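(* Let $d\ge 2$. Let $f\in L_\infty(\mathbb R^d)$ be compactly supported and let $g\in L_\infty(\mathbb S^{d-1})$. Then $$\big[\pi_1(f)(1-\Delta)^{-\frac12},\pi_2(g)\big]\in(\mathcal L_{d,\infty})_0,\qquad \big[\pi_1(f),\pi_2(g)(1-\Delta)^{-\frac12}\big]\in(\mathcal L_{d,\infty})_0.$$
   Context: For $f\in L_\infty(\mathbb R^d)$, $\pi_1(f)=M_f$ is multiplication by $f$ on $L_2(\mathbb R^d)$. For $g\in L_\infty(\mathbb S^{d-1})$, $\pi_2(g)$ is the Fourier multiplier on $L_2(\mathbb R^d)$ with symbol $s\mapsto g(s/|s|)$. $\Delta$ is the Laplacian on $\mathbb R^d$. For a bounded operator $T$ on a complex separable Hilbert space and $t>0$, $\mu(t,T)=\inf\{\|T-R\|:\ \mathrm{rank}(R)\leq t\}$ (operator norm). $\mathcal L_{p,\infty}$ is the set of compact operators $T$ with $\sup_{t>0}t^{1/p}\mu(t,T)<\infty$, and $(\mathcal L_{p,\infty})_0=\{T\in\mathcal L_{p,\infty}:\ \lim_{t\to\infty}t^{1/p}\mu(t,T)=0\}$. *)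

theory Defs
  imports "HOL-Analysis.Analysis"
begin

section \<open>The complex Hilbert space of square-integrable functions\<close>

definition square_integrable :: "('a::euclidean_space \<Rightarrow> complex) \<Rightarrow> bool" where
  "square_integrable u \<longleftrightarrow>
     u \<in> borel_measurable lborel \<and> integrable lborel (\<lambda>x. (cmod (u x))\<^sup>2)"

definition l2_rel :: "('a::euclidean_space \<Rightarrow> complex) \<Rightarrow> ('a \<Rightarrow> complex) \<Rightarrow> bool" where
  "l2_rel u v \<longleftrightarrow> square_integrable u \<and> square_integrable v \<and> (AE x in lborel. u x = v x)"

lemma square_integrable_zero: "square_integrable (\<lambda>_. 0)"
  by (simp add: square_integrable_def)

lemma square_integrable_mult:
  assumes "square_integrable u" "square_integrable v"
  shows "integrable lborel (\<lambda>x. u x * cnj (v x))"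
proof (rule Bochner_Integration.integrable_bound)
  show "integrable lborel (\<lambda>x. (cmod (u x))\<^sup>2 + (cmod (v x))\<^sup>2)"
    using assms by (auto simp: square_integrable_def)
  show "(\<lambda>x. u x * cnj (v x)) \<in> borel_measurable lborel"
  proof -
    have m: "u \<in> borel_measurable lborel" "v \<in> borel_measurable lborel"
      using assms by (auto simp: square_integrable_def)
    have "(\<lambda>x. cnj (v x)) \<in> borel_measurable lborel"
      by (rule borel_measurable_continuous_on[OF _ m(2)]) (intro continuous_intros)
    with m(1) show ?thesis by (rule borel_measurable_times)
  qed
  have "a * b \<le> a\<^sup>2 + b\<^sup>2" if "a \<ge> 0" "b \<ge> 0" for a b :: real
  proof -
    have "2 * a * b \<le> a\<^sup>2 + b\<^sup>2" by (rule sum_squares_bound)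
    moreover have "0 \<le> a * b" using that by simp
    ultimately show ?thesis by linarith
  qed
  then show "AE x in lborel. norm (u x * cnj (v x)) \<le> norm ((cmod (u x))\<^sup>2 + (cmod (v x))\<^sup>2)"
    by (auto simp: norm_mult)
qed

lemma square_integrable_add:
  assumes "square_integrable u" "square_integrable v"
  shows "square_integrable (\<lambda>x. u x + v x)"
proof -
  have m: "u \<in> borel_measurable lborel" "v \<in> borel_measurable lborel"
    using assms by (auto simp: square_integrable_def)
  have "integrable lborel (\<lambda>x. (cmod (u x + v x))\<^sup>2)"
  proof (rule Bochner_Integration.integrable_bound)
    show "integrable lborel (\<lambda>x. 2 * (cmod (u x))\<^sup>2 + 2 * (cmod (v x))\<^sup>2)"
      using assms by (auto simp: square_integrable_def)
    show "(\<lambda>x. (cmod (u x + v x))\<^sup>2) \<in> borel_measurable lborel"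
      using m by simp
    have "(cmod (a + b))\<^sup>2 \<le> 2 * (cmod a)\<^sup>2 + 2 * (cmod b)\<^sup>2" for a b
    proof -
      have "(cmod (a + b))\<^sup>2 \<le> (cmod a + cmod b)\<^sup>2"
        by (intro power_mono norm_triangle_ineq) auto
      also have "\<dots> \<le> 2 * (cmod a)\<^sup>2 + 2 * (cmod b)\<^sup>2"
        using sum_squares_bound[of "cmod a" "cmod b"] by (simp add: power2_sum)
      finally show ?thesis .
    qed
    then show "AE x in lborel. norm ((cmod (u x + v x))\<^sup>2)
        \<le> norm (2 * (cmod (u x))\<^sup>2 + 2 * (cmod (v x))\<^sup>2)"
      by auto
  qed
  then show ?thesis using m by (simp add: square_integrable_def)
qed

lemma square_integrable_scale:
  assumes "square_integrable u"
  shows "square_integrable (\<lambda>x. c * u x)"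
  using assms by (auto simp: square_integrable_def norm_mult power_mult_distrib)

lemma square_integrable_diff:
  assumes "square_integrable u" "square_integrable v"
  shows "square_integrable (\<lambda>x. u x - v x)"
  using square_integrable_add[OF assms(1) square_integrable_scale[OF assms(2), of "-1"]] by simp

lemma l2_rel_eqI:
  assumes "square_integrable v" "\<And>x. u x = v x"
  shows "l2_rel u v"
proof -
  have "u = v" using assms(2) by auto
  with assms(1) show ?thesis by (simp add: l2_rel_def)
qed

lemma part_equivp_l2_rel: "part_equivp l2_rel"
proof (rule part_equivpI)
  show "\<exists>u. l2_rel u u"
    by (rule exI[where x="\<lambda>_. 0"]) (simp add: l2_rel_def square_integrable_zero)
  show "symp l2_rel" by (auto simp: symp_def l2_rel_def)
  show "transp l2_rel" by (auto simp: transp_def l2_rel_def)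
qed

quotient_type (overloaded) 'a l2 = "'a::euclidean_space \<Rightarrow> complex" / partial: "l2_rel"
  by (rule part_equivp_l2_rel)

instantiation l2 :: (euclidean_space) real_vector
begin

lift_definition zero_l2 :: "'a l2" is "\<lambda>_. 0"
  by (simp add: l2_rel_def square_integrable_zero)

lift_definition plus_l2 :: "'a l2 \<Rightarrow> 'a l2 \<Rightarrow> 'a l2" is "\<lambda>u v x. u x + v x"
  by (auto simp: l2_rel_def square_integrable_add)

lift_definition uminus_l2 :: "'a l2 \<Rightarrow> 'a l2" is "\<lambda>u x. - u x"
  by (auto simp: l2_rel_def square_integrable_def)

lift_definition minus_l2 :: "'a l2 \<Rightarrow> 'a l2 \<Rightarrow> 'a l2" is "\<lambda>u v x. u x - v x"
  by (auto simp: l2_rel_def square_integrable_diff)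

lift_definition scaleR_l2 :: "real \<Rightarrow> 'a l2 \<Rightarrow> 'a l2" is "\<lambda>r u x. of_real r * u x"
  by (auto simp: l2_rel_def square_integrable_scale)

instance
proof
  fix u v w :: "'a l2" and r r' :: real
  show "u + v + w = u + (v + w)"
    by transfer (rule l2_rel_eqI; simp add: l2_rel_def square_integrable_add add.assoc)
  show "u + v = v + u"
    by transfer (rule l2_rel_eqI; simp add: l2_rel_def square_integrable_add add.commute)
  show "0 + u = u"
    by transfer (rule l2_rel_eqI; simp add: l2_rel_def)
  show "- u + u = 0"
    by transfer (rule l2_rel_eqI; simp add: square_integrable_zero)
  show "u - v = u + - v"
    by transfer (rule l2_rel_eqI; simp add: l2_rel_def square_integrable_diff)
  show "r *\<^sub>R (u + v) = r *\<^sub>R u + r *\<^sub>R v"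
    by transfer (rule l2_rel_eqI; simp add: l2_rel_def square_integrable_add
        square_integrable_scale distrib_left)
  show "(r + r') *\<^sub>R u = r *\<^sub>R u + r' *\<^sub>R u"
    by transfer (rule l2_rel_eqI; simp add: l2_rel_def square_integrable_add
        square_integrable_scale distrib_right)
  show "r *\<^sub>R r' *\<^sub>R u = (r * r') *\<^sub>R u"
    by transfer (rule l2_rel_eqI; simp add: l2_rel_def square_integrable_scale mult.assoc)
  show "1 *\<^sub>R u = u"
    by transfer (rule l2_rel_eqI; simp add: l2_rel_def)
qed

end

lift_definition scaleC :: "complex \<Rightarrow> 'a::euclidean_space l2 \<Rightarrow> 'a l2" is "\<lambda>c u x. c * u x"
  by (auto simp: l2_rel_def square_integrable_scale)

global_interpretation l2: vector_space "scaleC :: complex \<Rightarrow> 'a::euclidean_space l2 \<Rightarrow> 'a l2"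
proof
  fix c c' :: complex and u v :: "'a l2"
  show "scaleC c (u + v) = scaleC c u + scaleC c v"
    by transfer (rule l2_rel_eqI; simp add: l2_rel_def square_integrable_add
        square_integrable_scale distrib_left)
  show "scaleC (c + c') u = scaleC c u + scaleC c' u"
    by transfer (rule l2_rel_eqI; simp add: l2_rel_def square_integrable_add
        square_integrable_scale distrib_right)
  show "scaleC c (scaleC c' u) = scaleC (c * c') u"
    by transfer (rule l2_rel_eqI; simp add: l2_rel_def square_integrable_scale mult.assoc)
  show "scaleC 1 u = u"
    by transfer (rule l2_rel_eqI; simp add: l2_rel_def)
qed

lift_definition cinner :: "'a::euclidean_space l2 \<Rightarrow> 'a l2 \<Rightarrow> complex"
  is "\<lambda>u v. LINT x|lborel. u x * cnj (v x)"
proof -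
  fix u u' v v' :: "'a \<Rightarrow> complex"
  assume A: "l2_rel u u'" "l2_rel v v'"
  show "(LINT x|lborel. u x * cnj (v x)) = (LINT x|lborel. u' x * cnj (v' x))"
    using A square_integrable_mult[of u v] square_integrable_mult[of u' v']
    by (intro integral_cong_AE) (auto simp: l2_rel_def)
qed

lemma cinner_commute: "cinner v u = cnj (cinner u v)"
  by transfer (subst Bochner_Integration.integral_cnj[symmetric], simp add: mult.commute)

lemma cinner_add: "cinner (u + w) v = cinner u v + cinner w v"
  by transfer (simp add: l2_rel_def square_integrable_mult distrib_right)

lemma cinner_scaleR: "cinner (r *\<^sub>R u) v = of_real r * cinner u v"
  by transfer (simp add: mult.assoc)

lemma integral_mult_cnj_self:
  "(LINT x|lborel. u x * cnj (u x)) = complex_of_real (LINT x|lborel. (cmod (u x))\<^sup>2)"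
  unfolding complex_norm_square[symmetric] by (rule integral_complex_of_real)

lemma cinner_self_nonneg: "0 \<le> Re (cinner u u)"
  by transfer (simp add: integral_mult_cnj_self)

lemma cinner_self_eq_0: "Re (cinner u u) = 0 \<longleftrightarrow> u = 0"
proof transfer
  fix u :: "'a \<Rightarrow> complex"
  assume "l2_rel u u"
  then have i: "integrable lborel (\<lambda>x. (cmod (u x))\<^sup>2)" and s: "square_integrable u"
    by (auto simp: l2_rel_def square_integrable_def)
  have "Re (LINT x|lborel. u x * cnj (u x)) = (LINT x|lborel. (cmod (u x))\<^sup>2)"
    by (simp add: integral_mult_cnj_self)
  then show "(Re (LINT x|lborel. u x * cnj (u x)) = 0) = l2_rel u (\<lambda>_. 0)"
    using integral_nonneg_eq_0_iff_AE[OF i] s by (simp add: l2_rel_def square_integrable_zero)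
qed

instantiation l2 :: (euclidean_space) real_inner
begin

definition inner_l2 :: "'a l2 \<Rightarrow> 'a l2 \<Rightarrow> real" where "inner_l2 u v = Re (cinner u v)"
definition norm_l2 :: "'a l2 \<Rightarrow> real" where "norm_l2 u = sqrt (inner u u)"
definition dist_l2 :: "'a l2 \<Rightarrow> 'a l2 \<Rightarrow> real" where "dist_l2 u v = norm (u - v)"
definition sgn_l2 :: "'a l2 \<Rightarrow> 'a l2" where "sgn_l2 u = u /\<^sub>R norm u"
definition uniformity_l2 :: "('a l2 \<times> 'a l2) filter" where
  "uniformity_l2 = (INF e\<in>{0 <..}. principal {(u, v). dist u v < e})"
definition open_l2 :: "'a l2 set \<Rightarrow> bool" where
  "open_l2 U \<longleftrightarrow> (\<forall>u\<in>U. \<forall>\<^sub>F (u', v) in uniformity. u' = u \<longrightarrow> v \<in> U)"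

instance
proof
  fix u v w :: "'a l2" and r :: real and U :: "'a l2 set"
  show "dist u v = norm (u - v)" by (rule dist_l2_def)
  show "sgn u = u /\<^sub>R norm u" by (rule sgn_l2_def)
  show "uniformity = (INF e\<in>{0 <..}. principal {(u, v::'a l2). dist u v < e})"
    by (rule uniformity_l2_def)
  show "open U \<longleftrightarrow> (\<forall>u\<in>U. \<forall>\<^sub>F (u', v) in uniformity. u' = u \<longrightarrow> v \<in> U)" by (rule open_l2_def)
  show "inner u v = inner v u" by (subst inner_l2_def, subst cinner_commute) (simp add: inner_l2_def)
  show "inner (u + v) w = inner u w + inner v w" by (simp add: inner_l2_def cinner_add)
  show "inner (r *\<^sub>R u) v = r * inner u v" by (simp add: inner_l2_def cinner_scaleR)
  show "0 \<le> inner u u" by (simp add: inner_l2_def cinner_self_nonneg)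
  show "inner u u = 0 \<longleftrightarrow> u = 0" by (simp add: inner_l2_def cinner_self_eq_0)
  show "norm u = sqrt (inner u u)" by (rule norm_l2_def)
qed

end


section \<open>Singular values and weak Schatten ideals\<close>

definition bounded_clinear :: "('a::euclidean_space l2 \<Rightarrow> 'a l2) \<Rightarrow> bool" where
  "bounded_clinear T \<longleftrightarrow> bounded_linear T \<and> (\<forall>c u. T (scaleC c u) = scaleC c (T u))"

text \<open>The complex dimension of the range of \<open>R\<close> is at most \<open>t\<close>.\<close>

definition rank_le :: "('a::euclidean_space l2 \<Rightarrow> 'a l2) \<Rightarrow> real \<Rightarrow> bool" where
  "rank_le R t \<longleftrightarrow> (\<exists>S. finite S \<and> real (card S) \<le> t \<and> range R \<subseteq> l2.span S)"

definition singular_value :: "real \<Rightarrow> ('a::euclidean_space l2 \<Rightarrow> 'a l2) \<Rightarrow> real" where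
  "singular_value t T = Inf {onorm (\<lambda>u. T u - R u) | R. bounded_clinear R \<and> rank_le R t}"

definition compact_operator :: "('a::euclidean_space l2 \<Rightarrow> 'a l2) \<Rightarrow> bool" where
  "compact_operator T \<longleftrightarrow> bounded_clinear T \<and> compact (closure (T ` cball 0 1))"

definition weak_schatten :: "real \<Rightarrow> ('a::euclidean_space l2 \<Rightarrow> 'a l2) set" where
  "weak_schatten p =
     {T. compact_operator T \<and> bdd_above ((\<lambda>t. t powr (1 / p) * singular_value t T) ` {0<..})}"

definition weak_schatten_0 :: "real \<Rightarrow> ('a::euclidean_space l2 \<Rightarrow> 'a l2) set" where
  "weak_schatten_0 p =
     {T \<in> weak_schatten p. ((\<lambda>t. t powr (1 / p) * singular_value t T) \<longlongrightarrow> 0) at_top}"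

definition commutator ::
    "('a::euclidean_space l2 \<Rightarrow> 'a l2) \<Rightarrow> ('a l2 \<Rightarrow> 'a l2) \<Rightarrow> 'a l2 \<Rightarrow> 'a l2" where
  "commutator A B = (\<lambda>u. A (B u) - B (A u))"


section \<open>Multiplication operators and Fourier multipliers\<close>

definition L_infinity :: "'b measure \<Rightarrow> ('b \<Rightarrow> complex) set" where
  "L_infinity M = {f \<in> borel_measurable M. \<exists>C. AE x in M. cmod (f x) \<le> C}"

definition compactly_supported :: "('a::euclidean_space \<Rightarrow> complex) \<Rightarrow> bool" where
  "compactly_supported f \<longleftrightarrow> (\<exists>K. compact K \<and> (AE x in lborel. x \<notin> K \<longrightarrow> f x = 0))"

text \<open>
  Surface measure on the unit sphere, as cone measure: a Borel set \<open>A\<close> of the sphere has measure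
  \<open>d\<close> times the Lebesgue measure of the cone of all \<open>r \<theta>\<close> with \<open>0 < r \<le> 1\<close> and \<open>\<theta> \<in> A\<close>.
\<close>

definition sphere_measure :: "'a::euclidean_space measure" where
  "sphere_measure = scale_measure (of_nat DIM('a))
     (distr (restrict_space lborel (cball 0 1 - {0})) (restrict_space borel (sphere 0 1))
       (\<lambda>x. x /\<^sub>R norm x))"

text \<open>
  On vectors \<open>u\<close> for which \<open>m u\<close> is not square-integrable the value is unspecified;
  for essentially bounded \<open>m\<close> there are no such vectors.
\<close>

definition mult_op :: "('a::euclidean_space \<Rightarrow> complex) \<Rightarrow> 'a l2 \<Rightarrow> 'a l2" where
  "mult_op m u = abs_l2 (\<lambda>x. m x * rep_l2 u x)"

definition fourier_integral :: "('a::euclidean_space \<Rightarrow> complex) \<Rightarrow> 'a \<Rightarrow> complex" where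
  "fourier_integral u s =
     of_real ((2 * pi) powr (- real DIM('a) / 2)) * (LINT x|lborel. cis (- (x \<bullet> s)) * u x)"

text \<open>
  The unitary Fourier transform of Plancherel's theorem: the limit in mean of the Fourier integrals
  over the balls of radius \<open>n\<close>. A truncated square-integrable function is integrable.
\<close>

definition fourier :: "'a::euclidean_space l2 \<Rightarrow> 'a l2" where
  "fourier u =
     lim (\<lambda>n. abs_l2 (fourier_integral (\<lambda>x. indicator (cball 0 (real n)) x * rep_l2 u x)))"

definition fourier_multiplier :: "('a::euclidean_space \<Rightarrow> complex) \<Rightarrow> 'a l2 \<Rightarrow> 'a l2" where
  "fourier_multiplier m = inv fourier \<circ> mult_op m \<circ> fourier"

definition pi1 :: "('a::euclidean_space \<Rightarrow> complex) \<Rightarrow> 'a l2 \<Rightarrow> 'a l2" where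
  "pi1 f = mult_op f"

text \<open>The symbol at the origin, a null set, is irrelevant.\<close>

definition pi2 :: "('a::euclidean_space \<Rightarrow> complex) \<Rightarrow> 'a l2 \<Rightarrow> 'a l2" where
  "pi2 g = fourier_multiplier (\<lambda>s. g (s /\<^sub>R norm s))"

text \<open>
  Functional calculus of the self-adjoint Laplacian \<open>\<Delta>\<close>: with the above normalisation of the
  exponent, the Fourier transform carries \<open>\<Delta>\<close> to multiplication by \<open>- |s|\<^sup>2\<close>.
\<close>

definition laplacian_calculus :: "(real \<Rightarrow> real) \<Rightarrow> 'a::euclidean_space l2 \<Rightarrow> 'a l2" where
  "laplacian_calculus \<phi> = fourier_multiplier (\<lambda>s. of_real (\<phi> (- (norm s)\<^sup>2)))"

definition bessel_potential :: "'a::euclidean_space l2 \<Rightarrow> 'a l2" where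
  "bessel_potential = laplacian_calculus (\<lambda>z. (1 - z) powr (- 1 / 2))"

end

theory Submission
  imports Defs "HOL-Probability.Characteristic_Functions"
begin

text \<open>
  Let \<open>m(s) = g(s/|s|) (1 + |s|\<^sup>2)\<^bsup>-1/2\<^esup>\<close>. Both commutators reduce to \<open>[f, m(D)]\<close>: the second one is of this
  form, and the first one is \<open>[f, g(D) b(D)] - g(D) [f, b(D)]\<close> with \<open>b\<close> the Bessel symbol. It suffices to
  approximate \<open>[f, m(D)]\<close> by operators of rank \<open>O(N\<^sup>d)\<close> up to \<open>o(1/N)\<close>. Split the symbol at the frequencies
  \<open>\<kappa> N\<close> and \<open>\<Lambda> N\<close>. The high part has norm \<open>O(1/(\<Lambda> N))\<close>. The low part is approximated, with rank
  \<open>O(N\<^sup>d)\<close> independently of \<open>\<kappa>\<close> and error \<open>O(\<kappa>/N)\<close>, by first-order Taylor expansion on the cells of a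
  lattice of mesh \<open>1/N\<close>; exponentials at lattice points are orthogonal on the frequency cube, so Bessel's
  inequality controls the error. As \<open>g(s/|s|)\<close> is homogeneous, the middle part is essentially
  \<open>N\<^sup>-\<^sup>1 q(s/N)\<close> with a fixed bounded, compactly supported \<open>q\<close>. There \<open>f\<close> and \<open>q\<close> may be replaced by
  band-limited functions, at the cost of operators of small Hilbert-Schmidt norm \<open>\<epsilon> N\<^bsup>d/2\<^esup>\<close>, that is, of rank
  \<open>N\<^sup>d\<close> up to \<open>\<epsilon>\<close>; for band-limited functions the Weyl relations make the commutator with \<open>q(D/N)\<close> of
  size \<open>O(1/N)\<close>. Plancherel's theorem is obtained by Gaussian regularisation.
\<close>

section \<open>The Hilbert space of square-integrable functions\<close>

text \<open>Since g is only bounded and measurable, the symbol has no smoothness in the angular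
  directions and no symbol calculus is available: commutators at frequencies about N are a priori
  just O(1/N) in norm, and the gain to o(1/N) has to be bought with rank. Scaling makes this
  possible. With the factor 1/N taken out, the middle symbol is one fixed q dilated by N, so
  [f, q(D/N)] need only be small; and the squared Hilbert-Schmidt norm of a(x) h(D/N) is N^d times
  its value for N = 1, so approximation in mean, which f and q always admit, costs a rank of order
  N^d. Both cut-offs of q are forced: 1/|s| is unbounded at 0 and, for d \<ge> 2, not
  square-integrable at infinity. Above the band the decay of the symbol suffices; below it the
  symbol is of order 1, so the norm gives nothing and rank has to be spent there too.\<close>

lemma square_integrable_rep_l2: "square_integrable (rep_l2 u)"
  using Quotient_rep_reflp[OF Quotient_l2, of u] by (simp add: l2_rel_def)

lemma abs_rep_l2 [simp]: "abs_l2 (rep_l2 u) = u"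
  by (rule Quotient_abs_rep[OF Quotient_l2])

lemma abs_l2_eq_iff:
  assumes "square_integrable U" "square_integrable V"
  shows "abs_l2 U = abs_l2 V \<longleftrightarrow> (AE x in lborel. U x = V x)"
  using Quotient_rel[OF Quotient_l2, of U V] assms by (auto simp: l2_rel_def)

lemma abs_l2_cong:
  assumes "square_integrable U" "V \<in> borel_measurable lborel" "AE x in lborel. U x = V x"
  shows "abs_l2 U = abs_l2 V" "square_integrable V"
proof -
  have i: "integrable lborel (\<lambda>x. (cmod (V x))\<^sup>2)"
    by (rule integrable_cong_AE_imp[where g="\<lambda>x. (cmod (U x))\<^sup>2"])
       (use assms in \<open>auto simp: square_integrable_def\<close>)
  then show "square_integrable V" using assms(2) by (simp add: square_integrable_def)
  then show "abs_l2 U = abs_l2 V" using assms abs_l2_eq_iff by blast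
qed

lemma rep_abs_l2:
  assumes "square_integrable U"
  shows "AE x in lborel. rep_l2 (abs_l2 U) x = U x"
  using abs_l2_eq_iff[OF square_integrable_rep_l2 assms, of "abs_l2 U"] by simp

lemma square_integrable_measurable [measurable_dest]:
  "square_integrable U \<Longrightarrow> U \<in> borel_measurable borel"
  by (simp add: square_integrable_def)

lemma rep_l2_measurable [measurable]: "rep_l2 u \<in> borel_measurable borel"
  by (rule square_integrable_measurable[OF square_integrable_rep_l2])

lemma l2_rel_refl: "square_integrable U \<Longrightarrow> l2_rel U U" by (simp add: l2_rel_def)

lemma abs_l2_add: "square_integrable U \<Longrightarrow> square_integrable V \<Longrightarrow> abs_l2 U + abs_l2 V = abs_l2 (\<lambda>x. U x + V x)"
  by (rule plus_l2.abs_eq) (simp_all add: l2_rel_refl)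

lemma abs_l2_diff: "square_integrable U \<Longrightarrow> square_integrable V \<Longrightarrow> abs_l2 U - abs_l2 V = abs_l2 (\<lambda>x. U x - V x)"
  by (rule minus_l2.abs_eq) (simp_all add: l2_rel_refl)

lemma abs_l2_scaleC: "square_integrable U \<Longrightarrow> scaleC c (abs_l2 U) = abs_l2 (\<lambda>x. c * U x)"
  by (rule scaleC.abs_eq) (simp_all add: l2_rel_refl)

lemma abs_l2_zero: "abs_l2 (\<lambda>_. 0) = 0"
  by (simp add: zero_l2_def)

lemma cinner_abs_l2:
  "square_integrable U \<Longrightarrow> square_integrable V \<Longrightarrow> cinner (abs_l2 U) (abs_l2 V) = (LINT x|lborel. U x * cnj (V x))"
  by (rule cinner.abs_eq) (simp_all add: l2_rel_refl)

lemma norm_l2_power2: "(norm (u::'a::euclidean_space l2))\<^sup>2 = Re (cinner u u)"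
  by (simp add: norm_l2_def inner_l2_def cinner_self_nonneg)

lemma cinner_self: "cinner u u = of_real ((norm u)\<^sup>2)"
proof -
  have "cinner u u = cnj (cinner u u)" by (rule cinner_commute)
  then have "Im (cinner u u) = 0" by (metis Reals_cnj_iff complex_is_Real_iff)
  then show ?thesis by (simp add: norm_l2_power2 complex_eq_iff)
qed

lemma norm_abs_l2:
  assumes "square_integrable U"
  shows "(norm (abs_l2 U))\<^sup>2 = (LINT x|lborel. (cmod (U x))\<^sup>2)"
  by (simp add: norm_l2_power2 cinner_abs_l2 assms integral_mult_cnj_self)

lemma nn_norm_abs_l2:
  assumes "square_integrable U"
  shows "(\<integral>\<^sup>+x. ennreal ((cmod (U x))\<^sup>2) \<partial>lborel) = ennreal ((norm (abs_l2 U))\<^sup>2)"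
  unfolding norm_abs_l2[OF assms]
  by (rule nn_integral_eq_integral) (use assms in \<open>auto simp: square_integrable_def\<close>)

lemma square_integrable_iff_nn:
  "square_integrable U \<longleftrightarrow> U \<in> borel_measurable borel \<and> (\<integral>\<^sup>+x. ennreal ((cmod (U x))\<^sup>2) \<partial>lborel) < \<infinity>"
  unfolding square_integrable_def
  by (auto simp: integrable_iff_bounded)

lemma cinner_add_right: "cinner u (v + w) = cinner u v + cinner u w"
  by (subst (1 2 3) cinner_commute) (simp add: cinner_add)

lemma cinner_scaleC: "cinner (scaleC c u) v = c * cinner u v"
  by transfer (simp add: mult.assoc)

lemma cinner_scaleC_right: "cinner u (scaleC c v) = cnj c * cinner u v"
  by (subst (1 2) cinner_commute) (simp add: cinner_scaleC)

lemma scaleR_scaleC: "r *\<^sub>R u = scaleC (of_real r) u"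
  by transfer (rule l2_rel_eqI; simp add: l2_rel_def square_integrable_scale)

lemma cinner_zero [simp]: "cinner 0 v = 0" "cinner v 0 = 0"
  using cinner_scaleC[of 0 0 v] cinner_scaleC_right[of v 0 0] by (simp_all add: l2.scale_zero_left)

lemma cinner_diff: "cinner (u - w) v = cinner u v - cinner w v"
  using cinner_add[of "u - w" w v] by (simp add: algebra_simps)

lemma cinner_diff_right: "cinner v (u - w) = cinner v u - cinner v w"
  using cinner_add_right[of v "u - w" w] by (simp add: algebra_simps)

lemma cinner_sum: "cinner (\<Sum>i\<in>I. u i) v = (\<Sum>i\<in>I. cinner (u i) v)"
  by (induction I rule: infinite_finite_induct) (auto simp: cinner_add)

lemma cinner_sum_right: "cinner v (\<Sum>i\<in>I. u i) = (\<Sum>i\<in>I. cinner v (u i))"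
  by (induction I rule: infinite_finite_induct) (auto simp: cinner_add_right)

lemma norm_scaleC: "norm (scaleC c u) = cmod c * norm u"
proof -
  have "complex_of_real ((norm (scaleC c u))\<^sup>2) = (c * cnj c) * cinner u u"
    by (simp only: cinner_self[symmetric] cinner_scaleC cinner_scaleC_right mult_ac)
  also have "\<dots> = of_real ((cmod c * norm u)\<^sup>2)"
    by (simp add: cinner_self power_mult_distrib complex_norm_square[symmetric])
  finally have "complex_of_real ((norm (scaleC c u))\<^sup>2) = of_real ((cmod c * norm u)\<^sup>2)" .
  then have "(norm (scaleC c u))\<^sup>2 = (cmod c * norm u)\<^sup>2" using of_real_eq_iff by blast
  then show ?thesis by (simp add: power2_eq_iff_nonneg)
qed

lemma cinner_bound: "cmod (cinner u v) \<le> norm u * norm v"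
proof (cases "cinner u v = 0")
  case False
  \<comment> \<open>A unimodular factor rotates the inner product onto the nonnegative reals, so
    that the real Cauchy-Schwarz inequality applies.\<close>
  define c where "c = cnj (sgn (cinner u v))"
  have "cmod c = 1" using False by (simp add: c_def norm_sgn)
  have "cinner (scaleC c u) v = of_real (cmod (cinner u v))"
    using False by (simp add: cinner_scaleC c_def sgn_eq complex_norm_square[symmetric] power2_eq_square mult.commute)
  then have "cmod (cinner u v) = inner (scaleC c u) v" by (simp add: inner_l2_def)
  also have "\<dots> \<le> norm (scaleC c u) * norm v" by (rule norm_cauchy_schwarz)
  finally show ?thesis by (simp add: norm_scaleC \<open>cmod c = 1\<close>)
qed simp

text \<open>Testing with \<open>v = u\<close> suffices. This is how operators known only through
  their matrix elements are bounded.\<close>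

lemma norm_le_of_cinner_bound:
  assumes "0 \<le> C" "\<And>v. cmod (cinner u v) \<le> C * norm v"
  shows "norm u \<le> C"
proof (cases "u = 0")
  case False
  have "(norm u)\<^sup>2 \<le> C * norm u"
    using assms(2)[of u] by (simp add: cinner_self norm_power)
  with False show ?thesis by (simp add: power2_eq_square)
qed (use assms in simp)

section \<open>Completeness and multiplication operators\<close>

text \<open>Fatou's lemma, applied to |U n - w|^2, shows that V and w agree almost everywhere. It
  serves to identify limits in mean with Fourier integrals, which converge pointwise.\<close>

lemma l2_limit_pointwise:
  assumes U: "\<And>n::nat. square_integrable (U n)" and lim: "(\<lambda>n. abs_l2 (U n)) \<longlonglongrightarrow> w"
    and V [measurable]: "V \<in> borel_measurable borel"
    and ae: "AE x in lborel. (\<lambda>n. U n x) \<longlonglongrightarrow> V x"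
  shows "square_integrable V" "abs_l2 V = w"
proof -
  note [measurable] = square_integrable_measurable[OF U]
  have "(\<integral>\<^sup>+x. ennreal ((cmod (V x - rep_l2 w x))\<^sup>2) \<partial>lborel)
      = (\<integral>\<^sup>+x. liminf (\<lambda>n. ennreal ((cmod (U n x - rep_l2 w x))\<^sup>2)) \<partial>lborel)"
  proof (rule nn_integral_cong_AE, use ae in eventually_elim)
    fix x assume "(\<lambda>n. U n x) \<longlonglongrightarrow> V x"
    then have "(\<lambda>n. ennreal ((cmod (U n x - rep_l2 w x))\<^sup>2)) \<longlonglongrightarrow> ennreal ((cmod (V x - rep_l2 w x))\<^sup>2)"
      by (intro tendsto_intros)
    then show "ennreal ((cmod (V x - rep_l2 w x))\<^sup>2) = liminf (\<lambda>n. ennreal ((cmod (U n x - rep_l2 w x))\<^sup>2))"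
      by (rule lim_imp_Liminf[OF trivial_limit_sequentially, symmetric])
  qed
  also have "\<dots> \<le> liminf (\<lambda>n. \<integral>\<^sup>+x. ennreal ((cmod (U n x - rep_l2 w x))\<^sup>2) \<partial>lborel)"
    by (rule nn_integral_liminf) auto
  also have "(\<lambda>n. \<integral>\<^sup>+x. ennreal ((cmod (U n x - rep_l2 w x))\<^sup>2) \<partial>lborel) = (\<lambda>n. ennreal ((norm (abs_l2 (U n) - w))\<^sup>2))"
  proof
    fix n
    have "abs_l2 (U n) - w = abs_l2 (\<lambda>x. U n x - rep_l2 w x)"
      using abs_l2_diff[OF U square_integrable_rep_l2, of n w] by simp
    then show "(\<integral>\<^sup>+x. ennreal ((cmod (U n x - rep_l2 w x))\<^sup>2) \<partial>lborel) = ennreal ((norm (abs_l2 (U n) - w))\<^sup>2)"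
      by (simp add: nn_norm_abs_l2[OF square_integrable_diff[OF U square_integrable_rep_l2]])
  qed
  also have "liminf (\<lambda>n. ennreal ((norm (abs_l2 (U n) - w))\<^sup>2)) = 0"
  proof -
    have "(\<lambda>n. ennreal ((norm (abs_l2 (U n) - w))\<^sup>2)) \<longlonglongrightarrow> ennreal ((norm (w - w))\<^sup>2)"
      by (intro tendsto_intros lim)
    then show ?thesis using lim_imp_Liminf[OF trivial_limit_sequentially] by fastforce
  qed
  finally have "(\<integral>\<^sup>+x. ennreal ((cmod (V x - rep_l2 w x))\<^sup>2) \<partial>lborel) = 0" by simp
  then have "AE x in lborel. rep_l2 w x = V x"
    by (subst (asm) nn_integral_0_iff_AE) (auto elim: eventually_mono)
  from abs_l2_cong[OF square_integrable_rep_l2 _ this] show "square_integrable V" "abs_l2 V = w"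
    by auto
qed

lemma integral_norm_mult_le:
  assumes "square_integrable U" "square_integrable V"
  shows "(LINT x|lborel. cmod (U x * V x)) \<le> norm (abs_l2 U) * norm (abs_l2 V)"
proof -
  have U': "square_integrable (\<lambda>x. of_real (cmod (U x)))" and V': "square_integrable (\<lambda>x. of_real (cmod (V x)))"
    using assms by (auto simp: square_integrable_def)
  have "(LINT x|lborel. cmod (U x * V x)) = Re (cinner (abs_l2 (\<lambda>x. of_real (cmod (U x)))) (abs_l2 (\<lambda>x. of_real (cmod (V x)))))"
    unfolding cinner_abs_l2[OF U' V']
    by (simp add: norm_mult flip: of_real_mult)
  also have "\<dots> \<le> norm (abs_l2 (\<lambda>x. complex_of_real (cmod (U x)))) * norm (abs_l2 (\<lambda>x. complex_of_real (cmod (V x))))"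
    by (rule order_trans[OF complex_Re_le_cmod cinner_bound])
  also have "norm (abs_l2 (\<lambda>x. complex_of_real (cmod (U x)))) = norm (abs_l2 U)"
    by (rule power2_eq_imp_eq) (auto simp: norm_abs_l2 U' assms)
  also have "norm (abs_l2 (\<lambda>x. complex_of_real (cmod (V x)))) = norm (abs_l2 V)"
    by (rule power2_eq_imp_eq) (auto simp: norm_abs_l2 V' assms)
  finally show ?thesis .
qed

lemma square_integrable_cnj: "square_integrable V \<Longrightarrow> square_integrable (\<lambda>x. cnj (V x))"
  unfolding square_integrable_def
  by (auto intro: borel_measurable_continuous_on[where f=cnj] continuous_intros)

lemma square_integrable_mult':
  assumes "square_integrable U" "square_integrable V"
  shows "integrable lborel (\<lambda>x. U x * V x)"
  using square_integrable_mult[OF assms(1) square_integrable_cnj[OF assms(2)]] by simp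

instance l2 :: (euclidean_space) complete_space
proof
  fix X :: "nat \<Rightarrow> 'a l2"
  assume C: "Cauchy X"
  \<comment> \<open>The weight W = sqrt h is square-integrable and has no zeros. Multiplied by W, a
    Cauchy sequence in mean becomes Cauchy in L1, which has an almost everywhere convergent
    subsequence; division by W transfers the convergence back.\<close>
  obtain h :: "'a \<Rightarrow> real" where h: "h \<in> borel_measurable lborel" "\<And>x. h x > 0" "integrable lborel h"
    using sigma_finite_measure.obtain_positive_integrable_function[OF lborel.sigma_finite_measure_axioms, where ?'a1='a] by metis
  define W where "W = (\<lambda>x. complex_of_real (sqrt (h x)))"
  have W: "square_integrable W" "\<And>x. W x \<noteq> 0"
    using h(2) less_imp_le[OF h(2)] h by (auto simp: W_def square_integrable_def less_imp_neq[symmetric])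
  define s where "s = (\<lambda>n x. rep_l2 (X n) x * W x)"
  have "\<exists>N. \<forall>i\<ge>N. \<forall>j\<ge>N. (LINT x|lborel. norm (s i x - s j x)) < e" if "e > 0" for e
  proof -
    have pos: "norm (abs_l2 W) + 1 > 0" by (smt (verit) norm_ge_zero)
    then have "e / (norm (abs_l2 W) + 1) > 0" using that by simp
    then obtain N where N: "\<And>i j. i \<ge> N \<Longrightarrow> j \<ge> N \<Longrightarrow> norm (X i - X j) < e / (norm (abs_l2 W) + 1)"
      using C by (metis Cauchy_def dist_norm)
    have "(LINT x|lborel. norm (s i x - s j x)) < e" if "i \<ge> N" "j \<ge> N" for i j
    proof -
      have "(LINT x|lborel. norm (s i x - s j x)) = (LINT x|lborel. cmod ((rep_l2 (X i) x - rep_l2 (X j) x) * W x))"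
        by (simp add: s_def algebra_simps)
      also have "\<dots> \<le> norm (X i - X j) * norm (abs_l2 W)"
        using integral_norm_mult_le[OF square_integrable_diff[OF square_integrable_rep_l2 square_integrable_rep_l2] W(1), of "X i" "X j"]
          abs_l2_diff[OF square_integrable_rep_l2 square_integrable_rep_l2, of "X i" "X j"] by simp
      also have "\<dots> \<le> norm (X i - X j) * (norm (abs_l2 W) + 1)" by (intro mult_left_mono) auto
      also have "\<dots> < e" using N[OF that] pos by (simp add: pos_less_divide_eq)
      finally show ?thesis .
    qed
    then show ?thesis by blast
  qed
  moreover have "integrable lborel (s n)" for n
    unfolding s_def by (rule square_integrable_mult'[OF square_integrable_rep_l2 W(1)])
  ultimately obtain r where r: "strict_mono r" "AE x in lborel. Cauchy (\<lambda>i. s (r i) x)"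
    using cauchy_L1_AE_cauchy_subseq[of lborel s] by blast
  define V where "V = (\<lambda>x. lim (\<lambda>i. rep_l2 (X (r i)) x))"
  have ae: "AE x in lborel. (\<lambda>i. rep_l2 (X (r i)) x) \<longlonglongrightarrow> V x"
    using r(2)
  proof eventually_elim
    fix x assume "Cauchy (\<lambda>i. s (r i) x)"
    then have "convergent (\<lambda>i. s (r i) x)" by (simp add: Cauchy_convergent_iff)
    then obtain l where "(\<lambda>i. s (r i) x) \<longlonglongrightarrow> l" by (auto simp: convergent_def)
    then have "(\<lambda>i. s (r i) x / W x) \<longlonglongrightarrow> l / W x" using W(2) by (intro tendsto_intros)
    then have "(\<lambda>i. rep_l2 (X (r i)) x) \<longlonglongrightarrow> l / W x" using W(2) by (simp add: s_def)
    then show "(\<lambda>i. rep_l2 (X (r i)) x) \<longlonglongrightarrow> V x" unfolding V_def by (simp add: limI)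
  qed
  have V: "V \<in> borel_measurable borel" unfolding V_def by measurable
  define Y where "Y = (\<lambda>j k x. rep_l2 (X (r k)) x - rep_l2 (X j) x)"
  have siV: "square_integrable V \<and> X \<longlonglongrightarrow> abs_l2 V"
  proof -
    \<comment> \<open>Fatou along the subsequence: the Cauchy estimate passes to the pointwise limit
      V. It yields both the square integrability of V and the convergence of the full
      sequence.\<close>
    have bnd: "(\<integral>\<^sup>+x. ennreal ((cmod (V x - rep_l2 (X j) x))\<^sup>2) \<partial>lborel) \<le> ennreal (e\<^sup>2)"
      if e: "\<And>i. i \<ge> j \<Longrightarrow> norm (X i - X j) \<le> e" "e \<ge> 0" for j e
    proof -
      have "(\<integral>\<^sup>+x. ennreal ((cmod (V x - rep_l2 (X j) x))\<^sup>2) \<partial>lborel)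
          = (\<integral>\<^sup>+x. liminf (\<lambda>n. ennreal ((cmod (Y j n x))\<^sup>2)) \<partial>lborel)"
      proof (rule nn_integral_cong_AE, use ae in eventually_elim)
        fix x assume "(\<lambda>n. rep_l2 (X (r n)) x) \<longlonglongrightarrow> V x"
        then have "(\<lambda>n. ennreal ((cmod (Y j n x))\<^sup>2)) \<longlonglongrightarrow> ennreal ((cmod (V x - rep_l2 (X j) x))\<^sup>2)"
          unfolding Y_def by (intro tendsto_intros)
        then show "ennreal ((cmod (V x - rep_l2 (X j) x))\<^sup>2) = liminf (\<lambda>n. ennreal ((cmod (Y j n x))\<^sup>2))"
          by (rule lim_imp_Liminf[OF trivial_limit_sequentially, symmetric])
      qed
      also have "\<dots> \<le> liminf (\<lambda>n. \<integral>\<^sup>+x. ennreal ((cmod (Y j n x))\<^sup>2) \<partial>lborel)"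
        by (rule nn_integral_liminf) (auto simp: Y_def)
      also have "(\<lambda>n. \<integral>\<^sup>+x. ennreal ((cmod (Y j n x))\<^sup>2) \<partial>lborel) = (\<lambda>n. ennreal ((norm (X (r n) - X j))\<^sup>2))"
        unfolding Y_def nn_norm_abs_l2[OF square_integrable_diff[OF square_integrable_rep_l2 square_integrable_rep_l2]]
          abs_l2_diff[OF square_integrable_rep_l2 square_integrable_rep_l2, symmetric] abs_rep_l2 ..
      also have "liminf (\<lambda>n. ennreal ((norm (X (r n) - X j))\<^sup>2)) \<le> liminf (\<lambda>n. ennreal (e\<^sup>2))"
      proof (rule Liminf_mono)
        show "\<forall>\<^sub>F n in sequentially. ennreal ((norm (X (r n) - X j))\<^sup>2) \<le> ennreal (e\<^sup>2)"
          using eventually_ge_at_top[of j]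
          by eventually_elim
             (use e(1) seq_suble[OF r(1)] in \<open>auto intro!: ennreal_leI power_mono intro: order_trans\<close>)
      qed
      finally show ?thesis by (simp add: Liminf_const)
    qed
    have ev: "\<exists>N. \<forall>j\<ge>N. (\<integral>\<^sup>+x. ennreal ((cmod (V x - rep_l2 (X j) x))\<^sup>2) \<partial>lborel) \<le> ennreal (e\<^sup>2)" if "e > 0" for e
    proof -
      obtain N where "\<And>i j. i \<ge> N \<Longrightarrow> j \<ge> N \<Longrightarrow> norm (X i - X j) < e"
        using C \<open>e > 0\<close> by (metis Cauchy_def dist_norm)
      then have "(\<integral>\<^sup>+x. ennreal ((cmod (V x - rep_l2 (X j) x))\<^sup>2) \<partial>lborel) \<le> ennreal (e\<^sup>2)" if "j \<ge> N" for j
        using that \<open>e > 0\<close> by (intro bnd) (auto intro: less_imp_le)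
      then show ?thesis by blast
    qed
    obtain N where "(\<integral>\<^sup>+x. ennreal ((cmod (V x - rep_l2 (X N) x))\<^sup>2) \<partial>lborel) \<le> ennreal (1\<^sup>2)"
      using ev[of 1] by auto
    then have "square_integrable (\<lambda>x. V x - rep_l2 (X N) x)"
      unfolding square_integrable_iff_nn using V by (auto simp: le_less_trans)
    from square_integrable_add[OF this square_integrable_rep_l2[of "X N"]]
    have V2: "square_integrable V" by simp
    moreover have "X \<longlonglongrightarrow> abs_l2 V"
      unfolding LIMSEQ_def
    proof (intro allI impI)
      fix e :: real assume "e > 0"
      then obtain N where N: "\<And>j. j \<ge> N \<Longrightarrow> (\<integral>\<^sup>+x. ennreal ((cmod (V x - rep_l2 (X j) x))\<^sup>2) \<partial>lborel) \<le> ennreal ((e/2)\<^sup>2)"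
        using ev[of "e/2"] by auto
      have "dist (X j) (abs_l2 V) < e" if "j \<ge> N" for j
      proof -
        have "ennreal ((norm (abs_l2 V - X j))\<^sup>2) \<le> ennreal ((e/2)\<^sup>2)"
          using N[OF that] nn_norm_abs_l2[OF square_integrable_diff[OF V2 square_integrable_rep_l2], of "X j"]
            abs_l2_diff[OF V2 square_integrable_rep_l2, of "X j"] by simp
        then have "norm (abs_l2 V - X j) \<le> e/2" using \<open>e > 0\<close>
          by (simp add: ennreal_le_iff power_mono_iff)
        then show ?thesis using \<open>e > 0\<close> by (simp add: dist_norm norm_minus_commute)
      qed
      then show "\<exists>N. \<forall>j\<ge>N. dist (X j) (abs_l2 V) < e" by blast
    qed
    ultimately show ?thesis by simp
  qed
  then show "convergent X" by (auto simp: convergent_def)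
qed

section \<open>Complex-linear maps and multiplication by essentially bounded functions\<close>

definition clinear :: "('a::euclidean_space l2 \<Rightarrow> 'a l2) \<Rightarrow> bool" where
  "clinear T \<longleftrightarrow> (\<forall>u v. T (u + v) = T u + T v) \<and> (\<forall>c u. T (scaleC c u) = scaleC c (T u))"

lemma clinear_add: "clinear T \<Longrightarrow> T (u + v) = T u + T v"
  and clinear_scaleC: "clinear T \<Longrightarrow> T (scaleC c u) = scaleC c (T u)"
  by (simp_all add: clinear_def)

lemma clinear_diff: "clinear T \<Longrightarrow> T (u - v) = T u - T v"
  using clinear_add[of T "u - v" v] by (simp add: algebra_simps)

lemma clinear_zero: "clinear T \<Longrightarrow> T 0 = 0"
  using clinear_scaleC[of T 0 0] by simp

lemma clinear_sum: "clinear T \<Longrightarrow> T (\<Sum>i\<in>I. u i) = (\<Sum>i\<in>I. T (u i))"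
  by (induction I rule: infinite_finite_induct) (auto simp: clinear_add clinear_zero)

lemma clinear_compose: "clinear S \<Longrightarrow> clinear T \<Longrightarrow> clinear (\<lambda>u. S (T u))"
  by (simp add: clinear_def)

lemma clinear_minus: "clinear S \<Longrightarrow> clinear T \<Longrightarrow> clinear (\<lambda>u. S u - T u)"
  by (simp add: clinear_def algebra_simps l2.scale_right_diff_distrib)

lemma bounded_clinearI:
  assumes "clinear T" "\<And>u. norm (T u) \<le> K * norm u"
  shows "bounded_clinear T"
  unfolding bounded_clinear_def
proof (intro conjI allI)
  show "bounded_linear T"
    by (rule bounded_linear_intro[where K=K])
       (use assms in \<open>auto simp: clinear_add clinear_scaleC scaleR_scaleC mult.commute\<close>)
qed (use assms(1) in \<open>simp add: clinear_scaleC\<close>)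

text \<open>The bound is kept as a parameter because it reappears as a bound for the norms of
  \<open>mult_op m\<close> and \<open>fourier_multiplier m\<close>.\<close>

definition ess_bounded :: "real \<Rightarrow> ('a::euclidean_space \<Rightarrow> complex) \<Rightarrow> bool" where
  "ess_bounded C m \<longleftrightarrow> m \<in> borel_measurable borel \<and> (AE x in lborel. cmod (m x) \<le> C)"

lemma ess_bounded_measurable [measurable_dest]: "ess_bounded C m \<Longrightarrow> m \<in> borel_measurable borel"
  by (simp add: ess_bounded_def)

text \<open>Lebesgue measure is not zero, so the bound dominates a modulus at some point.\<close>

lemma ess_bounded_nonneg: "ess_bounded C (m :: 'a::euclidean_space \<Rightarrow> complex) \<Longrightarrow> 0 \<le> C"
proof (rule ccontr)
  assume "ess_bounded C m" "\<not> 0 \<le> C"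
  then have "AE x in (lborel::'a measure). False"
    by (auto simp: ess_bounded_def elim!: eventually_mono) (smt (verit) norm_ge_zero)
  then show False using emeasure_lborel_UNIV
    by (simp add: AE_iff_null null_sets_def)
qed

lemma ess_bounded_add: "ess_bounded C m \<Longrightarrow> ess_bounded D n \<Longrightarrow> ess_bounded (C + D) (\<lambda>x. m x + n x)"
  unfolding ess_bounded_def by (auto intro: norm_triangle_mono)

lemma ess_bounded_diff: "ess_bounded C m \<Longrightarrow> ess_bounded D n \<Longrightarrow> ess_bounded (C + D) (\<lambda>x. m x - n x)"
  using ess_bounded_add[of C m D "\<lambda>x. - n x"] by (simp add: ess_bounded_def)

lemma ess_bounded_mult:
  assumes "ess_bounded C m" "ess_bounded D n"
  shows "ess_bounded (C * D) (\<lambda>x. m x * n x)"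
  using assms ess_bounded_nonneg[OF assms(1)] unfolding ess_bounded_def
  by (auto simp: norm_mult elim!: eventually_elim2 intro!: mult_mono)

lemma ess_bounded_cnj: "ess_bounded C m \<Longrightarrow> ess_bounded C (\<lambda>x. cnj (m x))"
  unfolding ess_bounded_def
  by (auto intro: borel_measurable_continuous_on[where f=cnj] continuous_intros)

lemma square_integrable_ess_bounded_mult:
  assumes "ess_bounded C m" "square_integrable U"
  shows "square_integrable (\<lambda>x. m x * U x)" "norm (abs_l2 (\<lambda>x. m x * U x)) \<le> C * norm (abs_l2 U)"
proof -
  note [measurable] = ess_bounded_measurable[OF assms(1)] square_integrable_measurable[OF assms(2)]
  have C: "0 \<le> C" by (rule ess_bounded_nonneg[OF assms(1)])
  have le: "AE x in lborel. (cmod (m x * U x))\<^sup>2 \<le> C\<^sup>2 * (cmod (U x))\<^sup>2"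
    using assms(1) unfolding ess_bounded_def
    by (auto simp: norm_mult power_mult_distrib elim!: eventually_mono intro!: mult_right_mono power_mono)
  have iU: "integrable lborel (\<lambda>x. C\<^sup>2 * (cmod (U x))\<^sup>2)" using assms(2) by (simp add: square_integrable_def)
  show si: "square_integrable (\<lambda>x. m x * U x)"
    unfolding square_integrable_def
  proof
    show "integrable lborel (\<lambda>x. (cmod (m x * U x))\<^sup>2)"
      by (rule Bochner_Integration.integrable_bound[OF iU]) (use le in auto)
  qed measurable
  have "(norm (abs_l2 (\<lambda>x. m x * U x)))\<^sup>2 \<le> (LINT x|lborel. C\<^sup>2 * (cmod (U x))\<^sup>2)"
    unfolding norm_abs_l2[OF si]
    by (rule integral_mono_AE[OF _ iU le]) (use si in \<open>simp add: square_integrable_def\<close>)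
  also have "\<dots> = (C * norm (abs_l2 U))\<^sup>2"
    by (simp add: norm_abs_l2 assms power_mult_distrib)
  finally show "norm (abs_l2 (\<lambda>x. m x * U x)) \<le> C * norm (abs_l2 U)"
    by (rule power2_le_imp_le) (simp add: C)
qed

lemma mult_op_abs:
  assumes "ess_bounded C m" "square_integrable U"
  shows "mult_op m (abs_l2 U) = abs_l2 (\<lambda>x. m x * U x)"
  unfolding mult_op_def
  by (rule abs_l2_cong(1)[OF square_integrable_ess_bounded_mult(1)[OF assms(1) square_integrable_rep_l2]])
     (use assms rep_abs_l2[OF assms(2)] in \<open>auto elim!: eventually_mono\<close>)

lemma l2_abs_induct [case_names abs]: "(\<And>U. square_integrable U \<Longrightarrow> P (abs_l2 U)) \<Longrightarrow> P u"
  using square_integrable_rep_l2[of u] abs_rep_l2[of u] by metis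

lemma norm_mult_op: "ess_bounded C m \<Longrightarrow> norm (mult_op m u) \<le> C * norm u"
  by (induction u rule: l2_abs_induct) (simp add: mult_op_abs square_integrable_ess_bounded_mult)

lemma clinear_mult_op:
  assumes m: "ess_bounded C m"
  shows "clinear (mult_op m)"
  unfolding clinear_def
proof safe
  fix u v :: "'a l2" and c
  note m' = square_integrable_ess_bounded_mult(1)[OF m]
  show "mult_op m (u + v) = mult_op m u + mult_op m v"
    by (induction u rule: l2_abs_induct; induction v rule: l2_abs_induct)
       (simp add: abs_l2_add mult_op_abs[OF m] square_integrable_add m' distrib_left)
  show "mult_op m (scaleC c u) = scaleC c (mult_op m u)"
    by (induction u rule: l2_abs_induct)
       (simp add: abs_l2_scaleC mult_op_abs[OF m] square_integrable_scale m' mult.left_commute)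
qed

lemma mult_op_mult:
  assumes "ess_bounded C m" "ess_bounded D n"
  shows "mult_op m (mult_op n u) = mult_op (\<lambda>x. m x * n x) u"
  by (induction u rule: l2_abs_induct)
     (simp add: mult_op_abs[OF assms(1)] mult_op_abs[OF assms(2)] mult_op_abs[OF ess_bounded_mult[OF assms]]
       square_integrable_ess_bounded_mult(1)[OF assms(2)] mult.assoc)

lemma mult_op_add:
  assumes "ess_bounded C m" "ess_bounded D n"
  shows "mult_op (\<lambda>x. m x + n x) u = mult_op m u + mult_op n u"
  by (induction u rule: l2_abs_induct)
     (simp add: mult_op_abs[OF assms(1)] mult_op_abs[OF assms(2)] mult_op_abs[OF ess_bounded_add[OF assms]]
       abs_l2_add square_integrable_ess_bounded_mult(1)[OF assms(1)] square_integrable_ess_bounded_mult(1)[OF assms(2)] distrib_right)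

lemma mult_op_cong:
  assumes "AE x in lborel. m x = n x" "ess_bounded C m" "ess_bounded D n"
  shows "mult_op m u = mult_op n u"
  by (induction u rule: l2_abs_induct, simp only: mult_op_abs[OF assms(2)] mult_op_abs[OF assms(3)])
     (subst abs_l2_eq_iff, use assms(1) in \<open>auto intro: square_integrable_ess_bounded_mult(1)[OF assms(2)]
       square_integrable_ess_bounded_mult(1)[OF assms(3)] elim!: eventually_mono\<close>)

lemma cinner_mult_op:
  assumes m: "ess_bounded C m"
  shows "cinner (mult_op m u) v = cinner u (mult_op (\<lambda>x. cnj (m x)) v)"
  by (induction u rule: l2_abs_induct; induction v rule: l2_abs_induct)
     (simp add: mult_op_abs[OF m] mult_op_abs[OF ess_bounded_cnj[OF m]] cinner_abs_l2
       square_integrable_ess_bounded_mult(1)[OF m] square_integrable_ess_bounded_mult(1)[OF ess_bounded_cnj[OF m]] mult.assoc mult.left_commute)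

section \<open>Gaussians and the multiplication formula\<close>

lemma cis_measurable [measurable]: "cis \<in> borel_measurable borel"
  by (intro borel_measurable_continuous_onI) (auto intro: continuous_intros)

lemma lborel_integral_affine:
  fixes f :: "'a::euclidean_space \<Rightarrow> 'b::{banach, second_countable_topology}"
  assumes "c \<noteq> 0" "f \<in> borel_measurable borel"
  shows "(LINT x|lborel. f x) = \<bar>c\<bar> ^ DIM('a) *\<^sub>R (LINT x|lborel. f (t + c *\<^sub>R x))"
  by (subst lborel_affine[OF assms(1), of t]) (use assms in \<open>simp add: integral_density integral_distr\<close>)

lemma lborel_integrable_affine:
  fixes f :: "'a::euclidean_space \<Rightarrow> 'b::{banach, second_countable_topology}"
  assumes "c \<noteq> 0" "f \<in> borel_measurable borel"
  shows "integrable lborel (\<lambda>x. f (t + c *\<^sub>R x)) \<longleftrightarrow> integrable lborel f"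
proof -
  have iff: "integrable lborel (\<lambda>x. k *\<^sub>R g x) \<longleftrightarrow> integrable lborel g" if "k \<noteq> 0" for k :: real and g :: "'a \<Rightarrow> 'b"
    using integrable_scaleR_right[of "inverse k" lborel "\<lambda>x. k *\<^sub>R g x"] that by auto
  show ?thesis
    by (subst (2) lborel_affine[OF assms(1), of t])
       (use assms in \<open>simp add: integrable_density integrable_distr_eq iff\<close>)
qed

lemma AE_lborel_affine:
  fixes t :: "'a::euclidean_space"
  assumes "c \<noteq> 0" "AE x in lborel. P x"
  shows "AE x in lborel. P (t + c *\<^sub>R x)"
proof -
  obtain N where N: "N \<in> null_sets lborel" "{x. \<not> P x} \<subseteq> N"
    using assms(2) by (auto simp: eventually_ae_filter)
  have [measurable]: "N \<in> sets borel" using N(1) by auto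
  have "AE x in density (distr lborel borel (\<lambda>x. t + c *\<^sub>R x)) (\<lambda>_. \<bar>c\<bar>^DIM('a)). x \<notin> N"
    unfolding lborel_affine[OF assms(1), of t, symmetric] by (rule AE_not_in[OF N(1)])
  then have "AE x in lborel. t + c *\<^sub>R x \<notin> N"
    using assms(1) by (simp add: AE_density AE_distr_iff)
  then show ?thesis using N(2) by (auto elim!: eventually_mono)
qed

text \<open>Fubini, after \<open>lborel\<close> is identified with a product over the basis vectors.
  It evaluates the Gaussian and shows the orthogonality of exponentials on a cube.\<close>

lemma integrable_prod_Basis:
  fixes h :: "'a::euclidean_space \<Rightarrow> real \<Rightarrow> complex"
  assumes "\<And>b. b \<in> Basis \<Longrightarrow> integrable lborel (h b)"
  shows "integrable lborel (\<lambda>x. \<Prod>b\<in>Basis. h b (x \<bullet> b))"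
    and "(LINT x|lborel. (\<Prod>b\<in>Basis. h b (x \<bullet> b))) = (\<Prod>b\<in>Basis. (LINT t|lborel. h b t))"
proof -
  interpret product_sigma_finite "\<lambda>b::'a. lborel :: real measure"
    by (simp add: product_sigma_finite_def lborel.sigma_finite_measure_axioms)
  have [measurable]: "b \<in> Basis \<Longrightarrow> h b \<in> borel_measurable borel" for b
    using borel_measurable_integrable[OF assms] by simp
  have [measurable]: "(\<lambda>x. \<Prod>b\<in>Basis. h b (x \<bullet> b)) \<in> borel_measurable borel"
    by measurable
  have [measurable]: "(\<lambda>f. \<Sum>b\<in>Basis. f b *\<^sub>R b) \<in> (\<Pi>\<^sub>M b\<in>(Basis::'a set). (lborel::real measure)) \<rightarrow>\<^sub>M borel"
    by measurable
  have eq: "(\<Prod>b\<in>Basis. h b ((\<Sum>b\<in>Basis. f b *\<^sub>R b) \<bullet> b)) = (\<Prod>b\<in>Basis. h b (f b))" for f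
    by (rule prod.cong) auto
  show "integrable lborel (\<lambda>x. \<Prod>b\<in>Basis. h b (x \<bullet> b))"
    by (subst lborel_eq) (simp add: integrable_distr_eq eq product_integrable_prod assms)
  show "(LINT x|lborel. (\<Prod>b\<in>Basis. h b (x \<bullet> b))) = (\<Prod>b\<in>Basis. (LINT t|lborel. h b t))"
    by (subst lborel_eq) (simp add: integral_distr eq product_integral_prod assms)
qed

text \<open>Up to the dilation by e and a factor sqrt(2 pi) this is the characteristic function of
  the standard normal distribution at - t / e.\<close>

lemma gaussian_char_1d:
  assumes "e > 0"
  shows "integrable lborel (\<lambda>y. cis (- (t * y)) * of_real (exp (- (e * y)\<^sup>2 / 2)))"
    and "(LINT y|lborel. cis (- (t * y)) * of_real (exp (- (e * y)\<^sup>2 / 2)))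
       = of_real (sqrt (2 * pi) / e * exp (- (t / e)\<^sup>2 / 2))"
proof -
  define h where "h = (\<lambda>t y. cis (- (t * y)) * complex_of_real (exp (- y\<^sup>2 / 2)))"
  have [measurable]: "h t \<in> borel_measurable borel" for t unfolding h_def by measurable
  have hs: "h t y = sqrt (2 * pi) *\<^sub>R (std_normal_density y *\<^sub>R iexp ((- t) * y))" for t y
    by (simp add: h_def std_normal_density_def cis_conv_exp scaleR_conv_of_real exp_of_real mult.commute)
  have "integrable lborel (\<lambda>y. std_normal_density y *\<^sub>R iexp ((- t) * y))" for t
    by (rule Bochner_Integration.integrable_bound[OF integrable_std_normal_moment[of 0]])
       (auto simp: norm_mult)
  then have int: "integrable lborel (h t)" for t unfolding hs by (rule integrable_scaleR_right)
  have char: "(LINT y|lborel. h t y) = of_real (sqrt (2 * pi) * exp (- t\<^sup>2 / 2))" for t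
  proof -
    have "(LINT y|lborel. h t y) = sqrt (2 * pi) *\<^sub>R (LINT y|lborel. std_normal_density y *\<^sub>R iexp ((- t) * y))"
      unfolding hs by (rule integral_scaleR_right)
    also have "(LINT y|lborel. std_normal_density y *\<^sub>R iexp ((- t) * y)) = char std_normal_distribution (- t)"
      unfolding char_def by (subst integral_density) (auto simp: normal_density_nonneg)
    finally show ?thesis by (simp add: char_std_normal_distribution scaleR_conv_of_real)
  qed
  have eq: "cis (- (t * y)) * complex_of_real (exp (- (e * y)\<^sup>2 / 2)) = h (t / e) (0 + e *\<^sub>R y)" for y
    using assms by (simp add: h_def)
  show "integrable lborel (\<lambda>y. cis (- (t * y)) * of_real (exp (- (e * y)\<^sup>2 / 2)))"
    unfolding eq using assms by (subst lborel_integrable_affine) (auto simp: int)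
  have "(LINT y|lborel. h (t / e) y) = e *\<^sub>R (LINT y|lborel. h (t / e) (0 + e *\<^sub>R y))"
    using lborel_integral_affine[of e "h (t / e)" 0] assms by simp
  then show "(LINT y|lborel. cis (- (t * y)) * of_real (exp (- (e * y)\<^sup>2 / 2)))
       = of_real (sqrt (2 * pi) / e * exp (- (t / e)\<^sup>2 / 2))"
    unfolding eq char using assms by (simp add: scaleR_conv_of_real field_simps)
qed

lemma cis_sum: "finite A \<Longrightarrow> cis (\<Sum>a\<in>A. f a) = (\<Prod>a\<in>A. cis (f a))"
  by (induction A rule: finite_induct) (auto simp: cis_mult[symmetric])

lemma gaussian_char:
  fixes x :: "'a::euclidean_space"
  assumes "e > 0"
  shows "integrable lborel (\<lambda>s. cis (- (x \<bullet> s)) * of_real (exp (- (e * norm s)\<^sup>2 / 2)))"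
    and "(LINT s|lborel. cis (- (x \<bullet> s)) * of_real (exp (- (e * norm s)\<^sup>2 / 2)))
       = of_real ((sqrt (2 * pi) / e) ^ DIM('a) * exp (- (norm x / e)\<^sup>2 / 2))"
proof -
  have nrm: "(norm s)\<^sup>2 = (\<Sum>b\<in>Basis. (s \<bullet> b)\<^sup>2)" for s :: 'a
    by (subst power2_norm_eq_inner, subst euclidean_inner) (simp add: power2_eq_square)
  have eq: "cis (- (x \<bullet> s)) * complex_of_real (exp (- (e * norm s)\<^sup>2 / 2))
      = (\<Prod>b\<in>Basis. cis (- ((x \<bullet> b) * (s \<bullet> b))) * of_real (exp (- (e * (s \<bullet> b))\<^sup>2 / 2)))" for s
    by (simp add: prod.distrib cis_sum[symmetric] exp_sum[symmetric] nrm power_mult_distrib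
        euclidean_inner[of x s] sum_negf sum_divide_distrib sum_distrib_left flip: of_real_prod)
  show "integrable lborel (\<lambda>s. cis (- (x \<bullet> s)) * of_real (exp (- (e * norm s)\<^sup>2 / 2)))"
    unfolding eq by (rule integrable_prod_Basis(1)) (rule gaussian_char_1d(1)[OF assms])
  have "(LINT s|lborel. cis (- (x \<bullet> s)) * of_real (exp (- (e * norm s)\<^sup>2 / 2)))
      = (\<Prod>b\<in>Basis. of_real (sqrt (2 * pi) / e * exp (- ((x \<bullet> b) / e)\<^sup>2 / 2)))"
    unfolding eq
    by (rule trans[OF integrable_prod_Basis(2)[OF gaussian_char_1d(1)[OF assms]] prod.cong[OF refl gaussian_char_1d(2)[OF assms]]])
  also have "\<dots> = of_real ((sqrt (2 * pi) / e) ^ DIM('a) * exp (- (norm x / e)\<^sup>2 / 2))"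
    unfolding of_real_prod[symmetric]
    by (simp add: prod.distrib prod_dividef exp_sum[symmetric] nrm power_divide sum_negf sum_divide_distrib)
  finally show "(LINT s|lborel. cis (- (x \<bullet> s)) * of_real (exp (- (e * norm s)\<^sup>2 / 2)))
       = of_real ((sqrt (2 * pi) / e) ^ DIM('a) * exp (- (norm x / e)\<^sup>2 / 2))" .
qed

section \<open>The normalising constant and the multiplication formula\<close>

definition fourier_const :: "'a::euclidean_space itself \<Rightarrow> real" where
  "fourier_const _ = (2 * pi) powr (- real DIM('a) / 2)"

lemma fourier_const_pos: "fourier_const TYPE('a::euclidean_space) > 0"
  by (simp add: fourier_const_def)

lemma fourier_const_sqrt: "fourier_const TYPE('a::euclidean_space) * sqrt (2 * pi) ^ DIM('a) = 1"
proof -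
  have "sqrt (2 * pi) ^ DIM('a) = (2 * pi) powr (1/2 * real DIM('a))"
    by (simp add: powr_half_sqrt[symmetric] powr_realpow[symmetric] powr_powr)
  then show ?thesis unfolding fourier_const_def by (simp add: powr_add[symmetric])
qed

text \<open>In the low-frequency estimate (2 pi N)^d comes from the cube of periods and N^(-d) from
  the volume of a cell; the square of the constant cancels what remains.\<close>

lemma fourier_const_power2: "(fourier_const TYPE('a::euclidean_space))\<^sup>2 * (2 * pi) ^ DIM('a) = 1"
proof -
  have "(2 * pi) ^ DIM('a) = (sqrt (2 * pi) ^ DIM('a))\<^sup>2"
    by (simp add: power_mult[symmetric] mult.commute[of _ 2]) (simp add: power_mult)
  then show ?thesis
    by (simp only: power_mult_distrib[symmetric] fourier_const_sqrt) simp
qed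

lemma fourier_integral_alt:
  "fourier_integral u s = of_real (fourier_const TYPE('a)) * (LINT x|lborel. cis (- (x \<bullet> s)) * u x)"
  for u :: "'a::euclidean_space \<Rightarrow> complex"
  by (simp add: fourier_integral_def fourier_const_def)

lemma integrable_cis_mult:
  fixes u :: "'a::euclidean_space \<Rightarrow> complex"
  assumes "integrable lborel u" "\<theta> \<in> borel_measurable borel"
  shows "integrable lborel (\<lambda>x. cis (\<theta> x) * u x)"
  using assms borel_measurable_integrable[OF assms(1)]
  by (intro Bochner_Integration.integrable_bound[OF assms(1)]) (auto simp: norm_mult)

lemma fourier_integral_measurable [measurable]:
  assumes [measurable]: "u \<in> borel_measurable borel"
  shows "fourier_integral u \<in> borel_measurable borel"
  unfolding fourier_integral_def by measurable

lemma norm_fourier_integral_le: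
  fixes u :: "'a::euclidean_space \<Rightarrow> complex"
  shows "cmod (fourier_integral u s) \<le> fourier_const TYPE('a) * (LINT x|lborel. cmod (u x))"
proof -
  have "cmod (LINT x|lborel. cis (- (x \<bullet> s)) * u x) \<le> (LINT x|lborel. cmod (cis (- (x \<bullet> s)) * u x))"
    by (rule integral_norm_bound)
  then show ?thesis
    using fourier_const_pos[where ?'a='a]
    by (simp add: fourier_integral_alt norm_mult)
qed

lemma fourier_integral_diff:
  assumes "integrable lborel u" "integrable lborel v"
  shows "fourier_integral (\<lambda>x. u x - v x) s = fourier_integral u s - fourier_integral v s"
  using integrable_cis_mult[OF assms(1), of "\<lambda>x. - (x \<bullet> s)"] integrable_cis_mult[OF assms(2), of "\<lambda>x. - (x \<bullet> s)"]
  by (simp add: fourier_integral_def right_diff_distrib)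

text \<open>Fubini for the absolutely integrable kernel \<open>f\<close>. Plancherel's theorem, the
  adjoint of \<open>fourier\<close> and the expansion of band-limited multipliers all rest on this
  identity.\<close>

lemma fourier_integral_mult:
  fixes u v :: "'a::euclidean_space \<Rightarrow> complex"
  assumes u: "integrable lborel u" and v: "integrable lborel v"
  shows "(LINT s|lborel. fourier_integral u s * v s) = (LINT x|lborel. u x * fourier_integral v x)"
proof -
  have [measurable]: "u \<in> borel_measurable borel" "v \<in> borel_measurable borel"
    using borel_measurable_integrable[OF u] borel_measurable_integrable[OF v] by simp_all
  define f where "f = (\<lambda>x s. cis (- (x \<bullet> s)) * u x * v s)"
  have "integrable (lborel \<Otimes>\<^sub>M lborel) (case_prod f)"
  proof (rule lborel_pair.Fubini_integrable)
    show "case_prod f \<in> borel_measurable (lborel \<Otimes>\<^sub>M lborel)"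
      unfolding f_def by measurable
    have "integrable lborel (\<lambda>x. cmod (u x) * (LINT s|lborel. cmod (v s)))"
      using u by simp
    then show "integrable lborel (\<lambda>x. LINT y|lborel. norm (case_prod f (x, y)))"
      by (simp add: f_def norm_mult)
    show "AE x in lborel. integrable lborel (\<lambda>y. case_prod f (x, y))"
    proof (rule AE_I2)
      fix x
      have "integrable lborel (\<lambda>y. u x * (cis (- (x \<bullet> y)) * v y))"
        by (rule integrable_mult_right) (rule integrable_cis_mult[OF v], measurable)
      then show "integrable lborel (\<lambda>y. case_prod f (x, y))" by (simp add: f_def mult_ac)
    qed
  qed
  from lborel_pair.Fubini_integral[OF this]
  have F: "(LINT s|lborel. LINT x|lborel. f x s) = (LINT x|lborel. LINT s|lborel. f x s)" .
  have "(LINT s|lborel. fourier_integral u s * v s)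
      = of_real (fourier_const TYPE('a)) * (LINT s|lborel. LINT x|lborel. f x s)"
    unfolding fourier_integral_alt f_def by (simp add: mult.assoc flip: integral_mult_left_zero)
  also have "\<dots> = of_real (fourier_const TYPE('a)) * (LINT x|lborel. LINT s|lborel. f x s)"
    by (simp add: F)
  also have "\<dots> = (LINT x|lborel. u x * fourier_integral v x)"
  proof -
    have "(LINT s|lborel. f x s) = u x * (LINT s|lborel. cis (- (s \<bullet> x)) * v s)" for x
      unfolding f_def by (simp add: mult_ac inner_commute flip: integral_mult_right_zero)
    then have "(LINT x|lborel. u x * fourier_integral v x)
        = (LINT x|lborel. of_real (fourier_const TYPE('a)) * (LINT s|lborel. f x s))"
      unfolding fourier_integral_alt by (simp add: mult_ac)
    then show ?thesis by simp
  qed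
  finally show ?thesis .
qed

lemma cnj_fourier_integral: "cnj (fourier_integral u s) = fourier_integral (\<lambda>x. cnj (u x)) (- s)"
  unfolding fourier_integral_alt by (simp add: cis_cnj flip: Bochner_Integration.integral_cnj)

section \<open>Plancherel's theorem\<close>

lemma bounded_support_integrable:
  fixes u :: "'a::euclidean_space \<Rightarrow> complex"
  assumes "continuous_on UNIV u" "\<And>x. R < norm x \<Longrightarrow> u x = 0"
  shows "\<exists>M. \<forall>x. cmod (u x) \<le> M" "integrable lborel u" "square_integrable u"
proof -
  have [measurable]: "u \<in> borel_measurable borel"
    using assms(1) by (rule borel_measurable_continuous_onI)
  have "bounded (u ` cball 0 R)"
    by (intro compact_imp_bounded compact_continuous_image continuous_on_subset[OF assms(1)]) auto
  then obtain M where M: "M > 0" "\<And>x. x \<in> cball 0 R \<Longrightarrow> cmod (u x) \<le> M"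
    unfolding bounded_pos by auto
  have M': "cmod (u x) \<le> M * indicator (cball 0 R) x" for x
    using M(2)[of x] assms(2)[of x] by (auto simp: indicator_def)
  then show "\<exists>M. \<forall>x. cmod (u x) \<le> M" using M(1) by (intro exI[of _ M] allI order_trans[OF M']) (auto simp: indicator_def)
  have ind: "integrable lborel (indicator (cball 0 R) :: 'a \<Rightarrow> real)"
    by (rule integrable_real_indicator) (use emeasure_lborel_cball_finite[of "0::'a" R] in auto)
  show "integrable lborel u"
    by (rule Bochner_Integration.integrable_bound[of _ "\<lambda>x. M * indicator (cball 0 R) x"])
       (use M' ind M(1) in \<open>auto simp: abs_mult\<close>)
  have "integrable lborel (\<lambda>x. (cmod (u x))\<^sup>2)"
  proof (rule Bochner_Integration.integrable_bound[of _ "\<lambda>x. M\<^sup>2 * indicator (cball 0 R) x"])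
    have "(cmod (u x))\<^sup>2 \<le> (M * indicator (cball 0 R) x)\<^sup>2" for x
      by (rule power_mono[OF M']) simp
    also have "(M * indicator (cball 0 R) x)\<^sup>2 = M\<^sup>2 * indicator (cball 0 R) x" for x :: 'a
      by (auto simp: indicator_def)
    finally show "AE x in lborel. norm ((cmod (u x))\<^sup>2) \<le> norm (M\<^sup>2 * indicator (cball 0 R) x)" by auto
  qed (use ind in auto)
  then show "square_integrable u" by (simp add: square_integrable_def)
qed

text \<open>The integral \<open>L n\<close> of |F|^2 against a wide Gaussian equals, by the
  multiplication formula, the pairing of u with its averages \<open>A n\<close> over narrow
  Gaussians. As n grows, the former tends to the squared norm of F and the latter to that of u,
  because continuity makes the averages converge pointwise.\<close>

lemma plancherel_continuous:
  fixes u :: "'a::euclidean_space \<Rightarrow> complex"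
  assumes cont: "continuous_on UNIV u" and supp: "\<And>x. R < norm x \<Longrightarrow> u x = 0"
  shows "square_integrable (fourier_integral u)"
    and "norm (abs_l2 (fourier_integral u)) = norm (abs_l2 u)"
proof -
  obtain M where M: "\<And>x. cmod (u x) \<le> M" using bounded_support_integrable(1)[OF assms] by auto
  have int: "integrable lborel u" and si: "square_integrable u"
    using bounded_support_integrable[OF assms] by auto
  have [measurable]: "u \<in> borel_measurable borel"
    using si by (rule square_integrable_measurable)
  define \<kappa> where "\<kappa> = fourier_const TYPE('a)"
  define e where "e = (\<lambda>n. 1 / real (Suc n))"
  have e: "e n > 0" for n by (simp add: e_def)
  define G where "G = (\<lambda>n (s::'a). exp (- (e n * norm s)\<^sup>2 / 2))"
  have [measurable]: "G n \<in> borel_measurable borel" for n unfolding G_def by measurable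
  have Gint: "integrable lborel (\<lambda>s. cis (- (x \<bullet> s)) * of_real (G n s))" for n x
    unfolding G_def by (rule gaussian_char(1)[OF e])
  from this[of 0] have Gint0: "integrable lborel (\<lambda>s. complex_of_real (G n s))" for n by simp
  have Gint0': "integrable lborel (G n)" for n using Gint0[of n] by (simp only: complex_of_real_integrable_eq)
  have G0: "0 \<le> G n s" "G n s \<le> 1" for n s by (auto simp: G_def)
  have elim: "e \<longlonglongrightarrow> 0" unfolding e_def using LIMSEQ_inverse_real_of_nat by (simp add: inverse_eq_divide)
  have Glim: "(\<lambda>n. G n s) \<longlonglongrightarrow> 1" for s
  proof -
    have "(\<lambda>n. exp (- (e n * norm s)\<^sup>2 / 2)) \<longlonglongrightarrow> exp (- (0 * norm s)\<^sup>2 / 2)"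
      by (intro tendsto_intros elim) auto
    then show ?thesis by (simp add: G_def)
  qed
  define F where "F = fourier_integral u"
  have [measurable]: "F \<in> borel_measurable borel" unfolding F_def by measurable
  obtain B where B: "\<And>s. cmod (F s) \<le> B" unfolding F_def using norm_fourier_integral_le by blast
  have FG: "integrable lborel (\<lambda>s. h s * of_real (G n s))"
    if [measurable]: "h \<in> borel_measurable borel" and hb: "\<And>s. cmod (h s) \<le> C" for h n C
  proof -
    have "0 \<le> C" using order_trans[OF norm_ge_zero hb[of 0]] .
    show ?thesis
    proof (rule Bochner_Integration.integrable_bound[of _ "\<lambda>s. C * G n s"])
      have "cmod (h s * of_real (G n s)) \<le> C * G n s" for s
        using mult_right_mono[OF hb G0(1)[of n s], of s] G0(1)[of n s] by (simp add: norm_mult)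
      then show "AE s in lborel. norm (h s * of_real (G n s)) \<le> norm (C * G n s)"
        by (auto intro: order_trans[OF _ abs_ge_self])
    qed (use Gint0' in \<open>auto intro: integrable_mult_right\<close>)
  qed
  \<comment> \<open>The substitution y = x + e z has absorbed the width of the Gaussian: the weight
    no longer depends on n, and \<kappa> normalises its integral to 1.\<close>
  define A where "A = (\<lambda>n x. of_real \<kappa> * (LINT z|lborel. u (x + e n *\<^sub>R z) * of_real (exp (- (norm z)\<^sup>2 / 2))))"
  have gau: "integrable lborel (\<lambda>z::'a. exp (- (norm z)\<^sup>2 / 2))"
    "(LINT z|lborel. complex_of_real (exp (- (norm (z::'a))\<^sup>2 / 2))) = of_real (sqrt (2 * pi) ^ DIM('a))"
    using gaussian_char[of 1 "0::'a", OF zero_less_one] complex_of_real_integrable_eq[of lborel "\<lambda>z::'a. exp (- (norm z)\<^sup>2 / 2)"]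
    by simp_all
  have FI: "fourier_integral (\<lambda>s. cnj (F s) * of_real (G n s)) x = cnj (A n x)" for n x
  proof -
    \<comment> \<open>A modulated Gaussian: its Fourier integral is a Gaussian of width
      \<open>e n\<close> centred at x, the averaging kernel of \<open>A n\<close>.\<close>
    define v where "v = (\<lambda>s. cis (s \<bullet> x) * complex_of_real (G n s))"
    have vint: "integrable lborel v" using Gint[of "-x" n] by (simp add: v_def inner_commute)
    have FIv: "fourier_integral v y = of_real ((1 / e n) ^ DIM('a) * exp (- (norm (y - x) / e n)\<^sup>2 / 2))" for y
    proof -
      have "fourier_integral v y = of_real \<kappa> * (LINT s|lborel. cis (- ((y - x) \<bullet> s)) * of_real (G n s))"
        unfolding fourier_integral_alt v_def \<kappa>_def
        by (simp add: mult.assoc[symmetric] cis_mult inner_diff_left inner_diff_right inner_commute)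
      also have "\<dots> = of_real (\<kappa> * sqrt (2 * pi) ^ DIM('a) * (1 / e n) ^ DIM('a) * exp (- (norm (y - x) / e n)\<^sup>2 / 2))"
        unfolding G_def gaussian_char(2)[OF e] by (simp add: power_divide)
      also have "\<kappa> * sqrt (2 * pi) ^ DIM('a) = 1" unfolding \<kappa>_def by (rule fourier_const_sqrt)
      finally show ?thesis by simp
    qed
    have "fourier_integral (\<lambda>s. cnj (F s) * of_real (G n s)) x
        = cnj (of_real \<kappa> * (LINT s|lborel. F s * v s))"
      unfolding fourier_integral_alt v_def \<kappa>_def
      by (simp add: cis_cnj mult_ac flip: Bochner_Integration.integral_cnj)
    also have "(LINT s|lborel. F s * v s) = (LINT y|lborel. u y * fourier_integral v y)"
      unfolding F_def by (rule fourier_integral_mult[OF int vint])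
    also have "\<dots> = e n ^ DIM('a) *\<^sub>R (LINT z|lborel. u (x + e n *\<^sub>R z) * fourier_integral v (x + e n *\<^sub>R z))"
      using lborel_integral_affine[of "e n" "\<lambda>y. u y * fourier_integral v y" x] e[of n]
      unfolding FIv by simp
    also have "\<dots> = (LINT z|lborel. u (x + e n *\<^sub>R z) * of_real (exp (- (norm z)\<^sup>2 / 2)))"
      unfolding FIv integral_scaleR_right[symmetric] using e[of n]
      by (intro Bochner_Integration.integral_cong) (auto simp: scaleR_conv_of_real power_divide)
    finally show ?thesis by (simp add: A_def)
  qed
  have Alim: "(\<lambda>n. A n x) \<longlonglongrightarrow> u x" for x
  proof -
    have "(\<lambda>n. LINT z|lborel. u (x + e n *\<^sub>R z) * complex_of_real (exp (- (norm z)\<^sup>2 / 2)))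
        \<longlonglongrightarrow> (LINT z|lborel. u x * of_real (exp (- (norm (z::'a))\<^sup>2 / 2)))"
    proof (rule integral_dominated_convergence[where w="\<lambda>z. M * exp (- (norm z)\<^sup>2 / 2)"])
      have "(\<lambda>n. u (x + e n *\<^sub>R z)) \<longlonglongrightarrow> u x" for z
      proof -
        have "(\<lambda>n. x + e n *\<^sub>R z) \<longlonglongrightarrow> x + 0 *\<^sub>R z" by (intro tendsto_intros elim)
        with cont show ?thesis by (auto intro!: continuous_on_tendsto_compose[OF cont])
      qed
      then show "AE z in lborel. (\<lambda>n. u (x + e n *\<^sub>R z) * complex_of_real (exp (- (norm z)\<^sup>2 / 2)))
          \<longlonglongrightarrow> u x * of_real (exp (- (norm z)\<^sup>2 / 2))"
        by (intro AE_I2 tendsto_mult tendsto_const)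
      show "integrable lborel (\<lambda>z::'a. M * exp (- (norm z)\<^sup>2 / 2))" by (intro integrable_mult_right gau)
      show "AE z in lborel. norm (u (x + e n *\<^sub>R z) * complex_of_real (exp (- (norm z)\<^sup>2 / 2))) \<le> M * exp (- (norm z)\<^sup>2 / 2)" for n
        using M by (auto simp: norm_mult)
    qed measurable
    then have "(\<lambda>n. A n x) \<longlonglongrightarrow> of_real \<kappa> * (LINT z|lborel. u x * of_real (exp (- (norm (z::'a))\<^sup>2 / 2)))"
      unfolding A_def by (intro tendsto_intros)
    also have "(LINT z|lborel. u x * complex_of_real (exp (- (norm (z::'a))\<^sup>2 / 2))) = u x * of_real (sqrt (2 * pi) ^ DIM('a))"
      unfolding integral_mult_right_zero gau(2) ..
    also have "of_real \<kappa> * (u x * of_real (sqrt (2 * pi) ^ DIM('a))) = u x * of_real (\<kappa> * sqrt (2 * pi) ^ DIM('a))" by simp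
    also have "\<kappa> * sqrt (2 * pi) ^ DIM('a) = 1" unfolding \<kappa>_def by (rule fourier_const_sqrt)
    finally show ?thesis by simp
  qed
  have Abound: "cmod (A n x) \<le> M" for n x
  proof -
    have "cmod (LINT z|lborel. u (x + e n *\<^sub>R z) * complex_of_real (exp (- (norm z)\<^sup>2 / 2)))
        \<le> (LINT z|lborel. M * exp (- (norm (z::'a))\<^sup>2 / 2))"
    proof (rule order_trans[OF integral_norm_bound], rule integral_mono)
      have le: "norm (u (x + e n *\<^sub>R z) * complex_of_real (exp (- (norm z)\<^sup>2 / 2))) \<le> M * exp (- (norm z)\<^sup>2 / 2)" for z
        using M by (simp add: norm_mult)
      then show "norm (u (x + e n *\<^sub>R z) * complex_of_real (exp (- (norm z)\<^sup>2 / 2))) \<le> M * exp (- (norm z)\<^sup>2 / 2)" for z .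
      show i: "integrable lborel (\<lambda>z::'a. M * exp (- (norm z)\<^sup>2 / 2))" by (rule integrable_mult_right[OF gau(1)])
      show "integrable lborel (\<lambda>z. norm (u (x + e n *\<^sub>R z) * complex_of_real (exp (- (norm z)\<^sup>2 / 2))))"
      proof (rule Bochner_Integration.integrable_bound[OF i])
        show "AE z in lborel. norm (norm (u (x + e n *\<^sub>R z) * complex_of_real (exp (- (norm z)\<^sup>2 / 2)))) \<le> norm (M * exp (- (norm z)\<^sup>2 / 2))"
          by (intro AE_I2) (use order_trans[OF le abs_ge_self] in simp)
      qed measurable
    qed
    also have "\<dots> = M * sqrt (2 * pi) ^ DIM('a)"
    proof -
      have "complex_of_real (LINT z|lborel. exp (- (norm (z::'a))\<^sup>2 / 2)) = of_real (sqrt (2 * pi) ^ DIM('a))"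
        using gau(2) by (simp only: integral_complex_of_real)
      then have "(LINT z|lborel. exp (- (norm (z::'a))\<^sup>2 / 2)) = sqrt (2 * pi) ^ DIM('a)" using of_real_eq_iff by blast
      then show ?thesis by simp
    qed
    finally have "cmod (A n x) \<le> \<kappa> * (M * sqrt (2 * pi) ^ DIM('a))"
      unfolding A_def using fourier_const_pos[where ?'a='a] by (simp add: norm_mult \<kappa>_def)
    also have "\<dots> = M * (\<kappa> * sqrt (2 * pi) ^ DIM('a))" by simp
    also have "\<kappa> * sqrt (2 * pi) ^ DIM('a) = 1" unfolding \<kappa>_def by (rule fourier_const_sqrt)
    finally show ?thesis by simp
  qed
  have [measurable]: "A n \<in> borel_measurable borel" for n unfolding A_def by measurable
  define L where "L = (\<lambda>n. LINT s|lborel. F s * (cnj (F s) * of_real (G n s)))"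
  have cnjm [measurable]: "(\<lambda>s. cnj (h s)) \<in> borel_measurable borel" if "h \<in> borel_measurable borel" for h :: "'a \<Rightarrow> complex"
    by (rule borel_measurable_continuous_on[OF _ that]) (intro continuous_intros)
  have L: "L n = (LINT x|lborel. u x * cnj (A n x))" for n
    unfolding L_def F_def
    by (subst fourier_integral_mult[OF int], rule FG[of _ B]) (use B in \<open>auto simp: FI[unfolded F_def] F_def\<close>)
  have "L \<longlonglongrightarrow> (LINT x|lborel. u x * cnj (u x))"
    unfolding L
  proof (rule integral_dominated_convergence[where w="\<lambda>x. cmod (u x) * M"])
    show "AE x in lborel. (\<lambda>n. u x * cnj (A n x)) \<longlonglongrightarrow> u x * cnj (u x)"
      by (intro AE_I2 tendsto_intros Alim)
    show "AE x in lborel. norm (u x * cnj (A n x)) \<le> cmod (u x) * M" for n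
      using Abound by (auto simp: norm_mult intro!: mult_left_mono)
    show "integrable lborel (\<lambda>x. cmod (u x) * M)"
      by (rule integrable_mult_left[OF integrable_norm[OF int]])
    show "(\<lambda>x. u x * cnj (A n x)) \<in> borel_measurable lborel" for n by measurable
  qed measurable
  then have "(\<lambda>n. Re (L n)) \<longlonglongrightarrow> Re (LINT x|lborel. u x * cnj (u x))" by (rule tendsto_Re)
  also have "Re (LINT x|lborel. u x * cnj (u x)) = (norm (abs_l2 u))\<^sup>2"
    by (simp add: integral_mult_cnj_self norm_abs_l2 si)
  finally have ReL: "(\<lambda>n. Re (L n)) \<longlonglongrightarrow> (norm (abs_l2 u))\<^sup>2" .
  have Fsq: "F s * (cnj (F s) * of_real (G n s)) = of_real ((cmod (F s))\<^sup>2 * G n s)" for s n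
    by (simp only: mult.assoc[symmetric] complex_norm_square[symmetric] of_real_mult)
  have FGint: "integrable lborel (\<lambda>s. (cmod (F s))\<^sup>2 * G n s)" for n
  proof -
    have "integrable lborel (\<lambda>s. (F s * cnj (F s)) * of_real (G n s))"
    proof (rule FG[of _ "B * B"])
      show "cmod (F s * cnj (F s)) \<le> B * B" for s
        using mult_mono[OF B B order_trans[OF norm_ge_zero B] norm_ge_zero] by (simp add: norm_mult)
    qed measurable
    then show ?thesis unfolding mult.assoc Fsq by (simp only: complex_of_real_integrable_eq)
  qed
  have ReL': "Re (L n) = (LINT s|lborel. (cmod (F s))\<^sup>2 * G n s)" for n
    unfolding L_def Fsq by (simp only: integral_complex_of_real Re_complex_of_real)
  have "(\<integral>\<^sup>+s. ennreal ((cmod (F s))\<^sup>2) \<partial>lborel) = (\<integral>\<^sup>+s. liminf (\<lambda>n. ennreal ((cmod (F s))\<^sup>2 * G n s)) \<partial>lborel)"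
  proof (rule nn_integral_cong)
    fix s
    have "(\<lambda>n. ennreal ((cmod (F s))\<^sup>2 * G n s)) \<longlonglongrightarrow> ennreal ((cmod (F s))\<^sup>2 * 1)"
      by (intro tendsto_intros Glim)
    then show "ennreal ((cmod (F s))\<^sup>2) = liminf (\<lambda>n. ennreal ((cmod (F s))\<^sup>2 * G n s))"
      using lim_imp_Liminf[OF trivial_limit_sequentially] by fastforce
  qed
  also have "\<dots> \<le> liminf (\<lambda>n. \<integral>\<^sup>+s. ennreal ((cmod (F s))\<^sup>2 * G n s) \<partial>lborel)"
    by (rule nn_integral_liminf) auto
  also have "(\<lambda>n. \<integral>\<^sup>+s. ennreal ((cmod (F s))\<^sup>2 * G n s) \<partial>lborel) = (\<lambda>n. ennreal (Re (L n)))"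
    unfolding ReL' by (intro ext nn_integral_eq_integral FGint AE_I2 mult_nonneg_nonneg G0) auto
  also have "liminf (\<lambda>n. ennreal (Re (L n))) = ennreal ((norm (abs_l2 u))\<^sup>2)"
    by (rule lim_imp_Liminf[OF trivial_limit_sequentially tendsto_ennrealI[OF ReL]])
  finally have "(\<integral>\<^sup>+s. ennreal ((cmod (F s))\<^sup>2) \<partial>lborel) \<le> ennreal ((norm (abs_l2 u))\<^sup>2)" .
  then show siF: "square_integrable (fourier_integral u)"
    unfolding square_integrable_iff_nn F_def[symmetric] by (auto simp: le_less_trans)
  \<comment> \<open>Dominated convergence takes |F|^2 itself as majorant; its integrability has just
    been obtained from Fatou's lemma.\<close>
  have "(\<lambda>n. Re (L n)) \<longlonglongrightarrow> (LINT s|lborel. (cmod (F s))\<^sup>2)"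
    unfolding ReL'
  proof (rule integral_dominated_convergence[where w="\<lambda>s. (cmod (F s))\<^sup>2"])
    show "AE s in lborel. (\<lambda>n. (cmod (F s))\<^sup>2 * G n s) \<longlonglongrightarrow> (cmod (F s))\<^sup>2"
      using tendsto_mult[OF tendsto_const Glim] by fastforce
    show "AE s in lborel. norm ((cmod (F s))\<^sup>2 * G n s) \<le> (cmod (F s))\<^sup>2" for n
      using G0 by (auto simp: abs_mult mult_left_le)
  qed (use siF in \<open>auto simp: square_integrable_def F_def[symmetric]\<close>)
  then have "(LINT s|lborel. (cmod (F s))\<^sup>2) = (norm (abs_l2 u))\<^sup>2"
    using ReL LIMSEQ_unique by blast
  then show "norm (abs_l2 (fourier_integral u)) = norm (abs_l2 u)"
    by (simp add: norm_abs_l2[OF siF] F_def flip: power2_eq_iff_nonneg[of "norm _" "norm _", OF norm_ge_zero norm_ge_zero])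
qed

section \<open>Convergence in mean and the extension of the isometry from continuous
  functions\<close>

lemma norm_l2_tendsto_0I:
  fixes V :: "nat \<Rightarrow> 'a::euclidean_space \<Rightarrow> complex"
  assumes "\<And>n::nat. square_integrable (V n)" "integrable lborel w" "\<And>n. AE x in lborel. (cmod (V n x))\<^sup>2 \<le> w x"
    and "AE x in lborel. (\<lambda>n. V n x) \<longlonglongrightarrow> 0"
  shows "(\<lambda>n. abs_l2 (V n)) \<longlonglongrightarrow> 0"
proof -
  note [measurable] = square_integrable_measurable[OF assms(1)]
  have "(\<lambda>n. LINT x|lborel. (cmod (V n x))\<^sup>2) \<longlonglongrightarrow> (LINT (x::'a)|lborel. 0)"
  proof (rule integral_dominated_convergence[where w=w])
    show "AE x in lborel. (\<lambda>n. (cmod (V n x))\<^sup>2) \<longlonglongrightarrow> 0"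
      using assms(4)
    proof eventually_elim
      fix x assume "(\<lambda>n. V n x) \<longlonglongrightarrow> 0"
      then have "(\<lambda>n. (cmod (V n x))\<^sup>2) \<longlonglongrightarrow> (cmod 0)\<^sup>2" by (intro tendsto_intros)
      then show "(\<lambda>n. (cmod (V n x))\<^sup>2) \<longlonglongrightarrow> 0" by simp
    qed
  qed (use assms in auto)
  then have "(\<lambda>n. (norm (abs_l2 (V n)))\<^sup>2) \<longlonglongrightarrow> 0" by (simp add: norm_abs_l2 assms(1))
  then have "(\<lambda>n. sqrt ((norm (abs_l2 (V n)))\<^sup>2)) \<longlonglongrightarrow> sqrt 0" by (rule tendsto_real_sqrt)
  then show ?thesis by (simp add: tendsto_norm_zero_iff)
qed

lemma square_integrable_indicator_mult:
  assumes "square_integrable U" "A \<in> sets borel"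
  shows "square_integrable (\<lambda>x. indicator A x * U x)"
proof -
  have "ess_bounded 1 (indicator A :: 'a \<Rightarrow> complex)"
    using assms(2) by (auto simp: ess_bounded_def indicator_def intro!: borel_measurable_indicator)
  from square_integrable_ess_bounded_mult(1)[OF this assms(1)] show ?thesis .
qed

lemma square_integrable_indicator_bounded:
  assumes "A \<in> sets borel" "emeasure lborel A < \<infinity>"
  shows "square_integrable (indicator A :: 'a::euclidean_space \<Rightarrow> complex)"
proof -
  have "integrable lborel (indicator A :: 'a \<Rightarrow> real)"
    using assms by (intro integrable_real_indicator) auto
  moreover have "(cmod (indicator A x))\<^sup>2 = indicator A x" for x :: 'a by (simp add: indicator_def)
  ultimately show ?thesis using assms(1) by (simp add: square_integrable_def borel_measurable_indicator)
qed

lemma square_integrable_indicator_cball: "square_integrable (indicator (cball a R) :: 'a::euclidean_space \<Rightarrow> complex)"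
  using emeasure_lborel_cball_finite[of a R] by (intro square_integrable_indicator_bounded) auto

lemma square_integrable_bounded_support:
  fixes U :: "'a::euclidean_space \<Rightarrow> complex"
  assumes U: "square_integrable U" and supp: "\<And>x. R < norm x \<Longrightarrow> U x = 0"
  shows "integrable lborel U"
    and "(LINT x|lborel. cmod (U x)) \<le> norm (abs_l2 U) * norm (abs_l2 (indicator (cball 0 R) :: 'a \<Rightarrow> complex))"
proof -
  have eq: "U x * indicator (cball 0 R) x = U x" for x
    using supp[of x] by (auto simp: indicator_def)
  show "integrable lborel U"
    using square_integrable_mult'[OF U square_integrable_indicator_cball[of 0 R]] by (simp add: eq)
  show "(LINT x|lborel. cmod (U x)) \<le> norm (abs_l2 U) * norm (abs_l2 (indicator (cball 0 R) :: 'a \<Rightarrow> complex))"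
    using integral_norm_mult_le[OF U square_integrable_indicator_cball[of 0 R]] by (simp add: eq)
qed

lemma truncate_tendsto:
  fixes U :: "'a::euclidean_space \<Rightarrow> complex"
  assumes U: "square_integrable U" and A: "\<And>n. A n \<in> sets borel"
    and ev: "\<And>x. \<forall>\<^sub>F n in sequentially. x \<in> A n"
  shows "(\<lambda>n. abs_l2 (\<lambda>x. indicator (A n) x * U x)) \<longlonglongrightarrow> abs_l2 U"
proof -
  have "(\<lambda>n. abs_l2 (\<lambda>x. indicator (A n) x * U x - U x)) \<longlonglongrightarrow> 0"
  proof (rule norm_l2_tendsto_0I[where w="\<lambda>x. (cmod (U x))\<^sup>2"])
    show "square_integrable (\<lambda>x. indicator (A n) x * U x - U x)" for n
      by (intro square_integrable_diff square_integrable_indicator_mult U A)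
    show "AE x in lborel. (cmod (indicator (A n) x * U x - U x))\<^sup>2 \<le> (cmod (U x))\<^sup>2" for n
      by (auto simp: indicator_def)
    show "AE x in lborel. (\<lambda>n. indicator (A n) x * U x - U x) \<longlonglongrightarrow> 0"
    proof (rule AE_I2)
      fix x
      show "(\<lambda>n. indicator (A n) x * U x - U x) \<longlonglongrightarrow> 0"
        by (rule tendsto_eventually, rule eventually_mono[OF ev[of x]]) simp
    qed
  qed (use U in \<open>simp add: square_integrable_def\<close>)
  then show ?thesis
    by (simp add: abs_l2_diff[symmetric] square_integrable_indicator_mult U A LIM_zero_iff)
qed

lemma truncate_cball_tendsto:
  "square_integrable U \<Longrightarrow> (\<lambda>n. abs_l2 (\<lambda>x. indicator (cball 0 (real n)) x * U x)) \<longlonglongrightarrow> abs_l2 U"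
proof (rule truncate_tendsto)
  fix x :: 'a
  obtain n0 :: nat where "norm x \<le> n0" using real_arch_simple by blast
  then show "\<forall>\<^sub>F n in sequentially. x \<in> cball 0 (real n)"
    by (intro eventually_sequentiallyI[of n0]) auto
qed auto

lemma continuous_dense_bounded:
  fixes U :: "'a::euclidean_space \<Rightarrow> complex"
  assumes U [measurable]: "U \<in> borel_measurable borel" and M: "M > 0" "\<And>x. cmod (U x) \<le> M"
    and supp: "\<And>x. R < norm x \<Longrightarrow> U x = 0"
  shows "\<exists>V. (\<forall>n::nat. continuous_on UNIV (V n) \<and> (\<forall>x. R + 1 < norm x \<longrightarrow> V n x = 0)) \<and>
    (\<lambda>n. abs_l2 (V n)) \<longlonglongrightarrow> abs_l2 U" "square_integrable U"
proof -
  have "U measurable_on UNIV"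
    using measurable_completion[of U lborel borel] U
    by (subst measurable_on_iff_borel_measurable) (simp_all add: lebesgue_on_UNIV_eq)
  then obtain N g where N: "negligible N" and g: "\<And>n. continuous_on UNIV (g n)"
    "\<And>x. x \<notin> N \<Longrightarrow> (\<lambda>n. g n x) \<longlonglongrightarrow> U x"
    unfolding measurable_on_def by auto
  have AEN: "AE x in lborel. x \<notin> N"
    using N by (metis AE_completion_iff AE_not_in negligible_iff_null_sets)
  \<comment> \<open>The continuous \<open>g n\<close> converge only almost everywhere. The cut-off
    \<open>ch\<close> and the retraction \<open>cl\<close> of the values to the disc of radius M
    supply a common majorant; neither changes the limit, since |U| \<le> M and U vanishes where
    \<open>ch\<close> is not 1.\<close>
  define ch where "ch = (\<lambda>x::'a. max 0 (min 1 (R + 1 - norm x)))"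
  define cl where "cl = (\<lambda>z::complex. z * of_real (M / max M (cmod z)))"
  define V where "V = (\<lambda>n x. of_real (ch x) * cl (g n x))"
  have cl_cont: "continuous_on UNIV cl"
    unfolding cl_def using M(1) by (intro continuous_intros) auto
  have cl_bd: "cmod (cl z) \<le> M" for z
  proof -
    have "cmod z * (M / max M (cmod z)) = M * (cmod z / max M (cmod z))" by simp
    also have "\<dots> \<le> M * 1" using M(1) by (intro mult_left_mono) (auto simp: divide_le_eq)
    finally have "cmod z * (M / max M (cmod z)) \<le> M" by simp
    moreover have "\<bar>M / max M (cmod z)\<bar> = M / max M (cmod z)" using M(1) by simp
    ultimately show ?thesis by (simp only: cl_def norm_mult norm_of_real)
  qed
  have cl_id: "cl z = z" if "cmod z \<le> M" for z using that M(1) by (simp add: cl_def)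
  have chi: "0 \<le> ch x" "ch x \<le> 1" "R + 1 < norm x \<Longrightarrow> ch x = 0" "norm x \<le> R \<Longrightarrow> ch x = 1" for x
    by (auto simp: ch_def)
  have chi_cont: "continuous_on UNIV (\<lambda>x. complex_of_real (ch x))"
    unfolding ch_def by (intro continuous_intros)
  have V: "continuous_on UNIV (V n)" for n
    unfolding V_def
    by (intro continuous_on_mult chi_cont continuous_on_compose2[OF cl_cont g(1)]) auto
  have V0: "V n x = 0" if "R + 1 < norm x" for n x using chi(3)[OF that] by (simp add: V_def)
  have Vb: "cmod (V n x) \<le> M" for n x
    using mult_mono[OF chi(2)[of x] cl_bd[of "g n x"]] chi(1)[of x] by (simp add: V_def norm_mult)
  have siV: "square_integrable (V n)" for n
    by (rule bounded_support_integrable(3)[OF V V0])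
  have ind: "integrable lborel (indicator (cball 0 (R + 1)) :: 'a \<Rightarrow> real)"
    by (rule integrable_real_indicator) (use emeasure_lborel_cball_finite[of "0::'a" "R + 1"] in auto)
  show siU: "square_integrable U"
    unfolding square_integrable_def
  proof
    show "integrable lborel (\<lambda>x. (cmod (U x))\<^sup>2)"
    proof (rule Bochner_Integration.integrable_bound[of _ "\<lambda>x. M\<^sup>2 * indicator (cball 0 (R + 1)) x"])
      show "AE x in lborel. norm ((cmod (U x))\<^sup>2) \<le> norm (M\<^sup>2 * indicator (cball 0 (R + 1)) x)"
        using supp M by (auto simp: indicator_def intro!: power_mono)
    qed (use ind in auto)
  qed measurable
  have "(\<lambda>n. abs_l2 (\<lambda>x. V n x - U x)) \<longlonglongrightarrow> 0"
  proof (rule norm_l2_tendsto_0I[where w="\<lambda>x. (2 * M)\<^sup>2 * indicator (cball 0 (R + 1)) x"])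
    show "square_integrable (\<lambda>x. V n x - U x)" for n by (intro square_integrable_diff siV siU)
    show "integrable lborel (\<lambda>x::'a. (2 * M)\<^sup>2 * indicator (cball 0 (R + 1)) x)" using ind by auto
    show "AE x in lborel. (cmod (V n x - U x))\<^sup>2 \<le> (2 * M)\<^sup>2 * indicator (cball 0 (R + 1)) x" for n
    proof (rule AE_I2)
      fix x
      show "(cmod (V n x - U x))\<^sup>2 \<le> (2 * M)\<^sup>2 * indicator (cball 0 (R + 1)) x"
      proof (cases "norm x \<le> R + 1")
        case True
        have "cmod (V n x - U x) \<le> 2 * M"
          using norm_triangle_ineq4[of "V n x" "U x"] Vb[of n x] M(2)[of x] by linarith
        then show ?thesis using True power_mono[of "cmod (V n x - U x)" "2 * M" 2] by (simp add: indicator_def)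
      qed (use V0 supp in auto)
    qed
    show "AE x in lborel. (\<lambda>n. V n x - U x) \<longlonglongrightarrow> 0"
      using AEN
    proof eventually_elim
      fix x assume "x \<notin> N"
      then have "(\<lambda>n. g n x) \<longlonglongrightarrow> U x" by (rule g)
      then have "(\<lambda>n. cl (g n x)) \<longlonglongrightarrow> cl (U x)"
        by (rule continuous_on_tendsto_compose[OF cl_cont]) auto
      then have "(\<lambda>n. V n x) \<longlonglongrightarrow> of_real (ch x) * U x"
        unfolding V_def using cl_id[OF M(2)[of x]] by (intro tendsto_intros) simp
      moreover have "of_real (ch x) * U x = U x" using supp[of x] chi(4)[of x] by (cases "norm x \<le> R") auto
      ultimately show "(\<lambda>n. V n x - U x) \<longlonglongrightarrow> 0" by (simp add: LIM_zero_iff)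
    qed
  qed
  then have "(\<lambda>n. abs_l2 (V n)) \<longlonglongrightarrow> abs_l2 U"
    by (simp add: abs_l2_diff[symmetric] siU siV LIM_zero_iff)
  with V V0 show "\<exists>V. (\<forall>n::nat. continuous_on UNIV (V n) \<and> (\<forall>x. R + 1 < norm x \<longrightarrow> V n x = 0)) \<and>
    (\<lambda>n. abs_l2 (V n)) \<longlonglongrightarrow> abs_l2 U" by blast
qed

text \<open>Isometry on functions supported in a fixed ball is preserved under limits in mean,
  because there convergence in mean implies uniform convergence of the Fourier integrals.\<close>

lemma plancherel_limit:
  fixes U :: "'a::euclidean_space \<Rightarrow> complex"
  assumes U: "square_integrable U" and supp: "\<And>x. R < norm x \<Longrightarrow> U x = 0"
    and V: "\<And>n::nat. square_integrable (V n)" "\<And>n x. R < norm x \<Longrightarrow> V n x = 0"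
    and iso: "\<And>n. square_integrable (fourier_integral (V n))"
      "\<And>m n. norm (abs_l2 (fourier_integral (\<lambda>x. V m x - V n x))) = norm (abs_l2 (\<lambda>x. V m x - V n x))"
      "\<And>n. norm (abs_l2 (fourier_integral (V n))) = norm (abs_l2 (V n))"
    and lim: "(\<lambda>n. abs_l2 (V n)) \<longlonglongrightarrow> abs_l2 U"
  shows "square_integrable (fourier_integral U)"
    "norm (abs_l2 (fourier_integral U)) = norm (abs_l2 U)"
    "(\<lambda>n. abs_l2 (fourier_integral (V n))) \<longlonglongrightarrow> abs_l2 (fourier_integral U)"
proof -
  have intV: "integrable lborel (V n)" for n by (rule square_integrable_bounded_support(1)[OF V])
  have intU: "integrable lborel U" by (rule square_integrable_bounded_support(1)[OF U supp])
  have [measurable]: "U \<in> borel_measurable borel" using U by (rule square_integrable_measurable)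
  have dV: "norm (abs_l2 (fourier_integral (V m)) - abs_l2 (fourier_integral (V n))) = norm (abs_l2 (V m) - abs_l2 (V n))" for m n
    unfolding abs_l2_diff[OF iso(1) iso(1)] abs_l2_diff[OF V(1) V(1)] iso(2)[symmetric]
    by (simp add: fourier_integral_diff[OF intV intV, abs_def])
  have "Cauchy (\<lambda>n. abs_l2 (V n))" using lim by (rule LIMSEQ_imp_Cauchy)
  then have "Cauchy (\<lambda>n. abs_l2 (fourier_integral (V n)))"
    by (simp add: Cauchy_def dist_norm dV)
  then obtain w where w: "(\<lambda>n. abs_l2 (fourier_integral (V n))) \<longlonglongrightarrow> w"
    by (auto simp: Cauchy_convergent_iff convergent_def)
  have ptw: "(\<lambda>n. fourier_integral (V n) s) \<longlonglongrightarrow> fourier_integral U s" for s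
  proof -
    define K where "K = fourier_const TYPE('a) * norm (abs_l2 (indicator (cball 0 R) :: 'a \<Rightarrow> complex))"
    have "cmod (fourier_integral (V n) s - fourier_integral U s) \<le> norm (abs_l2 (V n) - abs_l2 U) * K" for n
    proof -
      have "cmod (fourier_integral (V n) s - fourier_integral U s)
          \<le> fourier_const TYPE('a) * (LINT x|lborel. cmod (V n x - U x))"
        unfolding fourier_integral_diff[OF intV intU, symmetric] by (rule norm_fourier_integral_le)
      also have "\<dots> \<le> fourier_const TYPE('a) * (norm (abs_l2 (\<lambda>x. V n x - U x)) * norm (abs_l2 (indicator (cball 0 R) :: 'a \<Rightarrow> complex)))"
        using fourier_const_pos[where ?'a='a]
        by (intro mult_left_mono square_integrable_bounded_support(2) square_integrable_diff V U) (auto simp: V supp)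
      finally show ?thesis by (simp add: abs_l2_diff V U K_def mult_ac)
    qed
    moreover have "(\<lambda>n. norm (abs_l2 (V n) - abs_l2 U) * K) \<longlonglongrightarrow> 0"
      using tendsto_mult_left_zero[OF tendsto_norm_zero[OF iffD2[OF LIM_zero_iff lim]]] .
    ultimately have "(\<lambda>n. fourier_integral (V n) s - fourier_integral U s) \<longlonglongrightarrow> 0"
      by (rule Lim_null_comparison[OF always_eventually[OF allI]])
    then show ?thesis by (simp add: LIM_zero_iff)
  qed
  have "fourier_integral U \<in> borel_measurable borel" by measurable
  note l = l2_limit_pointwise[OF iso(1) w this AE_I2[OF ptw]]
  from l show "square_integrable (fourier_integral U)" by simp
  from l w show lim': "(\<lambda>n. abs_l2 (fourier_integral (V n))) \<longlonglongrightarrow> abs_l2 (fourier_integral U)" by simp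
  have "(\<lambda>n. norm (abs_l2 (V n))) \<longlonglongrightarrow> norm (abs_l2 (fourier_integral U))"
    using tendsto_norm[OF lim'] by (simp add: iso(3))
  then show "norm (abs_l2 (fourier_integral U)) = norm (abs_l2 U)"
    using tendsto_norm[OF lim] LIMSEQ_unique by blast
qed

lemma plancherel_bounded:
  fixes U :: "'a::euclidean_space \<Rightarrow> complex"
  assumes U [measurable]: "U \<in> borel_measurable borel" and M: "\<And>x. cmod (U x) \<le> M"
    and supp: "\<And>x. R < norm x \<Longrightarrow> U x = 0"
  shows "square_integrable (fourier_integral U)"
    "norm (abs_l2 (fourier_integral U)) = norm (abs_l2 U)"
proof -
  have M': "0 < M + 1" "\<And>x. cmod (U x) \<le> M + 1"
    using M order_trans[OF norm_ge_zero M[of 0]] by (auto intro: order_trans[OF M])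
  note D = continuous_dense_bounded[OF U M' supp]
  obtain V where V: "\<And>n::nat. continuous_on UNIV (V n)" "\<And>n x. R + 1 < norm x \<Longrightarrow> V n x = 0"
    and lim: "(\<lambda>n. abs_l2 (V n)) \<longlonglongrightarrow> abs_l2 U"
    using D(1) by blast
  have siV: "square_integrable (V n)" for n by (rule bounded_support_integrable(3)[OF V])
  have cd: "continuous_on UNIV (\<lambda>x. V m x - V n x)" for m n by (intro continuous_intros V)
  have supp': "U x = 0" if "R + 1 < norm x" for x using that by (intro supp) simp
  have P: "norm (abs_l2 (fourier_integral (\<lambda>x. V m x - V n x))) = norm (abs_l2 (\<lambda>x. V m x - V n x))" for m n
    by (rule plancherel_continuous(2)[OF cd, of "R + 1"]) (simp add: V)
  have P1: "square_integrable (fourier_integral (V n))" "norm (abs_l2 (fourier_integral (V n))) = norm (abs_l2 (V n))" for n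
    using plancherel_continuous[of "V n" "R + 1"] V by blast+
  note L = plancherel_limit[where U=U and V=V and R="R + 1", OF D(2) supp' siV V(2) P1(1) P P1(2) lim]
  show "square_integrable (fourier_integral U)"
    "norm (abs_l2 (fourier_integral U)) = norm (abs_l2 U)" using L by blast+
qed

lemma plancherel_bounded_support:
  fixes U :: "'a::euclidean_space \<Rightarrow> complex"
  assumes U: "square_integrable U" and supp: "\<And>x. R < norm x \<Longrightarrow> U x = 0"
  shows "square_integrable (fourier_integral U)"
    "norm (abs_l2 (fourier_integral U)) = norm (abs_l2 U)"
proof -
  have [measurable]: "U \<in> borel_measurable borel" using U by (rule square_integrable_measurable)
  \<comment> \<open>Truncation by the size of the values leaves the support in the ball of radius R,
    as \<open>plancherel_limit\<close> demands.\<close>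
  define A where "A = (\<lambda>n::nat. {x. cmod (U x) \<le> n})"
  have A [measurable]: "A n \<in> sets borel" for n unfolding A_def by measurable
  define V where "V = (\<lambda>n x. indicator (A n) x * U x)"
  have [measurable]: "V n \<in> borel_measurable borel" for n unfolding V_def by measurable
  have siV: "square_integrable (V n)" for n
    unfolding V_def by (rule square_integrable_indicator_mult[OF U A])
  have V0: "V n x = 0" if "R < norm x" for n x using supp[OF that] by (simp add: V_def)
  have Vb: "cmod (V n x) \<le> real n" for n x by (auto simp: V_def A_def indicator_def)
  have lim: "(\<lambda>n. abs_l2 (V n)) \<longlonglongrightarrow> abs_l2 U"
    unfolding V_def
  proof (rule truncate_tendsto[OF U A])
    fix x
    obtain n0 :: nat where "cmod (U x) \<le> n0" using real_arch_simple by blast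
    then show "\<forall>\<^sub>F n in sequentially. x \<in> A n"
      by (intro eventually_sequentiallyI[of n0]) (auto simp: A_def)
  qed
  have P: "norm (abs_l2 (fourier_integral (\<lambda>x. V m x - V n x))) = norm (abs_l2 (\<lambda>x. V m x - V n x))" for m n
  proof (rule plancherel_bounded(2)[of _ "real m + real n" R])
    show "cmod (V m x - V n x) \<le> real m + real n" for x
      using norm_triangle_ineq4[of "V m x" "V n x"] Vb[of m x] Vb[of n x] by linarith
  qed (auto simp: V0)
  have P1: "square_integrable (fourier_integral (V n))" "norm (abs_l2 (fourier_integral (V n))) = norm (abs_l2 (V n))" for n
    by (rule plancherel_bounded[OF _ Vb V0]; simp)+
  note L = plancherel_limit[where U=U and V=V and R=R, OF U supp siV V0 P1(1) P P1(2) lim]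
  show "square_integrable (fourier_integral U)"
    "norm (abs_l2 (fourier_integral U)) = norm (abs_l2 U)" using L by blast+
qed

section \<open>The unitary Fourier transform and Fourier multipliers\<close>

text \<open>Used with \<open>c = - 1\<close> for the reflection in the inverse transform and with
  \<open>c = 1\<close> for translations of the frequency.\<close>

definition affine_l2 :: "real \<Rightarrow> 'a::euclidean_space \<Rightarrow> 'a l2 \<Rightarrow> 'a l2" where
  "affine_l2 c t u = abs_l2 (\<lambda>x. rep_l2 u (t + c *\<^sub>R x))"

lemma affine_measurable [measurable]:
  "U \<in> borel_measurable borel \<Longrightarrow> (\<lambda>x. U (t + c *\<^sub>R x)) \<in> borel_measurable borel"
  for t :: "'a::euclidean_space"
  by (rule measurable_compose[where N=borel]) auto

lemma square_integrable_affine: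
  fixes t :: "'a::euclidean_space"
  assumes "c \<noteq> 0" "square_integrable U"
  shows "square_integrable (\<lambda>x. U (t + c *\<^sub>R x))"
    "\<bar>c\<bar> ^ DIM('a) * (norm (abs_l2 (\<lambda>x. U (t + c *\<^sub>R x))))\<^sup>2 = (norm (abs_l2 U))\<^sup>2"
proof -
  note [measurable] = square_integrable_measurable[OF assms(2)]
  have m: "(\<lambda>x. (cmod (U x))\<^sup>2) \<in> borel_measurable borel" by measurable
  show si: "square_integrable (\<lambda>x. U (t + c *\<^sub>R x))"
    using assms(2) lborel_integrable_affine[OF assms(1) m, of t] by (simp add: square_integrable_def)
  show "\<bar>c\<bar> ^ DIM('a) * (norm (abs_l2 (\<lambda>x. U (t + c *\<^sub>R x))))\<^sup>2 = (norm (abs_l2 U))\<^sup>2"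
    using lborel_integral_affine[OF assms(1) m, of t] by (simp add: norm_abs_l2 si assms(2))
qed

lemma affine_l2_abs:
  assumes "c \<noteq> 0" "square_integrable U"
  shows "affine_l2 c t (abs_l2 U) = abs_l2 (\<lambda>x. U (t + c *\<^sub>R x))"
  unfolding affine_l2_def
  by (rule abs_l2_cong(1)[OF square_integrable_affine(1)[OF assms(1) square_integrable_rep_l2]])
     (use square_integrable_affine(1)[OF assms] AE_lborel_affine[OF assms(1) rep_abs_l2[OF assms(2)]] in auto)

lemma norm_affine_l2: "\<bar>c\<bar> = 1 \<Longrightarrow> norm (affine_l2 c t u) = norm u"
proof (induction u rule: l2_abs_induct)
  case (abs U)
  then have c: "c \<noteq> 0" by auto
  show ?case using square_integrable_affine(2)[OF c abs(1), of t] abs(2)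
    by (simp add: affine_l2_abs[OF c abs(1)] power2_eq_iff_nonneg)
qed

lemma affine_l2_diff: "c \<noteq> 0 \<Longrightarrow> affine_l2 c t (u - v) = affine_l2 c t u - affine_l2 c t v"
  by (induction u rule: l2_abs_induct; induction v rule: l2_abs_induct)
     (simp add: abs_l2_diff affine_l2_abs square_integrable_diff square_integrable_affine)

lemma affine_l2_tendsto:
  assumes "\<bar>c\<bar> = 1" "(u \<longlongrightarrow> l) F"
  shows "((\<lambda>n. affine_l2 c t (u n)) \<longlongrightarrow> affine_l2 c t l) F"
proof -
  have c: "c \<noteq> 0" using assms(1) by auto
  have "((\<lambda>n. norm (u n - l)) \<longlongrightarrow> 0) F" using assms(2) by (simp add: LIM_zero_iff tendsto_norm_zero)
  then have "((\<lambda>n. norm (affine_l2 c t (u n) - affine_l2 c t l)) \<longlongrightarrow> 0) F"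
    by (simp add: affine_l2_diff[OF c, symmetric] norm_affine_l2[OF assms(1)])
  then show ?thesis by (simp add: tendsto_norm_zero_iff LIM_zero_iff)
qed

lemma fourier_integral_cong_AE:
  assumes "AE x in lborel. U x = V x" "U \<in> borel_measurable borel" "V \<in> borel_measurable borel"
  shows "fourier_integral U = fourier_integral V"
proof
  fix s
  note [measurable] = assms(2,3)
  have "(LINT x|lborel. cis (- (x \<bullet> s)) * U x) = (LINT x|lborel. cis (- (x \<bullet> s)) * V x)"
  proof (rule integral_cong_AE)
    show "AE x in lborel. cis (- (x \<bullet> s)) * U x = cis (- (x \<bullet> s)) * V x"
      using assms(1) by (auto elim!: eventually_mono)
  qed measurable
  then show "fourier_integral U s = fourier_integral V s" by (simp add: fourier_integral_def)
qed

abbreviation truncate :: "nat \<Rightarrow> ('a::euclidean_space \<Rightarrow> complex) \<Rightarrow> 'a \<Rightarrow> complex" where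
  "truncate n U \<equiv> (\<lambda>x. indicator (cball 0 (real n)) x * U x)"

lemma truncate_properties:
  assumes "square_integrable U"
  shows "square_integrable (truncate n U)" "integrable lborel (truncate n U)"
    "square_integrable (fourier_integral (truncate n U))"
    "norm (abs_l2 (fourier_integral (truncate n U))) = norm (abs_l2 (truncate n U))"
proof -
  show si: "square_integrable (truncate n U)" by (rule square_integrable_indicator_mult[OF assms]) auto
  have b: "truncate n U x = 0" if "real n < norm x" for x using that by (simp add: indicator_def)
  show "integrable lborel (truncate n U)" by (rule square_integrable_bounded_support(1)[OF si b])
  show "square_integrable (fourier_integral (truncate n U))"
    "norm (abs_l2 (fourier_integral (truncate n U))) = norm (abs_l2 (truncate n U))"
    by (rule plancherel_bounded_support[OF si b]; assumption)+
qed

text \<open>\<open>fourier\<close> is a \<open>lim\<close> along the representative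
  \<open>rep_l2\<close>. Fourier integrals do not see null sets, and by the isometry on truncations
  the sequence is Cauchy; so the limit exists and every representative computes it.\<close>

lemma fourier_tendsto:
  assumes U: "square_integrable U"
  shows "(\<lambda>n. abs_l2 (fourier_integral (truncate n U))) \<longlonglongrightarrow> fourier (abs_l2 U)"
proof -
  define W where "W = rep_l2 (abs_l2 U)"
  have W: "square_integrable W" unfolding W_def by (rule square_integrable_rep_l2)
  note T = truncate_properties[OF W]
  have "fourier_integral (truncate n U) = fourier_integral (truncate n W)" for n
  proof (rule fourier_integral_cong_AE)
    show "AE x in lborel. truncate n U x = truncate n W x"
      using rep_abs_l2[OF U] by (auto simp: W_def elim!: eventually_mono)
  qed (use truncate_properties(1)[OF U, of n] T(1)[of n] in \<open>auto dest: square_integrable_measurable\<close>)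
  moreover have "convergent (\<lambda>n. abs_l2 (fourier_integral (truncate n W)))"
  proof (rule Cauchy_convergent)
    have "norm (abs_l2 (fourier_integral (truncate m W)) - abs_l2 (fourier_integral (truncate n W)))
        = norm (abs_l2 (truncate m W) - abs_l2 (truncate n W))" for m n
    proof -
      have d: "(\<lambda>x. truncate m W x - truncate n W x) x = 0" if "real (max m n) < norm x" for x
        using that by (auto simp: indicator_def)
      show ?thesis
        unfolding abs_l2_diff[OF T(3) T(3)] abs_l2_diff[OF T(1) T(1)]
          fourier_integral_diff[OF T(2) T(2), abs_def, symmetric]
        by (rule plancherel_bounded_support(2)[OF square_integrable_diff[OF T(1) T(1)] d])
    qed
    moreover have "Cauchy (\<lambda>n. abs_l2 (truncate n W))"
      by (rule LIMSEQ_imp_Cauchy[OF truncate_cball_tendsto[OF W]])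
    ultimately show "Cauchy (\<lambda>n. abs_l2 (fourier_integral (truncate n W)))"
      by (simp add: Cauchy_def dist_norm)
  qed
  ultimately show ?thesis unfolding fourier_def W_def by (simp add: convergent_LIMSEQ_iff)
qed

lemma norm_fourier: "norm (fourier u) = norm u"
proof (induction u rule: l2_abs_induct)
  case (abs U)
  have "(\<lambda>n. norm (abs_l2 (truncate n U))) \<longlonglongrightarrow> norm (fourier (abs_l2 U))"
    using tendsto_norm[OF fourier_tendsto[OF abs]] by (simp add: truncate_properties(4)[OF abs])
  moreover have "(\<lambda>n. norm (abs_l2 (truncate n U))) \<longlonglongrightarrow> norm (abs_l2 U)"
    by (rule tendsto_norm[OF truncate_cball_tendsto[OF abs]])
  ultimately show ?case by (rule LIMSEQ_unique)
qed

lemma scaleC_tendsto: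
  assumes "(u \<longlongrightarrow> l) F"
  shows "((\<lambda>n. scaleC c (u n)) \<longlongrightarrow> scaleC c l) F"
proof -
  have "((\<lambda>n. norm (u n - l)) \<longlongrightarrow> 0) F" using assms by (simp add: LIM_zero_iff tendsto_norm_zero)
  then have "((\<lambda>n. norm (scaleC c (u n) - scaleC c l)) \<longlongrightarrow> 0) F"
    by (simp add: l2.scale_right_diff_distrib[symmetric] norm_scaleC tendsto_mult_right_zero)
  then show ?thesis by (simp add: tendsto_norm_zero_iff LIM_zero_iff)
qed

lemma fourier_integral_scale: "fourier_integral (\<lambda>x. c * u x) s = c * fourier_integral u s"
proof -
  have "(LINT x|lborel. cis (- (x \<bullet> s)) * (c * u x)) = (LINT x|lborel. c * (cis (- (x \<bullet> s)) * u x))"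
    by (simp only: mult.left_commute)
  then show ?thesis by (simp add: fourier_integral_def)
qed

lemma clinear_fourier: "clinear fourier"
  unfolding clinear_def
proof safe
  fix u v :: "'a l2" and c
  show "fourier (u + v) = fourier u + fourier v"
  proof (induction u rule: l2_abs_induct; induction v rule: l2_abs_induct)
    case (abs V U)
    note TU = truncate_properties[OF abs(2)] and TV = truncate_properties[OF abs(1)]
    have "abs_l2 (fourier_integral (truncate n (\<lambda>x. U x + V x)))
        = abs_l2 (fourier_integral (truncate n U)) + abs_l2 (fourier_integral (truncate n V))" for n
    proof -
      have "fourier_integral (truncate n (\<lambda>x. U x + V x)) = (\<lambda>s. fourier_integral (truncate n U) s + fourier_integral (truncate n V) s)"
      proof
        fix s
        show "fourier_integral (truncate n (\<lambda>x. U x + V x)) s = fourier_integral (truncate n U) s + fourier_integral (truncate n V) s"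
          using integrable_cis_mult[OF TU(2), of "\<lambda>x. - (x \<bullet> s)" n] integrable_cis_mult[OF TV(2), of "\<lambda>x. - (x \<bullet> s)" n]
          by (simp add: fourier_integral_def distrib_left)
      qed
      then show ?thesis by (simp add: abs_l2_add TU TV)
    qed
    then have "(\<lambda>n. abs_l2 (fourier_integral (truncate n U)) + abs_l2 (fourier_integral (truncate n V))) \<longlonglongrightarrow> fourier (abs_l2 U + abs_l2 V)"
      using fourier_tendsto[OF square_integrable_add[OF abs(2,1)]] by (simp add: abs_l2_add abs)
    moreover have "(\<lambda>n. abs_l2 (fourier_integral (truncate n U)) + abs_l2 (fourier_integral (truncate n V))) \<longlonglongrightarrow> fourier (abs_l2 U) + fourier (abs_l2 V)"
      by (intro tendsto_add fourier_tendsto abs)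
    ultimately show ?case by (rule LIMSEQ_unique)
  qed
  show "fourier (scaleC c u) = scaleC c (fourier u)"
  proof (induction u rule: l2_abs_induct)
    case (abs U)
    have "abs_l2 (fourier_integral (truncate n (\<lambda>x. c * U x))) = scaleC c (abs_l2 (fourier_integral (truncate n U)))" for n
      unfolding abs_l2_scaleC[OF truncate_properties(3)[OF abs]] fourier_integral_scale[symmetric]
      by (simp add: mult.left_commute)
    then have "(\<lambda>n. scaleC c (abs_l2 (fourier_integral (truncate n U)))) \<longlonglongrightarrow> fourier (scaleC c (abs_l2 U))"
      using fourier_tendsto[OF square_integrable_scale[OF abs, of c]] by (simp add: abs_l2_scaleC abs)
    then show ?case using LIMSEQ_unique[OF _ scaleC_tendsto[OF fourier_tendsto[OF abs]]] by blast
  qed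
qed

text \<open>For integrable U the truncated integrals converge pointwise as well, by dominated
  convergence, so the limit in mean and the Fourier integral coincide.\<close>

lemma fourier_abs_l2:
  fixes U :: "'a::euclidean_space \<Rightarrow> complex"
  assumes U: "square_integrable U" and int: "integrable lborel U"
  shows "square_integrable (fourier_integral U)" "fourier (abs_l2 U) = abs_l2 (fourier_integral U)"
proof -
  have [measurable]: "U \<in> borel_measurable borel" using U by (rule square_integrable_measurable)
  have "(\<lambda>n. fourier_integral (truncate n U) s) \<longlonglongrightarrow> fourier_integral U s" for s
    unfolding fourier_integral_def
  proof (intro tendsto_mult tendsto_const integral_dominated_convergence[where w="\<lambda>x. cmod (U x)"])
    show "AE x in lborel. (\<lambda>n. cis (- (x \<bullet> s)) * truncate n U x) \<longlonglongrightarrow> cis (- (x \<bullet> s)) * U x"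
    proof (rule AE_I2)
      fix x :: 'a
      obtain n0 :: nat where "norm x \<le> n0" using real_arch_simple by blast
      then show "(\<lambda>n. cis (- (x \<bullet> s)) * truncate n U x) \<longlonglongrightarrow> cis (- (x \<bullet> s)) * U x"
        by (intro tendsto_eventually eventually_sequentiallyI[of n0]) auto
    qed
    show "AE x in lborel. norm (cis (- (x \<bullet> s)) * truncate n U x) \<le> cmod (U x)" for n
      by (auto simp: norm_mult indicator_def)
    show "integrable lborel (\<lambda>x. cmod (U x))" by (rule integrable_norm[OF int])
    show "(\<lambda>x. cis (- (x \<bullet> s)) * U x) \<in> borel_measurable lborel" by measurable
    show "(\<lambda>x. cis (- (x \<bullet> s)) * truncate n U x) \<in> borel_measurable lborel" for n
      by (rule borel_measurable_integrable[OF integrable_cis_mult[OF truncate_properties(2)[OF U]]]) measurable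
  qed
  note L = l2_limit_pointwise[OF truncate_properties(3)[OF U] fourier_tendsto[OF U] _ AE_I2[OF this]]
  show "square_integrable (fourier_integral U)" "fourier (abs_l2 U) = abs_l2 (fourier_integral U)"
    using L(1) L(2)[symmetric] by simp_all
qed

section \<open>Unitarity and the inverse transform\<close>

lemma cinner_eq_if_norm_eq:
  fixes S :: "'a::euclidean_space l2 \<Rightarrow> 'a l2"
  assumes S: "clinear S" and T: "\<And>u. norm (S u) = norm u"
  shows "cinner (S u) (S v) = cinner u v"
proof -
  have re: "inner (S u) (S v) = inner u v" for u v
    using T[of "u + v"] T[of u] T[of v]
    by (simp add: dot_norm clinear_add[OF S, symmetric])
  \<comment> \<open>Polarisation yields real parts only; an imaginary part is the real part after
    multiplication by \<open>- \<i>\<close>.\<close>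
  have im: "Im (cinner u v) = Re (cinner (scaleC (- \<i>) u) v)" for u v :: "'a l2"
    by (simp only: cinner_scaleC) simp
  have "Im (cinner (S u) (S v)) = Im (cinner u v)"
    using re[of "scaleC (- \<i>) u" v] by (simp only: im clinear_scaleC[OF S, symmetric] inner_l2_def)
  with re[of u v] show ?thesis by (simp add: inner_l2_def complex_eq_iff)
qed

lemma cinner_tendsto:
  fixes u v :: "'b \<Rightarrow> 'a::euclidean_space l2"
  assumes "(u \<longlongrightarrow> a) F" "(v \<longlongrightarrow> b) F"
  shows "((\<lambda>n. cinner (u n) (v n)) \<longlongrightarrow> cinner a b) F"
proof -
  have im: "Im (cinner u v) = inner (scaleC (- \<i>) u) v" for u v :: "'a l2"
    by (simp only: cinner_scaleC inner_l2_def) simp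
  have "((\<lambda>n. Complex (inner (u n) (v n)) (inner (scaleC (- \<i>) (u n)) (v n))) \<longlongrightarrow>
      Complex (inner a b) (inner (scaleC (- \<i>) a) b)) F"
    by (intro tendsto_Complex tendsto_inner scaleC_tendsto assms)
  then show ?thesis unfolding im[symmetric] unfolding inner_l2_def complex_surj .
qed

lemma cinner_fourier: "cinner (fourier u) (fourier v) = cinner u v"
  by (rule cinner_eq_if_norm_eq[OF clinear_fourier norm_fourier])

text \<open>The multiplication formula on truncations; complex conjugation reverses the sign in the
  exponent and so brings in the reflection.\<close>

lemma cinner_fourier_adjoint: "cinner (fourier u) v = cinner u (affine_l2 (- 1) 0 (fourier v))"
proof (induction u rule: l2_abs_induct; induction v rule: l2_abs_induct)
  case (abs V U)
  note TU = truncate_properties[OF abs(2)] and TV = truncate_properties[OF abs(1)]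
  have eq: "cinner (abs_l2 (fourier_integral (truncate n U))) (abs_l2 (truncate n V))
      = cinner (abs_l2 (truncate n U)) (affine_l2 (- 1) 0 (abs_l2 (fourier_integral (truncate n V))))" for n
  proof -
    have c: "integrable lborel (\<lambda>x. cnj (truncate n V x))" using TV(2)[of n] by (simp only: integrable_cnj)
    have "cinner (abs_l2 (fourier_integral (truncate n U))) (abs_l2 (truncate n V))
        = (LINT s|lborel. fourier_integral (truncate n U) s * cnj (truncate n V s))"
      by (rule cinner_abs_l2[OF TU(3) TV(1)])
    also have "\<dots> = (LINT s|lborel. truncate n U s * fourier_integral (\<lambda>x. cnj (truncate n V x)) s)"
      by (rule fourier_integral_mult[OF TU(2) c])
    also have "\<dots> = (LINT s|lborel. truncate n U s * cnj (fourier_integral (truncate n V) (0 + (- 1) *\<^sub>R s)))"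
      unfolding cnj_fourier_integral by simp
    also have "\<dots> = cinner (abs_l2 (truncate n U)) (affine_l2 (- 1) 0 (abs_l2 (fourier_integral (truncate n V))))"
      unfolding affine_l2_abs[OF _ TV(3), of "-1", simplified]
      by (subst cinner_abs_l2[OF TU(1)]) (use square_integrable_affine(1)[OF _ TV(3)[of n], of "-1" 0] in auto)
    finally show ?thesis .
  qed
  have "(\<lambda>n. cinner (abs_l2 (fourier_integral (truncate n U))) (abs_l2 (truncate n V))) \<longlonglongrightarrow> cinner (fourier (abs_l2 U)) (abs_l2 V)"
    by (intro cinner_tendsto fourier_tendsto truncate_cball_tendsto abs)
  moreover have "(\<lambda>n. cinner (abs_l2 (truncate n U)) (affine_l2 (- 1) 0 (abs_l2 (fourier_integral (truncate n V)))))
      \<longlonglongrightarrow> cinner (abs_l2 U) (affine_l2 (- 1) 0 (fourier (abs_l2 V)))"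
    by (intro cinner_tendsto fourier_tendsto truncate_cball_tendsto affine_l2_tendsto abs) simp
  ultimately show ?case unfolding eq by (rule LIMSEQ_unique)
qed

lemma cinner_eqI: "(\<And>v. cinner u v = cinner w v) \<Longrightarrow> u = w"
proof -
  assume "\<And>v. cinner u v = cinner w v"
  then have "cinner (u - w) (u - w) = 0" by (simp add: cinner_diff)
  then show "u = w" by (simp add: cinner_self)
qed

lemma clinear_affine_l2:
  assumes "c \<noteq> 0"
  shows "clinear (affine_l2 c t)"
  unfolding clinear_def
proof safe
  fix u v :: "'a l2" and k
  show "affine_l2 c t (u + v) = affine_l2 c t u + affine_l2 c t v"
    using affine_l2_diff[OF assms, of t "u + v" v] by (simp add: algebra_simps)
  show "affine_l2 c t (scaleC k u) = scaleC k (affine_l2 c t u)"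
    by (induction u rule: l2_abs_induct)
       (simp add: abs_l2_scaleC affine_l2_abs[OF assms] square_integrable_scale square_integrable_affine(1)[OF assms])
qed

text \<open>The adjoint of the isometry \<open>fourier\<close> is its composition with the reflection, again an
  isometry; hence both are unitary.\<close>

lemma inv_fourier: "inv fourier = (\<lambda>v::'a::euclidean_space l2. affine_l2 (- 1) 0 (fourier v))"
  and bij_fourier: "bij (fourier :: 'a l2 \<Rightarrow> 'a l2)"
proof -
  let ?A = "\<lambda>v::'a l2. affine_l2 (- 1) 0 (fourier v)"
  have 1: "?A (fourier u) = u" for u
  proof (rule cinner_eqI)
    fix v
    have "cinner (?A (fourier u)) v = cnj (cinner v (?A (fourier u)))" by (rule cinner_commute)
    also have "\<dots> = cnj (cinner (fourier v) (fourier u))" by (simp only: cinner_fourier_adjoint[symmetric])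
    also have "\<dots> = cinner u v" by (simp add: cinner_fourier cinner_commute[of u v])
    finally show "cinner (?A (fourier u)) v = cinner u v" .
  qed
  have A: "cinner (?A u) (?A v) = cinner u v" for u v
    by (rule cinner_eq_if_norm_eq)
       (auto intro: clinear_compose[OF clinear_affine_l2 clinear_fourier] simp: norm_affine_l2 norm_fourier)
  \<comment> \<open>Surjectivity: the adjoint relation turns the left side into
    \<open>cinner (?A u) (?A v)\<close>, and \<open>?A\<close> is an isometry.\<close>
  have 2: "fourier (?A u) = u" for u
    by (rule cinner_eqI) (simp only: cinner_fourier_adjoint A)
  show "bij (fourier :: 'a l2 \<Rightarrow> 'a l2)" by (rule o_bij[of ?A]) (auto simp: 1 2)
  then show "inv fourier = ?A" using 2 by (metis bij_inv_eq_iff ext)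
qed

lemma fourier_inv [simp]: "fourier (inv fourier u) = u" "inv fourier (fourier u) = u"
  by (rule surj_f_inv_f[OF bij_is_surj[OF bij_fourier]]) (rule inv_f_f[OF bij_is_inj[OF bij_fourier]])

lemma clinear_inv_fourier: "clinear (inv fourier)"
  unfolding inv_fourier by (rule clinear_compose[OF clinear_affine_l2 clinear_fourier]) simp

lemma norm_inv_fourier: "norm (inv fourier u) = norm u"
  by (metis fourier_inv(1) norm_fourier)

lemma cinner_inv_fourier: "cinner (inv fourier u) v = cinner u (fourier v)"
  by (metis fourier_inv(1) cinner_fourier)

lemma inv_fourier_abs_l2:
  fixes V :: "'a::euclidean_space \<Rightarrow> complex"
  assumes "square_integrable V" "integrable lborel V"
  shows "square_integrable (\<lambda>x. fourier_integral V (- x))" "inv fourier (abs_l2 V) = abs_l2 (\<lambda>x. fourier_integral V (- x))"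
  using fourier_abs_l2[OF assms] affine_l2_abs[of "- 1" "fourier_integral V" 0]
    square_integrable_affine(1)[of "- 1" "fourier_integral V" 0]
  by (simp_all add: inv_fourier)

section \<open>Algebra of Fourier multipliers\<close>

lemma clinear_fourier_multiplier: "ess_bounded C m \<Longrightarrow> clinear (fourier_multiplier m)"
  unfolding fourier_multiplier_def comp_def
  by (intro clinear_compose[OF clinear_inv_fourier] clinear_compose[OF _ clinear_fourier] clinear_mult_op)

lemma norm_fourier_multiplier: "ess_bounded C m \<Longrightarrow> norm (fourier_multiplier m u) \<le> C * norm u"
  unfolding fourier_multiplier_def comp_def norm_inv_fourier
  using norm_mult_op[of C m "fourier u"] by (simp add: norm_fourier)

lemma fourier_multiplier_mult:
  assumes "ess_bounded C m" "ess_bounded D n"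
  shows "fourier_multiplier m (fourier_multiplier n u) = fourier_multiplier (\<lambda>x. m x * n x) u"
  by (simp add: fourier_multiplier_def mult_op_mult[OF assms])

lemma fourier_multiplier_add:
  assumes "ess_bounded C m" "ess_bounded D n"
  shows "fourier_multiplier (\<lambda>x. m x + n x) u = fourier_multiplier m u + fourier_multiplier n u"
  by (simp add: fourier_multiplier_def mult_op_add[OF assms] clinear_add[OF clinear_inv_fourier])

lemma fourier_multiplier_cong:
  assumes "AE x in lborel. m x = n x" "ess_bounded C m" "ess_bounded D n"
  shows "fourier_multiplier m = fourier_multiplier n"
  using mult_op_cong[OF assms] by (simp add: fourier_multiplier_def fun_eq_iff)

lemma cinner_fourier_multiplier:
  assumes m: "ess_bounded C m"
  shows "cinner (fourier_multiplier m u) v = cinner u (fourier_multiplier (\<lambda>x. cnj (m x)) v)"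
proof -
  have "cinner (fourier_multiplier m u) v = cinner (fourier u) (mult_op (\<lambda>x. cnj (m x)) (fourier v))"
    by (simp add: fourier_multiplier_def cinner_inv_fourier cinner_mult_op[OF m])
  also have "\<dots> = cinner u (fourier_multiplier (\<lambda>x. cnj (m x)) v)"
    by (subst (1 2) cinner_commute) (simp add: fourier_multiplier_def cinner_inv_fourier)
  finally show ?thesis .
qed

lemma ess_bounded_cis: "\<theta> \<in> borel_measurable borel \<Longrightarrow> ess_bounded 1 (\<lambda>x. cis (\<theta> x))"
  by (auto simp: ess_bounded_def)

text \<open>In this form of the Weyl relations the commutator of a character with a multiplier c(D)
  is governed by the differences c(\<xi> + s) - c(s).\<close>

lemma fourier_modulation:
  fixes \<xi> :: "'a::euclidean_space"
  shows "fourier (mult_op (\<lambda>x. cis (- (x \<bullet> \<xi>))) u) = affine_l2 1 \<xi> (fourier u)"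
proof (induction u rule: l2_abs_induct)
  case (abs U)
  let ?e = "\<lambda>x. cis (- (x \<bullet> \<xi>))"
  have e: "ess_bounded 1 ?e" by (rule ess_bounded_cis) measurable
  have eU: "square_integrable (\<lambda>x. ?e x * U x)" by (rule square_integrable_ess_bounded_mult(1)[OF e abs])
  have "fourier_integral (truncate n (\<lambda>x. ?e x * U x)) = (\<lambda>s. fourier_integral (truncate n U) (\<xi> + 1 *\<^sub>R s))" for n
  proof
    fix s
    have "cis (- (x \<bullet> (\<xi> + 1 *\<^sub>R s))) = cis (- (x \<bullet> s)) * ?e x" for x
      by (simp add: inner_add_right cis_mult add.commute)
    then show "fourier_integral (truncate n (\<lambda>x. ?e x * U x)) s = fourier_integral (truncate n U) (\<xi> + 1 *\<^sub>R s)"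
      unfolding fourier_integral_def by (simp only: mult_ac)
  qed
  then have "(\<lambda>n. affine_l2 1 \<xi> (abs_l2 (fourier_integral (truncate n U)))) \<longlonglongrightarrow> fourier (mult_op ?e (abs_l2 U))"
    using fourier_tendsto[OF eU] unfolding fun_eq_iff[symmetric]
    by (simp add: mult_op_abs[OF e abs] affine_l2_abs truncate_properties[OF abs])
  moreover have "(\<lambda>n. affine_l2 1 \<xi> (abs_l2 (fourier_integral (truncate n U)))) \<longlonglongrightarrow> affine_l2 1 \<xi> (fourier (abs_l2 U))"
    by (intro affine_l2_tendsto fourier_tendsto abs) simp
  ultimately show ?case by (rule LIMSEQ_unique)
qed

section \<open>Approximation by operators of finite rank\<close>

text \<open>An explicit sum of rank-one maps, because sums, composition from the left and adjoints
  then act term by term; \<open>rank_le_finite_sum\<close> translates it back to spans.\<close>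

definition rank_approx :: "('a::euclidean_space l2 \<Rightarrow> 'a l2) \<Rightarrow> nat \<Rightarrow> real \<Rightarrow> bool" where
  "rank_approx T n \<epsilon> \<longleftrightarrow>
     (\<exists>v w. \<forall>u. norm (T u - (\<Sum>i<n. scaleC (cinner u (v i)) (w i))) \<le> \<epsilon> * norm u)"

lemma rank_approx_index:
  fixes T :: "'a::euclidean_space l2 \<Rightarrow> 'a l2"
  assumes "finite I" "card I \<le> n" "\<And>u. norm (T u - (\<Sum>i\<in>I. scaleC (cinner u (v i)) (w i))) \<le> \<epsilon> * norm u"
  shows "rank_approx T n \<epsilon>"
proof -
  obtain h where h: "bij_betw h {..<card I} I"
    using ex_bij_betw_nat_finite[OF assms(1)] by (auto simp: atLeast0LessThan)
  define v' where "v' = (\<lambda>i. v (h i))"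
  \<comment> \<open>Surplus indices are filled with zero vectors, so \<open>card I\<close> may be
    smaller than n.\<close>
  define w' where "w' = (\<lambda>i. if i < card I then w (h i) else 0)"
  have "(\<Sum>i<n. scaleC (cinner u (v' i)) (w' i)) = (\<Sum>i\<in>I. scaleC (cinner u (v i)) (w i))" for u
  proof -
    have "(\<Sum>i<n. scaleC (cinner u (v' i)) (w' i)) = (\<Sum>i<card I. scaleC (cinner u (v' i)) (w' i))"
      by (rule sum.mono_neutral_right) (use assms(2) in \<open>auto simp: w'_def\<close>)
    also have "\<dots> = (\<Sum>i<card I. scaleC (cinner u (v (h i))) (w (h i)))"
      by (simp add: v'_def w'_def)
    also have "\<dots> = (\<Sum>i\<in>I. scaleC (cinner u (v i)) (w i))"
      by (rule sum.reindex_bij_betw[OF h])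
    finally show ?thesis .
  qed
  then show ?thesis using assms(3) unfolding rank_approx_def by metis
qed

lemma rank_approx_mono:
  assumes "rank_approx T m \<epsilon>" "m \<le> n" "\<epsilon> \<le> \<delta>"
  shows "rank_approx T n \<delta>"
proof -
  obtain v w where "\<And>u. norm (T u - (\<Sum>i<m. scaleC (cinner u (v i)) (w i))) \<le> \<epsilon> * norm u"
    using assms(1) by (auto simp: rank_approx_def)
  then have "norm (T u - (\<Sum>i<m. scaleC (cinner u (v i)) (w i))) \<le> \<delta> * norm u" for u
    using mult_right_mono[OF assms(3) norm_ge_zero[of u]] order_trans by blast
  then show ?thesis using assms(2) by (intro rank_approx_index[of "{..<m}"]) auto
qed

lemma rank_approx_norm: "(\<And>u. norm (T u) \<le> \<epsilon> * norm u) \<Longrightarrow> rank_approx T 0 \<epsilon>"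
  by (rule rank_approx_index[of "{}"]) auto

lemma rank_approx_add:
  fixes T :: "'a::euclidean_space l2 \<Rightarrow> 'a l2"
  assumes "rank_approx S m \<delta>" "rank_approx T n \<epsilon>"
  shows "rank_approx (\<lambda>u. S u + T u) (m + n) (\<delta> + \<epsilon>)"
proof -
  obtain v w where S: "\<And>u. norm (S u - (\<Sum>i<m. scaleC (cinner u (v i)) (w i))) \<le> \<delta> * norm u"
    using assms(1) by (auto simp: rank_approx_def)
  obtain v' w' where T: "\<And>u. norm (T u - (\<Sum>i<n. scaleC (cinner u (v' i)) (w' i))) \<le> \<epsilon> * norm u"
    using assms(2) by (auto simp: rank_approx_def)
  let ?v = "case_sum v v'" and ?w = "case_sum w w'"
  show ?thesis
  proof (rule rank_approx_index[of "{..<m} <+> {..<n}" _ _ ?v ?w])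
    fix u
    have "norm (S u + T u - (\<Sum>i\<in>{..<m} <+> {..<n}. scaleC (cinner u (?v i)) (?w i)))
        = norm ((S u - (\<Sum>i<m. scaleC (cinner u (v i)) (w i))) + (T u - (\<Sum>i<n. scaleC (cinner u (v' i)) (w' i))))"
      by (subst sum.Plus) (auto simp: algebra_simps)
    also have "\<dots> \<le> (\<delta> + \<epsilon>) * norm u"
      using norm_triangle_mono[OF S T] by (simp add: distrib_right)
    finally show "norm (S u + T u - (\<Sum>i\<in>{..<m} <+> {..<n}. scaleC (cinner u (?v i)) (?w i))) \<le> (\<delta> + \<epsilon>) * norm u" .
  qed (auto simp: card_Plus)
qed

lemma rank_approx_compose:
  fixes T :: "'a::euclidean_space l2 \<Rightarrow> 'a l2"
  assumes T: "rank_approx T n \<epsilon>" and B: "clinear B" "\<And>u. norm (B u) \<le> K * norm u" "0 \<le> K"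
  shows "rank_approx (\<lambda>u. B (T u)) n (K * \<epsilon>)"
proof -
  obtain v w where T: "\<And>u. norm (T u - (\<Sum>i<n. scaleC (cinner u (v i)) (w i))) \<le> \<epsilon> * norm u"
    using T by (auto simp: rank_approx_def)
  have "norm (B (T u) - (\<Sum>i<n. scaleC (cinner u (v i)) (B (w i)))) \<le> K * \<epsilon> * norm u" for u
  proof -
    have "norm (B (T u) - (\<Sum>i<n. scaleC (cinner u (v i)) (B (w i))))
        = norm (B (T u - (\<Sum>i<n. scaleC (cinner u (v i)) (w i))))"
      by (simp add: clinear_diff[OF B(1)] clinear_sum[OF B(1)] clinear_scaleC[OF B(1)])
    also have "\<dots> \<le> K * norm (T u - (\<Sum>i<n. scaleC (cinner u (v i)) (w i)))" by (rule B)
    also have "\<dots> \<le> K * (\<epsilon> * norm u)" by (intro mult_left_mono T B)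
    finally show ?thesis by (simp add: mult.assoc)
  qed
  then show ?thesis by (intro rank_approx_index[of "{..<n}"]) auto
qed

lemma rank_approx_minus: "rank_approx T n \<epsilon> \<Longrightarrow> rank_approx (\<lambda>u. - T u) n \<epsilon>"
  for T :: "'a::euclidean_space l2 \<Rightarrow> 'a l2"
  using rank_approx_compose[of T n \<epsilon> "\<lambda>u. - u" 1] by (simp add: clinear_def)

lemma rank_approx_diff:
  fixes T :: "'a::euclidean_space l2 \<Rightarrow> 'a l2"
  assumes "rank_approx S m \<delta>" "rank_approx T n \<epsilon>"
  shows "rank_approx (\<lambda>u. S u - T u) (m + n) (\<delta> + \<epsilon>)"
  using rank_approx_add[OF assms(1) rank_approx_minus[OF assms(2)]] by simp

text \<open>Passing to the adjoint exchanges \<open>v\<close> and \<open>w\<close> in every rank-one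
  term. An estimate for a(x) h(D) thereby yields one for h(D) a(x).\<close>

lemma rank_approx_adjoint:
  fixes T :: "'a::euclidean_space l2 \<Rightarrow> 'a l2"
  assumes T: "rank_approx T n \<epsilon>" and adj: "\<And>u v. cinner (T u) v = cinner u (S v)" and "0 \<le> \<epsilon>"
  shows "rank_approx S n \<epsilon>"
proof -
  obtain v w where T: "\<And>u. norm (T u - (\<Sum>i<n. scaleC (cinner u (v i)) (w i))) \<le> \<epsilon> * norm u"
    using T by (auto simp: rank_approx_def)
  have "norm (S u - (\<Sum>i<n. scaleC (cinner u (w i)) (v i))) \<le> \<epsilon> * norm u" for u
  proof (rule norm_le_of_cinner_bound)
    fix x
    have adj': "cinner (S u) x = cinner u (T x)"
      by (subst (1 2) cinner_commute) (simp add: adj)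
    have "cinner (S u - (\<Sum>i<n. scaleC (cinner u (w i)) (v i))) x
        = cinner u (T x - (\<Sum>i<n. scaleC (cinner x (v i)) (w i)))"
      by (simp add: cinner_diff cinner_diff_right cinner_sum cinner_sum_right cinner_scaleC
          cinner_scaleC_right adj' cinner_commute[of x] mult.commute)
    also have "cmod \<dots> \<le> norm u * (\<epsilon> * norm x)"
      by (rule order_trans[OF cinner_bound mult_left_mono[OF T]]) simp
    finally show "cmod (cinner (S u - (\<Sum>i<n. scaleC (cinner u (w i)) (v i))) x) \<le> \<epsilon> * norm u * norm x"
      by (simp add: mult_ac)
  qed (use assms(3) in simp)
  then show ?thesis by (intro rank_approx_index[of "{..<n}"]) auto
qed

section \<open>Bessel's inequality and operators of Hilbert-Schmidt type\<close>

definition orthonormal :: "('i \<Rightarrow> 'a::euclidean_space l2) \<Rightarrow> 'i set \<Rightarrow> bool" where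
  "orthonormal e I \<longleftrightarrow> (\<forall>i\<in>I. \<forall>j\<in>I. cinner (e i) (e j) = of_bool (i = j))"

lemma norm_diff_projection:
  assumes "finite I" "orthonormal e I"
  shows "(norm (u - (\<Sum>i\<in>I. scaleC (cinner u (e i)) (e i))))\<^sup>2 = (norm u)\<^sup>2 - (\<Sum>i\<in>I. (cmod (cinner u (e i)))\<^sup>2)"
    "\<And>j. j \<in> I \<Longrightarrow> cinner (u - (\<Sum>i\<in>I. scaleC (cinner u (e i)) (e i))) (e j) = 0"
proof -
  let ?p = "\<Sum>i\<in>I. scaleC (cinner u (e i)) (e i)"
  have pe: "cinner ?p (e j) = cinner u (e j)" if "j \<in> I" for j
  proof -
    have "cinner ?p (e j) = (\<Sum>i\<in>I. cinner u (e i) * of_bool (i = j))"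
      using assms(2) that unfolding cinner_sum cinner_scaleC orthonormal_def by (intro sum.cong) auto
    then show ?thesis using assms(1) that by (simp add: of_bool_def if_distrib[of "(*) _"] cong: if_cong)
  qed
  then show z: "cinner (u - ?p) (e j) = 0" if "j \<in> I" for j using that by (simp add: cinner_diff)
  have "cinner (u - ?p) (u - ?p) = cinner (u - ?p) u"
    by (simp add: cinner_diff_right[of _ u] cinner_sum_right cinner_scaleC_right z)
  also have "\<dots> = cinner u u - (\<Sum>i\<in>I. cinner u (e i) * cnj (cinner u (e i)))"
    by (simp add: cinner_diff cinner_sum cinner_scaleC cinner_commute[of _ u, symmetric] cong: sum.cong)
  also have "\<dots> = of_real ((norm u)\<^sup>2 - (\<Sum>i\<in>I. (cmod (cinner u (e i)))\<^sup>2))"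
    by (simp add: cinner_self complex_norm_square[symmetric])
  finally show "(norm (u - ?p))\<^sup>2 = (norm u)\<^sup>2 - (\<Sum>i\<in>I. (cmod (cinner u (e i)))\<^sup>2)"
    unfolding cinner_self using of_real_eq_iff by blast
qed

lemma bessel:
  assumes "finite I" "orthonormal e I"
  shows "(\<Sum>i\<in>I. (cmod (cinner u (e i)))\<^sup>2) \<le> (norm u)\<^sup>2"
  using norm_diff_projection(1)[OF assms, of u] zero_le_power2[of "norm (u - (\<Sum>i\<in>I. scaleC (cinner u (e i)) (e i)))"]
  by linarith

text \<open>A maximal orthonormal system on which \<open>T\<close> is larger than \<open>\<epsilon>\<close> has at most \<open>n\<close> elements,
  and \<open>T\<close> is bounded by \<open>\<epsilon>\<close> on its orthogonal complement.\<close>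

lemma rank_approx_hilbert_schmidt:
  fixes T :: "'a::euclidean_space l2 \<Rightarrow> 'a l2"
  assumes T: "clinear T"
    and H: "\<And>e (m::nat). orthonormal e {..<m} \<Longrightarrow> (\<Sum>i<m. (norm (T (e i)))\<^sup>2) \<le> H"
    and \<epsilon>: "0 < \<epsilon>" "H \<le> real n * \<epsilon>\<^sup>2"
  shows "rank_approx T n \<epsilon>"
proof -
  define A where "A = {m::nat. \<exists>e. orthonormal e {..<m} \<and> (\<forall>i<m. \<epsilon> < norm (T (e i)))}"
  have le: "m \<le> n" if mA: "m \<in> A" for m
  proof -
    obtain e where e: "orthonormal e {..<m}" "\<And>i. i < m \<Longrightarrow> \<epsilon> < norm (T (e i))" using mA by (auto simp: A_def)
    \<comment> \<open>Chebyshev's count: each of the m vectors contributes at least \<epsilon>^2 to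
      a sum bounded by H.\<close>
    have "real m * \<epsilon>\<^sup>2 = (\<Sum>i<m. \<epsilon>\<^sup>2)" by simp
    also have "\<dots> \<le> (\<Sum>i<m. (norm (T (e i)))\<^sup>2)"
      by (intro sum_mono power_mono less_imp_le) (use e(2) \<epsilon> in auto)
    also have "\<dots> \<le> real n * \<epsilon>\<^sup>2" using H[OF e(1)] \<epsilon>(2) by linarith
    finally show ?thesis using \<epsilon>(1) by simp
  qed
  have "finite A" using le by (meson finite_nat_set_iff_bounded_le)
  moreover have "0 \<in> A" by (auto simp: A_def orthonormal_def)
  ultimately obtain m where m: "m \<in> A" "Suc m \<notin> A"
    by (metis Max_ge Max_in empty_iff not_less_eq_eq order_refl)
  then obtain e where e: "orthonormal e {..<m}" "\<And>i. i < m \<Longrightarrow> \<epsilon> < norm (T (e i))" by (auto simp: A_def)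
  have small: "norm (T w) \<le> \<epsilon> * norm w" if w: "\<And>j. j < m \<Longrightarrow> cinner w (e j) = 0" for w
  proof (rule ccontr)
    assume "\<not> norm (T w) \<le> \<epsilon> * norm w"
    then have gt: "norm (T w) > \<epsilon> * norm w" by simp
    then have w0: "norm w > 0" using clinear_zero[OF T] by (cases "w = 0") auto
    \<comment> \<open>After normalisation, a vector of the orthogonal complement that violates the
      bound would extend the system to length \<open>Suc m\<close>.\<close>
    define w' where "w' = scaleC (of_real (1 / norm w)) w"
    have w': "cinner w' w' = 1" using w0
      by (simp add: w'_def cinner_self norm_scaleC norm_divide)
    have "norm (T w') = norm (T w) / norm w"
      using w0 by (simp add: w'_def clinear_scaleC[OF T] norm_scaleC norm_divide)
    then have Tw': "\<epsilon> < norm (T w')" using gt w0 by (simp add: pos_less_divide_eq)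
    have z: "cinner w' (e j) = 0" "cinner (e j) w' = 0" if "j < m" for j
      using w[OF that] cinner_commute[of "e j" w] by (simp_all add: w'_def cinner_scaleC cinner_scaleC_right)
    have "orthonormal (e(m := w')) {..<Suc m}"
      using e(1) w' z by (auto simp: orthonormal_def less_Suc_eq)
    moreover have "\<forall>i<Suc m. \<epsilon> < norm (T ((e(m := w')) i))" using e(2) Tw' by (auto simp: less_Suc_eq)
    ultimately show False using m(2) unfolding A_def by blast
  qed
  have "norm (T u - (\<Sum>i<m. scaleC (cinner u (e i)) (T (e i)))) \<le> \<epsilon> * norm u" for u
  proof -
    let ?w = "u - (\<Sum>i<m. scaleC (cinner u (e i)) (e i))"
    have "T u - (\<Sum>i<m. scaleC (cinner u (e i)) (T (e i))) = T ?w"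
      by (simp add: clinear_diff[OF T] clinear_sum[OF T] clinear_scaleC[OF T])
    moreover have "norm (T ?w) \<le> \<epsilon> * norm ?w"
      by (rule small) (use norm_diff_projection(2)[OF _ e(1)] in auto)
    moreover have "norm ?w \<le> norm u"
    proof (rule power2_le_imp_le)
      show "(norm ?w)\<^sup>2 \<le> (norm u)\<^sup>2"
        unfolding norm_diff_projection(1)[OF finite_lessThan e(1)] by (simp add: sum_nonneg)
    qed simp
    ultimately show ?thesis using order_trans[OF _ mult_left_mono[of "norm ?w" "norm u" \<epsilon>]] \<epsilon>(1) by simp
  qed
  then have "rank_approx T m \<epsilon>" by (intro rank_approx_index[of "{..<m}"]) auto
  then show ?thesis by (rule rank_approx_mono) (use le m in auto)
qed

lemma bounded_clinear_finite_sum: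
  "bounded_clinear (\<lambda>u. \<Sum>i<n. scaleC (cinner u (v i)) (w i))"
proof (rule bounded_clinearI[where K="\<Sum>i<n. norm (v i) * norm (w i)"])
  show "clinear (\<lambda>u. \<Sum>i<n. scaleC (cinner u (v i)) (w i))"
    by (simp add: clinear_def cinner_add cinner_scaleC l2.scale_left_distrib sum.distrib l2.scale_sum_right)
  fix u
  have "norm (\<Sum>i<n. scaleC (cinner u (v i)) (w i)) \<le> (\<Sum>i<n. cmod (cinner u (v i)) * norm (w i))"
    by (rule order_trans[OF norm_sum]) (simp add: norm_scaleC)
  also have "\<dots> \<le> (\<Sum>i<n. (norm u * norm (v i)) * norm (w i))"
    by (intro sum_mono mult_right_mono cinner_bound) auto
  finally show "norm (\<Sum>i<n. scaleC (cinner u (v i)) (w i)) \<le> (\<Sum>i<n. norm (v i) * norm (w i)) * norm u"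
    by (simp add: sum_distrib_left mult_ac)
qed

lemma rank_le_finite_sum:
  assumes "real n \<le> t"
  shows "rank_le (\<lambda>u. \<Sum>i<n. scaleC (cinner u (v i)) (w i)) t"
  unfolding rank_le_def
proof (intro exI conjI)
  show "real (card (w ` {..<n})) \<le> t" using card_image_le[of "{..<n}" w] assms by simp
  show "range (\<lambda>u. \<Sum>i<n. scaleC (cinner u (v i)) (w i)) \<subseteq> l2.span (w ` {..<n})"
    by (rule image_subsetI, rule l2.span_sum, rule l2.span_scale, rule l2.span_base) auto
qed simp

section \<open>Singular values and compactness from finite-rank approximation\<close>

context
  fixes T :: "'a::euclidean_space l2 \<Rightarrow> 'a l2"
  assumes T: "bounded_clinear T"
begin

lemma onorm_diff_nonneg: "bounded_clinear R \<Longrightarrow> 0 \<le> onorm (\<lambda>u. T u - R u)"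
  using T by (intro onorm_pos_le bounded_linear_sub) (auto simp: bounded_clinear_def)

lemma singular_value_le:
  assumes "rank_approx T n \<epsilon>" "real n \<le> t" "0 \<le> \<epsilon>"
  shows "singular_value t T \<le> \<epsilon>"
proof -
  obtain v w where vw: "\<And>u. norm (T u - (\<Sum>i<n. scaleC (cinner u (v i)) (w i))) \<le> \<epsilon> * norm u"
    using assms(1) by (auto simp: rank_approx_def)
  let ?R = "\<lambda>u. \<Sum>i<n. scaleC (cinner u (v i)) (w i)"
  have "singular_value t T \<le> onorm (\<lambda>u. T u - ?R u)"
    unfolding singular_value_def
  proof (rule cInf_lower)
    show "onorm (\<lambda>u. T u - ?R u) \<in> {onorm (\<lambda>u. T u - R u) |R. bounded_clinear R \<and> rank_le R t}"
      by (intro CollectI exI[of _ ?R] conjI refl bounded_clinear_finite_sum rank_le_finite_sum[OF assms(2)])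
    show "bdd_below {onorm (\<lambda>u. T u - R u) |R. bounded_clinear R \<and> rank_le R t}"
      by (rule bdd_belowI[of _ 0]) (auto intro: onorm_diff_nonneg)
  qed
  also have "\<dots> \<le> \<epsilon>" by (rule onorm_bound[OF assms(3) vw])
  finally show ?thesis .
qed

lemma singular_value_nonneg:
  assumes "0 \<le> t"
  shows "0 \<le> singular_value t T"
  unfolding singular_value_def
proof (rule cInf_greatest)
  show "{onorm (\<lambda>u. T u - R u) |R. bounded_clinear R \<and> rank_le R t} \<noteq> {}"
    using bounded_clinear_finite_sum[of "\<lambda>_. 0" "\<lambda>_. 0::'a l2" 0] rank_le_finite_sum[of 0 t "\<lambda>_. 0" "\<lambda>_. 0::'a l2"] assms by auto
qed (auto intro: onorm_diff_nonneg)

lemma compact_operatorI: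
  assumes approx: "\<And>e. e > 0 \<Longrightarrow> \<exists>n. rank_approx T n e"
  shows "compact_operator T"
  unfolding compact_operator_def
proof (intro conjI T)
  show "compact (closure (T ` cball 0 1))"
    unfolding compact_eq_totally_bounded
  proof (intro conjI allI impI)
    show "Topological_Spaces.complete (closure (T ` cball 0 1))" by (simp add: complete_eq_closed)
    fix e :: real assume e: "e > 0"
    then obtain n where "rank_approx T n (e / 3)" using approx[of "e / 3"] by auto
    then obtain v w where vw: "\<And>u. norm (T u - (\<Sum>i<n. scaleC (cinner u (v i)) (w i))) \<le> e / 3 * norm u"
      by (auto simp: rank_approx_def)
    \<comment> \<open>Each rank-one term maps the unit ball into the continuous image of a disc, so
      the finite sum maps it into a sum of compact sets.\<close>
    have "\<exists>K. compact K \<and> (\<forall>u\<in>cball 0 1. (\<Sum>i<n. scaleC (cinner u (v i)) (w i)) \<in> K)"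
    proof (induction n)
      case (Suc n)
      then obtain K where K: "compact K" "\<And>u. u \<in> cball 0 1 \<Longrightarrow> (\<Sum>i<n. scaleC (cinner u (v i)) (w i)) \<in> K" by blast
      define L where "L = (\<lambda>c. scaleC c (w n)) ` cball 0 (norm (v n))"
      have eq: "(\<lambda>c. scaleC c (w n)) = (\<lambda>c. Re c *\<^sub>R w n + Im c *\<^sub>R scaleC \<i> (w n))"
        by (auto simp: scaleR_scaleC mult.commute complex_eq[symmetric] simp flip: l2.scale_left_distrib)
      have "continuous_on UNIV (\<lambda>c. scaleC c (w n))" unfolding eq by (intro continuous_intros)
      then have "compact L" unfolding L_def
        by (intro compact_continuous_image) (auto intro: continuous_on_subset)
      moreover have "scaleC (cinner u (v n)) (w n) \<in> L" if "u \<in> cball 0 1" for u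
      proof -
        have "norm u * norm (v n) \<le> 1 * norm (v n)" using that by (intro mult_right_mono) auto
        then show ?thesis using cinner_bound[of u "v n"] by (auto simp: L_def)
      qed
      ultimately show ?case
        using K by (intro exI[of _ "{x + y |x y. x \<in> K \<and> y \<in> L}"]) (auto intro!: compact_sums, blast)
    qed (rule exI[of _ "{0}"], auto)
    then obtain K where K: "compact K" "\<And>u. u \<in> cball 0 1 \<Longrightarrow> (\<Sum>i<n. scaleC (cinner u (v i)) (w i)) \<in> K" by blast
    then obtain k where k: "finite k" "K \<subseteq> (\<Union>x\<in>k. ball x (e / 3))"
      unfolding compact_eq_totally_bounded using e by (meson divide_pos_pos zero_less_numeral)
    \<comment> \<open>Closed balls of radius 2 e / 3 leave room: their finite union is closed, hence
      contains the closure of the image, and still lies in the open balls of radius e.\<close>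
    have "T ` cball 0 1 \<subseteq> (\<Union>x\<in>k. cball x (2 * e / 3))"
    proof safe
      fix u :: "'a l2" assume u: "u \<in> cball 0 1"
      then obtain x where x: "x \<in> k" "dist x (\<Sum>i<n. scaleC (cinner u (v i)) (w i)) < e / 3"
        using subsetD[OF k(2) K(2)[OF u]] by auto
      have "dist (\<Sum>i<n. scaleC (cinner u (v i)) (w i)) (T u) \<le> e / 3"
      proof -
        have "e / 3 * norm u \<le> e / 3" using u e by (intro mult_left_le) auto
        then show ?thesis using vw[of u] by (simp add: dist_norm norm_minus_commute)
      qed
      then have "dist x (T u) \<le> 2 * e / 3"
        using x(2) dist_triangle[of x "T u" "\<Sum>i<n. scaleC (cinner u (v i)) (w i)"] by linarith
      with x(1) show "T u \<in> (\<Union>x\<in>k. cball x (2 * e / 3))" by auto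
    qed
    then have "closure (T ` cball 0 1) \<subseteq> (\<Union>x\<in>k. cball x (2 * e / 3))"
      by (rule closure_minimal) (use k(1) in \<open>auto intro: closed_UN\<close>)
    also have "\<dots> \<subseteq> (\<Union>x\<in>k. ball x e)" using e by (intro UN_mono) auto
    finally show "\<exists>k. finite k \<and> closure (T ` cball 0 1) \<subseteq> (\<Union>x\<in>k. ball x e)" using k(1) by blast
  qed
qed

end

text \<open>The order of the quantifiers matters: C is fixed before \<eta>. For t = C N^d the error
  \<eta> / N is C^(1/d) \<eta> t^(-1/d), which becomes small compared with t^(-1/d) because C does
  not grow as \<eta> shrinks.\<close>

definition infinitesimal_rank :: "('a::euclidean_space l2 \<Rightarrow> 'a l2) \<Rightarrow> bool" where
  "infinitesimal_rank T \<longleftrightarrow> (\<exists>C::nat. \<forall>\<eta>>0. \<forall>\<^sub>F N in sequentially. rank_approx T (C * N ^ DIM('a)) (\<eta> / real N))"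

lemma weak_schatten_0I:
  fixes T :: "'a::euclidean_space l2 \<Rightarrow> 'a l2"
  assumes T: "clinear T" "\<And>u. norm (T u) \<le> K * norm u" and small: "infinitesimal_rank T"
  shows "T \<in> weak_schatten_0 (real DIM('a))"
proof -
  let ?d = "DIM('a)"
  have d: "?d > 0" by simp
  have bT: "bounded_clinear T" by (rule bounded_clinearI[OF T])
  obtain C0 :: nat where C0: "\<And>\<eta>. \<eta> > 0 \<Longrightarrow> \<forall>\<^sub>F N in sequentially. rank_approx T (C0 * N ^ ?d) (\<eta> / real N)"
    using small unfolding infinitesimal_rank_def by blast
  \<comment> \<open>\<open>Suc C0\<close> is positive, so that t may be divided by C below.\<close>
  define C where "C = Suc C0"
  have C: "\<forall>\<^sub>F N in sequentially. rank_approx T (C * N ^ ?d) (\<eta> / real N)" if "\<eta> > 0" for \<eta>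
    using C0[OF that] by (rule eventually_mono) (auto intro: rank_approx_mono simp: C_def)
  have C1: "C > 0" by (simp add: C_def)
  let ?K = "max K 0"
  have K: "rank_approx T 0 ?K"
  proof (rule rank_approx_norm)
    show "norm (T u) \<le> ?K * norm u" for u
      using T(2)[of u] mult_right_mono[of K ?K "norm u"] by simp
  qed
  define s where "s = (\<lambda>t. t powr (1 / real ?d) * singular_value t T)"
  have s0: "0 \<le> s t" if "t > 0" for t
    unfolding s_def using singular_value_nonneg[OF bT] that by simp
  have ev: "\<forall>\<^sub>F t in at_top. s t \<le> 2 * real C powr (1 / real ?d) * \<eta>" if \<eta>: "\<eta> > 0" for \<eta>
  proof -
    obtain N0 where N0: "\<And>N. N \<ge> N0 \<Longrightarrow> rank_approx T (C * N ^ ?d) (\<eta> / real N)"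
      using C[OF \<eta>] by (auto simp: eventually_sequentially)
    define t0 where "t0 = real C * (real N0 + 1) ^ ?d"
    have "s t \<le> 2 * real C powr (1 / real ?d) * \<eta>" if t: "t \<ge> t0" for t
    proof -
      have t0: "t0 > 0" using C1 by (simp add: t0_def)
      \<comment> \<open>x solves C x^d = t. Its integer part N gives the largest rank C N^d not
        exceeding t, and the threshold \<open>t0\<close> ensures x \<ge> N0 + 1, hence N \<ge> N0
        and N \<ge> 1.\<close>
      define x where "x = (t / real C) powr (1 / real ?d)"
      have tC: "t / real C > 0" using t t0 C1 by simp
      have "(real N0 + 1) ^ ?d \<le> t / real C" using t C1 by (simp add: t0_def field_simps)
      then have "((real N0 + 1) ^ ?d) powr (1 / real ?d) \<le> x"
        unfolding x_def by (intro powr_mono2) auto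
      also have "((real N0 + 1) ^ ?d) powr (1 / real ?d) = real N0 + 1"
        using d by (simp add: powr_realpow[symmetric] powr_powr)
      finally have x: "real N0 + 1 \<le> x" .
      have xd: "x ^ ?d = t / real C"
      proof -
        have "x ^ ?d = x powr real ?d" using x by (simp add: powr_realpow)
        also have "\<dots> = t / real C" using less_imp_le[OF tC] d C1 by (simp add: x_def powr_powr zero_le_divide_iff)
        finally show ?thesis .
      qed
      define N where "N = nat \<lfloor>x\<rfloor>"
      have N: "real N \<le> x" "x < real N + 1" using x by (auto simp: N_def)
      then have NN0: "N0 \<le> N" "1 \<le> N" using x by linarith+
      have "real (C * N ^ ?d) \<le> real C * x ^ ?d" using N by (simp add: power_mono mult_left_mono)
      also have "\<dots> = t" using C1 xd by simp
      finally have Ct: "real (C * N ^ ?d) \<le> t" .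
      have "singular_value t T \<le> \<eta> / real N"
        by (rule singular_value_le[OF bT N0[OF NN0(1)] Ct]) (use \<eta> in simp)
      \<comment> \<open>Rounding x down to N \<ge> 1 loses at most a factor 2, the source of the 2
        in \<open>ev\<close>.\<close>
      also have "\<dots> \<le> \<eta> / (x / 2)"
      proof (rule divide_left_mono)
        have "1 \<le> real N" using NN0(2) by simp
        then show "x / 2 \<le> real N" using N by linarith
        show "0 < real N * (x / 2)" using NN0(2) x by simp
      qed (use \<eta> in simp)
      finally have "s t \<le> t powr (1 / real ?d) * (\<eta> / (x / 2))"
        unfolding s_def by (intro mult_left_mono) auto
      also have "t powr (1 / real ?d) = x * real C powr (1 / real ?d)"
        using tC C1 by (simp add: x_def powr_mult[symmetric])
      also have "x * real C powr (1 / real ?d) * (\<eta> / (x / 2)) = 2 * real C powr (1 / real ?d) * \<eta>"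
        using x by simp
      finally show ?thesis .
    qed
    then show ?thesis by (auto simp: eventually_at_top_linorder)
  qed
  have lim: "(s \<longlongrightarrow> 0) at_top"
  proof (rule tendstoI)
    fix e :: real assume e: "e > 0"
    define \<eta> where "\<eta> = e / (4 * real C powr (1 / real ?d))"
    have c: "real C powr (1 / real ?d) > 0" using C1 by simp
    have \<eta>: "\<eta> > 0" unfolding \<eta>_def by (intro divide_pos_pos mult_pos_pos e c) simp
    have "2 * real C powr (1 / real ?d) * \<eta> = e / 2" using c unfolding \<eta>_def by (simp add: field_simps)
    with ev[OF \<eta>] have "\<forall>\<^sub>F t in at_top. s t \<le> e / 2" by simp
    with eventually_gt_at_top[of 0] show "\<forall>\<^sub>F t in at_top. dist (s t) 0 < e"
    proof eventually_elim
      case (elim t)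
      then show ?case using s0[of t] e by (simp add: dist_real_def)
    qed
  qed
  have comp: "compact_operator T"
  proof (rule compact_operatorI[OF bT])
    fix e :: real assume e: "e > 0"
    from C[OF e] eventually_ge_at_top[of 1] have "\<forall>\<^sub>F N in sequentially. rank_approx T (C * N ^ ?d) e"
    proof eventually_elim
      case (elim N)
      have "e * 1 \<le> e * real N" using elim(2) e by (intro mult_left_mono) auto
      then have "e / real N \<le> e" using elim(2) by (simp add: divide_le_eq)
      then show ?case by (rule rank_approx_mono[OF elim(1) order_refl])
    qed
    then show "\<exists>n. rank_approx T n e" by (auto simp: eventually_sequentially)
  qed
  \<comment> \<open>Beyond \<open>t0\<close> the convergence bounds \<open>s\<close>; below it the
    approximation of rank 0, that is, the operator norm does.\<close>
  have "bdd_above (s ` {0<..})"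
  proof -
    from order_tendstoD(2)[OF lim zero_less_one] obtain t0 where t0: "\<And>t. t \<ge> t0 \<Longrightarrow> s t < 1"
      by (auto simp: eventually_at_top_linorder)
    have "s t \<le> max 1 (\<bar>t0\<bar> powr (1 / real ?d) * ?K)" if "t > 0" for t
    proof (cases "t \<ge> t0")
      case False
      have "s t \<le> \<bar>t0\<bar> powr (1 / real ?d) * ?K"
        unfolding s_def
        by (intro mult_mono powr_mono2 singular_value_le[OF bT K] singular_value_nonneg[OF bT]) (use False that in auto)
      then show ?thesis by simp
    qed (use t0[of t] in auto)
    then show ?thesis by (intro bdd_aboveI2[where M="max 1 (\<bar>t0\<bar> powr (1 / real ?d) * ?K)"]) auto
  qed
  with comp lim show ?thesis by (simp add: weak_schatten_0_def weak_schatten_def s_def)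
qed

lemma infinitesimal_rank_diff:
  fixes T :: "'a::euclidean_space l2 \<Rightarrow> 'a l2"
  assumes "infinitesimal_rank S" "infinitesimal_rank T"
  shows "infinitesimal_rank (\<lambda>u. S u - T u)"
proof -
  obtain C D :: nat where
    C: "\<And>\<eta>. \<eta> > 0 \<Longrightarrow> \<forall>\<^sub>F N in sequentially. rank_approx S (C * N ^ DIM('a)) (\<eta> / real N)" and
    D: "\<And>\<eta>. \<eta> > 0 \<Longrightarrow> \<forall>\<^sub>F N in sequentially. rank_approx T (D * N ^ DIM('a)) (\<eta> / real N)"
    using assms unfolding infinitesimal_rank_def by blast
  have "\<forall>\<^sub>F N in sequentially. rank_approx (\<lambda>u. S u - T u) ((C + D) * N ^ DIM('a)) (\<eta> / real N)" if "\<eta> > 0" for \<eta>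
  proof -
    have "\<eta> / 2 > 0" using that by simp
    from C[OF this] D[OF this] show ?thesis
    proof eventually_elim
      case (elim N)
      from rank_approx_diff[OF elim] show ?case by (simp add: add_mult_distrib add_divide_distrib[symmetric])
    qed
  qed
  then show ?thesis unfolding infinitesimal_rank_def by blast
qed

lemma infinitesimal_rank_compose:
  fixes T :: "'a::euclidean_space l2 \<Rightarrow> 'a l2"
  assumes "infinitesimal_rank T" and B: "clinear B" "\<And>u. norm (B u) \<le> K * norm u" "0 \<le> K"
  shows "infinitesimal_rank (\<lambda>u. B (T u))"
proof -
  obtain C :: nat where
    C: "\<And>\<eta>. \<eta> > 0 \<Longrightarrow> \<forall>\<^sub>F N in sequentially. rank_approx T (C * N ^ DIM('a)) (\<eta> / real N)"
    using assms unfolding infinitesimal_rank_def by blast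
  have "\<forall>\<^sub>F N in sequentially. rank_approx (\<lambda>u. B (T u)) (C * N ^ DIM('a)) (\<eta> / real N)" if "\<eta> > 0" for \<eta>
  proof -
    have "\<eta> / (K + 1) > 0" using that B(3) by simp
    from C[OF this] show ?thesis
    proof eventually_elim
      case (elim N)
      have "K * (\<eta> / (K + 1)) \<le> \<eta>" using that B(3) by (simp add: field_simps)
      then have "K * (\<eta> / (K + 1) / real N) \<le> \<eta> / real N" using divide_right_mono[of "K * (\<eta> / (K + 1))" \<eta> "real N"] by simp
      with rank_approx_compose[OF elim B] show ?case by (rule rank_approx_mono[OF _ order_refl])
    qed
  qed
  then show ?thesis unfolding infinitesimal_rank_def by blast
qed

section \<open>Hilbert-Schmidt bounds and band-limited functions\<close>

lemma cinner_abs_l2_right: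
  assumes "square_integrable h"
  shows "cinner u (abs_l2 h) = (LINT x|lborel. rep_l2 u x * cnj (h x))"
  using cinner_abs_l2[OF square_integrable_rep_l2 assms, of u] by simp

text \<open>With a square-integrable symbol, h(D) u has a value at each x, a multiple of the inner
  product of the transform of u with \<open>k x\<close>. The norm of \<open>k x\<close> is the same
  for all x, so that Bessel's inequality can be applied uniformly in x.\<close>

lemma fourier_multiplier_integral:
  fixes h :: "'a::euclidean_space \<Rightarrow> complex"
  assumes "ess_bounded C h" "square_integrable h"
  defines "k \<equiv> \<lambda>x s. cnj (cis (s \<bullet> x) * h s)"
  shows "fourier_multiplier h u = abs_l2 (\<lambda>x. of_real (fourier_const TYPE('a)) * cinner (fourier u) (abs_l2 (k x)))"
    and "square_integrable (\<lambda>x. of_real (fourier_const TYPE('a)) * cinner (fourier u) (abs_l2 (k x)))"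
    and "square_integrable (k x)" "norm (abs_l2 (k x)) = norm (abs_l2 h)"
proof -
  show k: "square_integrable (k x)" for x
    unfolding k_def
    by (intro square_integrable_cnj square_integrable_ess_bounded_mult(1)[OF ess_bounded_cis] assms) measurable
  have "(norm (abs_l2 (k x)))\<^sup>2 = (norm (abs_l2 h))\<^sup>2"
    unfolding norm_abs_l2[OF k] norm_abs_l2[OF assms(2)] by (simp add: k_def norm_mult)
  then show "norm (abs_l2 (k x)) = norm (abs_l2 h)" by (simp add: power2_eq_iff_nonneg)
  let ?V = "\<lambda>s. h s * rep_l2 (fourier u) s"
  have V: "square_integrable ?V" "integrable lborel ?V"
    by (rule square_integrable_ess_bounded_mult(1)[OF assms(1) square_integrable_rep_l2])
       (rule square_integrable_mult'[OF assms(2) square_integrable_rep_l2])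
  have eq: "fourier_integral ?V (- x) = of_real (fourier_const TYPE('a)) * cinner (fourier u) (abs_l2 (k x))" for x
    unfolding fourier_integral_alt cinner_abs_l2_right[OF k] by (simp add: k_def mult_ac)
  have "fourier_multiplier h u = inv fourier (abs_l2 ?V)"
    using mult_op_abs[OF assms(1) square_integrable_rep_l2, of "fourier u"] by (simp add: fourier_multiplier_def)
  with inv_fourier_abs_l2[OF V]
  show "fourier_multiplier h u = abs_l2 (\<lambda>x. of_real (fourier_const TYPE('a)) * cinner (fourier u) (abs_l2 (k x)))"
    "square_integrable (\<lambda>x. of_real (fourier_const TYPE('a)) * cinner (fourier u) (abs_l2 (k x)))"
    unfolding eq by simp_all
qed

text \<open>The operator \<open>a(x) h(D)\<close> has the integral kernel \<open>a(x) h(s) e\<^sup>i\<^sup>x\<^sup>s\<close> up to the Fourier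
  transform, hence is Hilbert-Schmidt.\<close>

lemma rank_approx_mult_multiplier:
  fixes a h :: "'a::euclidean_space \<Rightarrow> complex"
  assumes a: "ess_bounded A a" "square_integrable a" and h: "ess_bounded C h" "square_integrable h"
    and \<epsilon>: "0 < \<epsilon>" "(fourier_const TYPE('a) * norm (abs_l2 a) * norm (abs_l2 h))\<^sup>2 \<le> real n * \<epsilon>\<^sup>2"
  shows "rank_approx (\<lambda>u. mult_op a (fourier_multiplier h u)) n \<epsilon>"
proof (rule rank_approx_hilbert_schmidt[OF _ _ \<epsilon>])
  show "clinear (\<lambda>u. mult_op a (fourier_multiplier h u))"
    by (rule clinear_compose[OF clinear_mult_op[OF a(1)] clinear_fourier_multiplier[OF h(1)]])
  fix e :: "nat \<Rightarrow> 'a l2" and m :: nat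
  assume e: "orthonormal e {..<m}"
  define \<kappa> where "\<kappa> = fourier_const TYPE('a)"
  define k where "k = (\<lambda>x s. cnj (cis (s \<bullet> x) * h s))"
  have M: "fourier_multiplier h u = abs_l2 (\<lambda>x. of_real \<kappa> * cinner (fourier u) (abs_l2 (k x)))"
    "square_integrable (\<lambda>x. of_real \<kappa> * cinner (fourier u) (abs_l2 (k x)))"
    "norm (abs_l2 (k x)) = norm (abs_l2 h)" for u x
    unfolding k_def \<kappa>_def using fourier_multiplier_integral[OF h] by blast+
  define g where "g = (\<lambda>i x. of_real \<kappa> * cinner (fourier (e i)) (abs_l2 (k x)))"
  have g: "square_integrable (\<lambda>x. a x * g i x)" for i
    unfolding g_def by (rule square_integrable_ess_bounded_mult(1)[OF a(1) M(2)])
  have "(norm (mult_op a (fourier_multiplier h (e i))))\<^sup>2 = (LINT x|lborel. (cmod (a x * g i x))\<^sup>2)" for i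
    unfolding M(1)[of "e i"] mult_op_abs[OF a(1) M(2)] using norm_abs_l2[OF g[of i]] by (simp add: g_def)
  then have "(\<Sum>i<m. (norm (mult_op a (fourier_multiplier h (e i))))\<^sup>2) = (\<Sum>i<m. LINT x|lborel. (cmod (a x * g i x))\<^sup>2)"
    by simp
  also have "\<dots> = (LINT x|lborel. (\<Sum>i<m. (cmod (a x * g i x))\<^sup>2))"
    by (rule Bochner_Integration.integral_sum[symmetric]) (use g in \<open>simp add: square_integrable_def\<close>)
  \<comment> \<open>Bessel's inequality at fixed x replaces the sum over the orthonormal system by
    the squared norm of \<open>k x\<close>; what remains to be integrated is |a|^2.\<close>
  also have "\<dots> \<le> (LINT x|lborel. (\<kappa> * norm (abs_l2 h))\<^sup>2 * (cmod (a x))\<^sup>2)"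
  proof (rule integral_mono)
    fix x
    have o: "orthonormal (\<lambda>i. fourier (e i)) {..<m}"
      using e by (simp add: orthonormal_def cinner_fourier)
    have "(\<Sum>i<m. (cmod (a x * g i x))\<^sup>2) = (cmod (a x))\<^sup>2 * \<kappa>\<^sup>2 * (\<Sum>i<m. (cmod (cinner (abs_l2 (k x)) (fourier (e i))))\<^sup>2)"
      unfolding sum_distrib_left
    proof (rule sum.cong[OF refl])
      fix i
      have "cmod (cinner (abs_l2 (k x)) (fourier (e i))) = cmod (cinner (fourier (e i)) (abs_l2 (k x)))"
        by (subst cinner_commute) simp
      then show "(cmod (a x * g i x))\<^sup>2 = (cmod (a x))\<^sup>2 * \<kappa>\<^sup>2 * (cmod (cinner (abs_l2 (k x)) (fourier (e i))))\<^sup>2"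
        by (simp add: g_def norm_mult power_mult_distrib)
    qed
    also have "\<dots> \<le> (cmod (a x))\<^sup>2 * \<kappa>\<^sup>2 * (norm (abs_l2 (k x)))\<^sup>2"
      by (intro mult_left_mono bessel[OF _ o]) auto
    finally show "(\<Sum>i<m. (cmod (a x * g i x))\<^sup>2) \<le> (\<kappa> * norm (abs_l2 h))\<^sup>2 * (cmod (a x))\<^sup>2"
      by (simp add: M(3) power_mult_distrib mult_ac)
  qed (use g a in \<open>auto simp: square_integrable_def\<close>)
  also have "\<dots> = (\<kappa> * norm (abs_l2 a) * norm (abs_l2 h))\<^sup>2"
    by (simp add: norm_abs_l2[OF a(2)] power_mult_distrib mult_ac)
  finally show "(\<Sum>i<m. (norm (mult_op a (fourier_multiplier h (e i))))\<^sup>2)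
      \<le> (fourier_const TYPE('a) * norm (abs_l2 a) * norm (abs_l2 h))\<^sup>2" by (simp add: \<kappa>_def)
qed

lemma norm_abs_l2_cnj:
  assumes "square_integrable a"
  shows "norm (abs_l2 (\<lambda>x. cnj (a x))) = norm (abs_l2 a)"
proof -
  have "(norm (abs_l2 (\<lambda>x. cnj (a x))))\<^sup>2 = (norm (abs_l2 a))\<^sup>2"
    by (simp add: norm_abs_l2 assms square_integrable_cnj)
  then show ?thesis by (simp add: power2_eq_iff_nonneg)
qed

lemma cinner_mult_multiplier:
  assumes "ess_bounded A a" "ess_bounded C h"
  shows "cinner (mult_op (\<lambda>x. cnj (a x)) (fourier_multiplier (\<lambda>x. cnj (h x)) u)) v
    = cinner u (fourier_multiplier h (mult_op a v))"
  by (simp add: cinner_mult_op[OF ess_bounded_cnj[OF assms(1)]] cinner_fourier_multiplier[OF ess_bounded_cnj[OF assms(2)]])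

text \<open>The adjoint of the product in the other order, formed with the conjugates of a and
  h.\<close>

lemma rank_approx_multiplier_mult:
  fixes a h :: "'a::euclidean_space \<Rightarrow> complex"
  assumes a: "ess_bounded A a" "square_integrable a" and h: "ess_bounded C h" "square_integrable h"
    and \<epsilon>: "0 < \<epsilon>" "(fourier_const TYPE('a) * norm (abs_l2 a) * norm (abs_l2 h))\<^sup>2 \<le> real n * \<epsilon>\<^sup>2"
  shows "rank_approx (\<lambda>u. fourier_multiplier h (mult_op a u)) n \<epsilon>"
proof (rule rank_approx_adjoint)
  show "rank_approx (\<lambda>u. mult_op (\<lambda>x. cnj (a x)) (fourier_multiplier (\<lambda>x. cnj (h x)) u)) n \<epsilon>"
    by (rule rank_approx_mult_multiplier[OF ess_bounded_cnj[OF a(1)] square_integrable_cnj[OF a(2)]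
          ess_bounded_cnj[OF h(1)] square_integrable_cnj[OF h(2)]])
       (use \<epsilon> in \<open>simp_all add: norm_abs_l2_cnj a h\<close>)
qed (use \<epsilon> in \<open>simp_all add: cinner_mult_multiplier[OF a(1) h(1)]\<close>)

text \<open>A band-limited function is a superposition of characters, and so is multiplication by
  it. Stating this for matrix elements avoids operator-valued integrals; the proof is the
  multiplication formula for \<phi> and \<open>g\<close>.\<close>

lemma cinner_mult_fourier_integral:
  fixes \<phi> :: "'a::euclidean_space \<Rightarrow> complex"
  assumes \<phi>: "integrable lborel \<phi>" and b: "ess_bounded C (fourier_integral \<phi>)"
  shows "integrable lborel (\<lambda>\<xi>. \<phi> \<xi> * cinner (mult_op (\<lambda>x. cis (- (x \<bullet> \<xi>))) w) v)"
    and "cinner (mult_op (fourier_integral \<phi>) w) v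
      = of_real (fourier_const TYPE('a)) * (LINT \<xi>|lborel. \<phi> \<xi> * cinner (mult_op (\<lambda>x. cis (- (x \<bullet> \<xi>))) w) v)"
proof -
  define g where "g = (\<lambda>x. rep_l2 w x * cnj (rep_l2 v x))"
  have g: "integrable lborel g" unfolding g_def by (rule square_integrable_mult[OF square_integrable_rep_l2 square_integrable_rep_l2])
  have [measurable]: "\<phi> \<in> borel_measurable borel" "g \<in> borel_measurable borel"
    using borel_measurable_integrable[OF \<phi>] borel_measurable_integrable[OF g] by simp_all
  have e: "ess_bounded 1 (\<lambda>x. cis (- (x \<bullet> \<xi>)))" for \<xi> :: 'a by (rule ess_bounded_cis) measurable
  have form: "cinner (mult_op m w) v = (LINT x|lborel. m x * g x)" if m: "ess_bounded D m" for m D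
    using cinner_abs_l2[OF square_integrable_ess_bounded_mult(1)[OF m square_integrable_rep_l2] square_integrable_rep_l2, of w v]
      mult_op_abs[OF m square_integrable_rep_l2, of w]
    by (simp add: g_def mult.assoc)
  have E: "of_real (fourier_const TYPE('a)) * cinner (mult_op (\<lambda>x. cis (- (x \<bullet> \<xi>))) w) v = fourier_integral g \<xi>" for \<xi>
    unfolding form[OF e] fourier_integral_alt ..
  obtain B where B: "\<And>s. cmod (fourier_integral g s) \<le> B" using norm_fourier_integral_le by blast
  have B0: "0 \<le> B" using order_trans[OF norm_ge_zero B[of 0]] .
  have "integrable lborel (\<lambda>\<xi>. \<phi> \<xi> * fourier_integral g \<xi>)"
  proof (rule Bochner_Integration.integrable_bound[of _ "\<lambda>\<xi>. cmod (\<phi> \<xi>) * B"])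
    show "integrable lborel (\<lambda>\<xi>. cmod (\<phi> \<xi>) * B)" by (rule integrable_mult_left[OF integrable_norm[OF \<phi>]])
    show "AE \<xi> in lborel. norm (\<phi> \<xi> * fourier_integral g \<xi>) \<le> norm (cmod (\<phi> \<xi>) * B)"
      using B B0 by (auto simp: norm_mult abs_mult intro!: mult_left_mono)
  qed measurable
  then have "integrable lborel (\<lambda>\<xi>. of_real (1 / fourier_const TYPE('a)) * (\<phi> \<xi> * fourier_integral g \<xi>))"
    by (rule integrable_mult_right)
  then show "integrable lborel (\<lambda>\<xi>. \<phi> \<xi> * cinner (mult_op (\<lambda>x. cis (- (x \<bullet> \<xi>))) w) v)"
    unfolding E[symmetric] using fourier_const_pos[where ?'a='a] by simp
  have "cinner (mult_op (fourier_integral \<phi>) w) v = (LINT x|lborel. fourier_integral \<phi> x * g x)"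
    by (rule form[OF b])
  also have "\<dots> = (LINT \<xi>|lborel. \<phi> \<xi> * fourier_integral g \<xi>)" by (rule fourier_integral_mult[OF \<phi> g])
  also have "\<dots> = (LINT \<xi>|lborel. of_real (fourier_const TYPE('a)) * (\<phi> \<xi> * cinner (mult_op (\<lambda>x. cis (- (x \<bullet> \<xi>))) w) v))"
    unfolding E[symmetric] by (simp only: mult.left_commute)
  also have "\<dots> = of_real (fourier_const TYPE('a)) * (LINT \<xi>|lborel. \<phi> \<xi> * cinner (mult_op (\<lambda>x. cis (- (x \<bullet> \<xi>))) w) v)"
    by (rule integral_mult_right_zero)
  finally show "cinner (mult_op (fourier_integral \<phi>) w) v
      = of_real (fourier_const TYPE('a)) * (LINT \<xi>|lborel. \<phi> \<xi> * cinner (mult_op (\<lambda>x. cis (- (x \<bullet> \<xi>))) w) v)" .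
qed

text \<open>On the Fourier side the commutator is the translation by \<xi> followed by
  multiplication with \<open>c (\<xi> + s) - c s\<close>.\<close>

lemma norm_commutator_modulation:
  fixes c :: "'a::euclidean_space \<Rightarrow> complex"
  assumes c: "ess_bounded C c" and L: "\<And>s. cmod (c (\<xi> + s) - c s) \<le> L" "0 \<le> L"
  shows "norm (commutator (mult_op (\<lambda>x. cis (- (x \<bullet> \<xi>)))) (fourier_multiplier c) u) \<le> L * norm u"
proof -
  note [measurable] = ess_bounded_measurable[OF c]
  define W where "W = rep_l2 (fourier u)"
  have W: "square_integrable W" "fourier u = abs_l2 W" by (simp_all add: W_def square_integrable_rep_l2)
  have W': "square_integrable (\<lambda>s. W (\<xi> + 1 *\<^sub>R s))" by (rule square_integrable_affine(1)[OF _ W(1)]) simp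
  have cW: "square_integrable (\<lambda>s. c s * W s)" by (rule square_integrable_ess_bounded_mult(1)[OF c W(1)])
  have cW': "square_integrable (\<lambda>s. c (\<xi> + 1 *\<^sub>R s) * W (\<xi> + 1 *\<^sub>R s))" by (rule square_integrable_affine(1)[OF _ cW]) simp
  have cW'': "square_integrable (\<lambda>s. c s * W (\<xi> + 1 *\<^sub>R s))" by (rule square_integrable_ess_bounded_mult(1)[OF c W'])
  have d: "ess_bounded L (\<lambda>s. c (\<xi> + s) - c s)"
    using L affine_measurable[of c \<xi> 1] by (auto simp: ess_bounded_def)
  have "fourier (commutator (mult_op (\<lambda>x. cis (- (x \<bullet> \<xi>)))) (fourier_multiplier c) u)
      = affine_l2 1 \<xi> (mult_op c (fourier u)) - mult_op c (affine_l2 1 \<xi> (fourier u))"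
    by (simp add: commutator_def clinear_diff[OF clinear_fourier] fourier_multiplier_def fourier_modulation)
  also have "\<dots> = abs_l2 (\<lambda>s. c (\<xi> + 1 *\<^sub>R s) * W (\<xi> + 1 *\<^sub>R s)) - abs_l2 (\<lambda>s. c s * W (\<xi> + 1 *\<^sub>R s))"
    unfolding W(2) mult_op_abs[OF c W(1)] affine_l2_abs[OF one_neq_zero W(1)] affine_l2_abs[OF one_neq_zero cW] mult_op_abs[OF c W'] ..
  also have "\<dots> = abs_l2 (\<lambda>s. (c (\<xi> + s) - c s) * W (\<xi> + 1 *\<^sub>R s))"
    unfolding abs_l2_diff[OF cW' cW''] by (simp add: left_diff_distrib)
  also have "norm \<dots> \<le> L * norm (abs_l2 (\<lambda>s. W (\<xi> + 1 *\<^sub>R s)))"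
    by (rule square_integrable_ess_bounded_mult(2)[OF d W'])
  also have "abs_l2 (\<lambda>s. W (\<xi> + 1 *\<^sub>R s)) = affine_l2 1 \<xi> (fourier u)"
    unfolding W(2) affine_l2_abs[OF one_neq_zero W(1)] ..
  finally show ?thesis by (simp add: norm_fourier norm_affine_l2)
qed

text \<open>The bound for one character, L |\<xi>|, is integrated against |\<phi>|; hence the first
  absolute moment of \<phi>.\<close>

lemma norm_commutator_fourier_integral:
  fixes \<phi> c :: "'a::euclidean_space \<Rightarrow> complex"
  assumes \<phi>: "integrable lborel \<phi>" "integrable lborel (\<lambda>\<xi>. norm \<xi> * cmod (\<phi> \<xi>))"
    and b: "ess_bounded A (fourier_integral \<phi>)" and c: "ess_bounded C c"
    and L: "\<And>\<xi> s. cmod (c (\<xi> + s) - c s) \<le> L * norm \<xi>" "0 \<le> L"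
  shows "norm (commutator (mult_op (fourier_integral \<phi>)) (fourier_multiplier c) u)
    \<le> fourier_const TYPE('a) * (LINT \<xi>|lborel. norm \<xi> * cmod (\<phi> \<xi>)) * L * norm u"
proof (rule norm_le_of_cinner_bound)
  let ?\<kappa> = "fourier_const TYPE('a)" and ?I = "LINT \<xi>|lborel. norm \<xi> * cmod (\<phi> \<xi>)"
  note pos = fourier_const_pos[where ?'a='a]
  show "0 \<le> ?\<kappa> * ?I * L * norm u" using pos L(2) by (intro mult_nonneg_nonneg integral_nonneg_AE) auto
  fix v
  let ?E = "\<lambda>\<xi>. mult_op (\<lambda>x. cis (- (x \<bullet> \<xi>)))"
  let ?D = "fourier_multiplier c" and ?D' = "fourier_multiplier (\<lambda>s. cnj (c s))"
  note A1 = cinner_mult_fourier_integral[OF \<phi>(1) b, of "?D u" v]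
  note A2 = cinner_mult_fourier_integral[OF \<phi>(1) b, of u "?D' v"]
  have "cinner (commutator (mult_op (fourier_integral \<phi>)) ?D u) v
      = cinner (mult_op (fourier_integral \<phi>) (?D u)) v - cinner (mult_op (fourier_integral \<phi>) u) (?D' v)"
    by (simp add: commutator_def cinner_diff cinner_fourier_multiplier[OF c])
  also have "\<dots> = of_real ?\<kappa> * (LINT \<xi>|lborel. \<phi> \<xi> * cinner (?E \<xi> (?D u)) v - \<phi> \<xi> * cinner (?E \<xi> u) (?D' v))"
    unfolding A1(2) A2(2) by (simp add: Bochner_Integration.integral_diff[OF A1(1) A2(1)] right_diff_distrib)
  also have "(\<lambda>\<xi>. \<phi> \<xi> * cinner (?E \<xi> (?D u)) v - \<phi> \<xi> * cinner (?E \<xi> u) (?D' v)) = (\<lambda>\<xi>. \<phi> \<xi> * cinner (commutator (?E \<xi>) ?D u) v)"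
    by (simp add: commutator_def cinner_diff cinner_fourier_multiplier[OF c] right_diff_distrib)
  finally have "cmod (cinner (commutator (mult_op (fourier_integral \<phi>)) ?D u) v)
      = ?\<kappa> * cmod (LINT \<xi>|lborel. \<phi> \<xi> * cinner (commutator (?E \<xi>) ?D u) v)"
    using pos by (simp add: norm_mult)
  also have "\<dots> \<le> ?\<kappa> * (LINT \<xi>|lborel. (norm \<xi> * cmod (\<phi> \<xi>)) * (L * norm u * norm v))"
  proof (rule mult_left_mono)
    have le: "cmod (\<phi> \<xi> * cinner (commutator (?E \<xi>) ?D u) v) \<le> (norm \<xi> * cmod (\<phi> \<xi>)) * (L * norm u * norm v)" for \<xi>
    proof -
      have "norm (commutator (?E \<xi>) ?D u) \<le> L * norm \<xi> * norm u"
        by (rule norm_commutator_modulation[OF c L(1)]) (use L(2) in simp)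
      then have "cmod (cinner (commutator (?E \<xi>) ?D u) v) \<le> L * norm \<xi> * norm u * norm v"
        by (intro order_trans[OF cinner_bound] mult_right_mono) auto
      then have "cmod (\<phi> \<xi>) * cmod (cinner (commutator (?E \<xi>) ?D u) v) \<le> cmod (\<phi> \<xi>) * (L * norm \<xi> * norm u * norm v)"
        by (intro mult_left_mono) auto
      then show ?thesis by (simp add: norm_mult mult_ac)
    qed
    show "cmod (LINT \<xi>|lborel. \<phi> \<xi> * cinner (commutator (?E \<xi>) ?D u) v)
        \<le> (LINT \<xi>|lborel. (norm \<xi> * cmod (\<phi> \<xi>)) * (L * norm u * norm v))"
      by (rule order_trans[OF integral_norm_bound], rule Bochner_Integration.integral_mono'[OF _ le])
         (use \<phi>(2) L(2) in \<open>auto intro: integrable_mult_left\<close>)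
  qed (use pos in simp)
  also have "\<dots> = ?\<kappa> * ?I * L * norm u * norm v" by simp
  finally show "cmod (cinner (commutator (mult_op (fourier_integral \<phi>)) ?D u) v) \<le> ?\<kappa> * ?I * L * norm u * norm v" .
qed

lemma norm_cis_diff_le: "cmod (cis a - cis b) \<le> \<bar>a - b\<bar>"
proof -
  have "cis b * cis (a - b) = cis a" by (simp add: cis_mult)
  then have "cis a - cis b = cis b * (iexp (a - b) - 1)"
    unfolding cis_conv_exp[of "a - b"] by (simp only: right_diff_distrib mult_1_right)
  then show ?thesis using iexp_approx1[of "a - b" 0] by (simp add: norm_mult)
qed

lemma fourier_integral_lipschitz:
  fixes \<psi> :: "'a::euclidean_space \<Rightarrow> complex"
  assumes \<psi>: "integrable lborel \<psi>" "integrable lborel (\<lambda>\<xi>. norm \<xi> * cmod (\<psi> \<xi>))"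
  shows "cmod (fourier_integral \<psi> (\<xi> + s) - fourier_integral \<psi> s)
    \<le> fourier_const TYPE('a) * (LINT \<zeta>|lborel. norm \<zeta> * cmod (\<psi> \<zeta>)) * norm \<xi>"
proof -
  note pos = fourier_const_pos[where ?'a='a]
  have i: "integrable lborel (\<lambda>x. cis (- (x \<bullet> s)) * \<psi> x)" for s by (rule integrable_cis_mult[OF \<psi>(1)]) measurable
  have "fourier_integral \<psi> (\<xi> + s) - fourier_integral \<psi> s
      = of_real (fourier_const TYPE('a)) * (LINT x|lborel. (cis (- (x \<bullet> (\<xi> + s))) - cis (- (x \<bullet> s))) * \<psi> x)"
    unfolding fourier_integral_alt left_diff_distrib by (simp add: Bochner_Integration.integral_diff[OF i i] right_diff_distrib)
  then have "cmod (fourier_integral \<psi> (\<xi> + s) - fourier_integral \<psi> s)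
      = fourier_const TYPE('a) * cmod (LINT x|lborel. (cis (- (x \<bullet> (\<xi> + s))) - cis (- (x \<bullet> s))) * \<psi> x)"
    using pos by (simp add: norm_mult)
  also have "\<dots> \<le> fourier_const TYPE('a) * (LINT x|lborel. (norm x * cmod (\<psi> x)) * norm \<xi>)"
  proof (rule mult_left_mono)
    have le: "cmod ((cis (- (x \<bullet> (\<xi> + s))) - cis (- (x \<bullet> s))) * \<psi> x) \<le> (norm x * cmod (\<psi> x)) * norm \<xi>" for x
    proof -
      have "cmod (cis (- (x \<bullet> (\<xi> + s))) - cis (- (x \<bullet> s))) \<le> \<bar>x \<bullet> \<xi>\<bar>"
        using norm_cis_diff_le[of "- (x \<bullet> (\<xi> + s))" "- (x \<bullet> s)"] by (simp add: inner_add_right)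
      also have "\<dots> \<le> norm x * norm \<xi>" by (rule Cauchy_Schwarz_ineq2)
      finally have "cmod (cis (- (x \<bullet> (\<xi> + s))) - cis (- (x \<bullet> s))) * cmod (\<psi> x) \<le> norm x * norm \<xi> * cmod (\<psi> x)"
        by (rule mult_right_mono) simp
      then show ?thesis by (simp add: norm_mult mult_ac)
    qed
    show "cmod (LINT x|lborel. (cis (- (x \<bullet> (\<xi> + s))) - cis (- (x \<bullet> s))) * \<psi> x) \<le> (LINT x|lborel. (norm x * cmod (\<psi> x)) * norm \<xi>)"
      by (rule order_trans[OF integral_norm_bound], rule Bochner_Integration.integral_mono'[OF _ le])
         (use \<psi>(2) in \<open>auto intro: integrable_mult_left\<close>)
  qed (use pos in simp)
  finally show ?thesis by simp
qed

text \<open>Truncating the transform leaves \<phi> with bounded support, hence with a finite first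
  moment, the quantity that controls the commutator.\<close>

lemma band_limited_approx:
  fixes f :: "'a::euclidean_space \<Rightarrow> complex"
  assumes f: "square_integrable f" and "\<delta> > 0"
  obtains \<phi> A where "integrable lborel \<phi>" "integrable lborel (\<lambda>\<xi>. norm \<xi> * cmod (\<phi> \<xi>))"
    "ess_bounded A (fourier_integral \<phi>)" "square_integrable (fourier_integral \<phi>)"
    "norm (abs_l2 (\<lambda>x. f x - fourier_integral \<phi> x)) < \<delta>"
proof -
  \<comment> \<open>W represents the inverse transform of f, so the Fourier integrals of its
    truncations tend to f by the very definition of \<open>fourier\<close>.\<close>
  define W where "W = rep_l2 (inv fourier (abs_l2 f))"
  have W: "square_integrable W" "fourier (abs_l2 W) = abs_l2 f" by (simp_all add: W_def square_integrable_rep_l2)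
  obtain n where n: "norm (abs_l2 (fourier_integral (truncate n W)) - abs_l2 f) < \<delta>"
    using LIMSEQ_D[OF fourier_tendsto[OF W(1)] \<open>\<delta> > 0\<close>] unfolding W(2) by blast
  define \<phi> where "\<phi> = truncate n W"
  note T = truncate_properties[OF W(1), of n, folded \<phi>_def]
  note [measurable] = square_integrable_measurable[OF T(1)]
  have "integrable lborel (\<lambda>\<xi>. norm \<xi> * cmod (\<phi> \<xi>))"
  proof (rule Bochner_Integration.integrable_bound[of _ "\<lambda>\<xi>. real n * cmod (\<phi> \<xi>)"])
    show "integrable lborel (\<lambda>\<xi>. real n * cmod (\<phi> \<xi>))" by (rule integrable_mult_right[OF integrable_norm[OF T(2)]])
    have "norm \<xi> * cmod (\<phi> \<xi>) \<le> real n * cmod (\<phi> \<xi>)" for \<xi>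
    proof (cases "norm \<xi> \<le> real n")
      case True
      then show ?thesis by (rule mult_right_mono) simp
    next
      case False
      then have "\<phi> \<xi> = 0" by (simp add: \<phi>_def)
      then show ?thesis by simp
    qed
    then show "AE \<xi> in lborel. norm (norm \<xi> * cmod (\<phi> \<xi>)) \<le> norm (real n * cmod (\<phi> \<xi>))"
      by (simp add: abs_mult)
  qed measurable
  moreover have "\<exists>A. ess_bounded A (fourier_integral \<phi>)"
    unfolding ess_bounded_def
    by (rule exI, rule conjI, measurable, rule AE_I2, rule norm_fourier_integral_le)
  moreover have "norm (abs_l2 (\<lambda>x. f x - fourier_integral \<phi> x)) < \<delta>"
    using n by (simp add: abs_l2_diff[OF f T(3), symmetric] norm_minus_commute flip: \<phi>_def)
  ultimately show thesis using that T(2,3) by blast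
qed

text \<open>The origin of the rank N^d: dilating the symbol by N multiplies the squared
  Hilbert-Schmidt norm by N^d, and rank N^d absorbs this factor at a fixed error.\<close>

lemma square_integrable_scaled:
  fixes h :: "'a::euclidean_space \<Rightarrow> complex"
  assumes "square_integrable h" "N > 0"
  shows "square_integrable (\<lambda>s. h (s /\<^sub>R real N))"
    "(norm (abs_l2 (\<lambda>s. h (s /\<^sub>R real N))))\<^sup>2 = real (N ^ DIM('a)) * (norm (abs_l2 h))\<^sup>2"
proof -
  have c: "inverse (real N) \<noteq> 0" using assms(2) by simp
  show "square_integrable (\<lambda>s. h (s /\<^sub>R real N))"
    using square_integrable_affine(1)[OF c assms(1), of 0] by simp
  show "(norm (abs_l2 (\<lambda>s. h (s /\<^sub>R real N))))\<^sup>2 = real (N ^ DIM('a)) * (norm (abs_l2 h))\<^sup>2"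
    using square_integrable_affine(2)[OF c assms(1), of 0] assms(2) by (simp add: field_simps)
qed

lemma ess_bounded_scaled:
  fixes h :: "'a::euclidean_space \<Rightarrow> complex"
  assumes "ess_bounded C h" "N > 0"
  shows "ess_bounded C (\<lambda>s. h (s /\<^sub>R real N))"
  using assms AE_lborel_affine[of "inverse (real N)" "\<lambda>s. cmod (h s) \<le> C" "0::'a"] affine_measurable[of h 0 "inverse (real N)"]
  by (simp add: ess_bounded_def)

text \<open>Both functions are approximated in mean by band-limited ones; the errors are controlled by the
  Hilbert-Schmidt bound and the commutator of the approximants is of order \<open>1 / N\<close>, since
  \<open>e\<^sup>i\<^sup>x\<^sup>\<xi>\<close> and \<open>e\<^sup>i\<^sup>\<zeta>\<^sup>D\<^sup>/\<^sup>N\<close> commute up to a factor that differs from 1 by at most \<open>\<bar>\<xi>\<bar>\<bar>\<zeta>\<bar> / N\<close>.\<close>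

lemma rank_approx_commutator_scaled:
  fixes f q :: "'a::euclidean_space \<Rightarrow> complex"
  assumes f: "ess_bounded A f" "square_integrable f" and q: "ess_bounded B q" "square_integrable q"
    and \<delta>: "\<delta> > 0"
  shows "\<forall>\<^sub>F N in sequentially. rank_approx (commutator (mult_op f) (fourier_multiplier (\<lambda>s. q (s /\<^sub>R real N)))) (4 * N ^ DIM('a)) \<delta>"
proof -
  let ?\<kappa> = "fourier_const TYPE('a)"
  note pos = fourier_const_pos[where ?'a='a]
  \<comment> \<open>One fifth of \<delta> is allotted to each of five errors: \<open>f'\<close> with
    q and \<open>a\<close> with \<open>q'\<close>, each in two orders, and the commutator of
    \<open>a\<close> with \<open>c\<close>. The first four cost rank N^d each.\<close>
  have small: "\<exists>\<eta>>0. \<forall>x. 0 \<le> x \<longrightarrow> x < \<eta> \<longrightarrow> ?\<kappa> * x * K \<le> \<delta> / 5" if "0 \<le> K" for K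
  proof (intro exI conjI allI impI)
    have p: "?\<kappa> * (K + 1) > 0" using pos that by simp
    show "0 < \<delta> / 5 / (?\<kappa> * (K + 1))" by (rule divide_pos_pos[OF _ p]) (use \<delta> in simp)
    fix x assume x: "0 \<le> x" "x < \<delta> / 5 / (?\<kappa> * (K + 1))"
    have "?\<kappa> * x * K \<le> x * (?\<kappa> * (K + 1))" using x pos by (simp add: algebra_simps)
    also have "\<dots> \<le> \<delta> / 5" using x(2) p by (simp add: pos_less_divide_eq)
    finally show "?\<kappa> * x * K \<le> \<delta> / 5" .
  qed
  obtain \<eta>1 where \<eta>1: "\<eta>1 > 0" "\<And>x. 0 \<le> x \<Longrightarrow> x < \<eta>1 \<Longrightarrow> ?\<kappa> * x * norm (abs_l2 q) \<le> \<delta> / 5"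
    using small[of "norm (abs_l2 q)"] by auto
  obtain \<phi> A' where \<phi>: "integrable lborel \<phi>" "integrable lborel (\<lambda>\<xi>. norm \<xi> * cmod (\<phi> \<xi>))"
    "ess_bounded A' (fourier_integral \<phi>)" "square_integrable (fourier_integral \<phi>)"
    "norm (abs_l2 (\<lambda>x. f x - fourier_integral \<phi> x)) < \<eta>1"
    using band_limited_approx[OF f(2) \<eta>1(1)] by metis
  define a where "a = fourier_integral \<phi>"
  note \<phi> = \<phi>[folded a_def]
  \<comment> \<open>The tolerance for q depends on the norm of \<open>a\<close>, so q is
    approximated only after f has been.\<close>
  obtain \<eta>2 where \<eta>2: "\<eta>2 > 0" "\<And>x. 0 \<le> x \<Longrightarrow> x < \<eta>2 \<Longrightarrow> ?\<kappa> * x * norm (abs_l2 a) \<le> \<delta> / 5"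
    using small[of "norm (abs_l2 a)"] by auto
  obtain \<psi> B' where \<psi>: "integrable lborel \<psi>" "integrable lborel (\<lambda>\<xi>. norm \<xi> * cmod (\<psi> \<xi>))"
    "ess_bounded B' (fourier_integral \<psi>)" "square_integrable (fourier_integral \<psi>)"
    "norm (abs_l2 (\<lambda>x. q x - fourier_integral \<psi> x)) < \<eta>2"
    using band_limited_approx[OF q(2) \<eta>2(1)] by metis
  define c where "c = fourier_integral \<psi>"
  note \<psi> = \<psi>[folded c_def]
  define f' where "f' = (\<lambda>x. f x - a x)"
  define q' where "q' = (\<lambda>x. q x - c x)"
  have f': "ess_bounded (A + A') f'" "square_integrable f'"
    unfolding f'_def by (rule ess_bounded_diff[OF f(1) \<phi>(3)], rule square_integrable_diff[OF f(2) \<phi>(4)])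
  have q': "ess_bounded (B + B') q'" "square_integrable q'"
    unfolding q'_def by (rule ess_bounded_diff[OF q(1) \<psi>(3)], rule square_integrable_diff[OF q(2) \<psi>(4)])
  have e1: "?\<kappa> * norm (abs_l2 f') * norm (abs_l2 q) \<le> \<delta> / 5"
    unfolding f'_def by (rule \<eta>1(2)[OF norm_ge_zero \<phi>(5)])
  have e2: "?\<kappa> * norm (abs_l2 a) * norm (abs_l2 q') \<le> \<delta> / 5"
    using \<eta>2(2)[OF norm_ge_zero \<psi>(5)] unfolding q'_def by (simp add: mult_ac)
  define L where "L = ?\<kappa> * (LINT \<zeta>|lborel. norm \<zeta> * cmod (\<psi> \<zeta>))"
  have L: "cmod (c (\<xi> + s) - c s) \<le> L * norm \<xi>" "0 \<le> L" for \<xi> s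
    unfolding c_def L_def using pos by (auto intro!: fourier_integral_lipschitz[OF \<psi>(1,2)] mult_nonneg_nonneg integral_nonneg_AE)
  define I where "I = ?\<kappa> * (LINT \<xi>|lborel. norm \<xi> * cmod (\<phi> \<xi>)) * L"
  have hs: "(?\<kappa> * norm (abs_l2 x) * norm (abs_l2 (\<lambda>s. y (s /\<^sub>R real N))))\<^sup>2 \<le> real (N ^ DIM('a)) * (\<delta> / 5)\<^sup>2"
    if "square_integrable y" "N > 0" "?\<kappa> * norm (abs_l2 x) * norm (abs_l2 y) \<le> \<delta> / 5" for x y :: "'a \<Rightarrow> complex" and N
  proof -
    have "(?\<kappa> * norm (abs_l2 x) * norm (abs_l2 (\<lambda>s. y (s /\<^sub>R real N))))\<^sup>2
        = real (N ^ DIM('a)) * (?\<kappa> * norm (abs_l2 x) * norm (abs_l2 y))\<^sup>2"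
      by (simp add: power_mult_distrib square_integrable_scaled(2)[OF that(1,2)] mult_ac)
    also have "\<dots> \<le> real (N ^ DIM('a)) * (\<delta> / 5)\<^sup>2"
      using that(3) pos by (intro mult_left_mono power_mono) auto
    finally show ?thesis .
  qed
  \<comment> \<open>The dilated symbol c(s/N) has Lipschitz constant L / N, so the last commutator
    is bounded by I / N.\<close>
  obtain N0 :: nat where N0: "5 * I / \<delta> \<le> N0" using real_arch_simple by blast
  have "rank_approx (commutator (mult_op f) (fourier_multiplier (\<lambda>s. q (s /\<^sub>R real N)))) (4 * N ^ DIM('a)) \<delta>"
    if N: "N \<ge> max 1 N0" for N
  proof -
    have N1: "N > 0" using N by simp
    have \<delta>5: "0 < \<delta> / 5" using \<delta> by simp
    let ?q = "\<lambda>s. q (s /\<^sub>R real N)" and ?q' = "\<lambda>s. q' (s /\<^sub>R real N)" and ?c = "\<lambda>s. c (s /\<^sub>R real N)"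
    note qs = ess_bounded_scaled[OF q(1) N1] square_integrable_scaled(1)[OF q(2) N1]
    note q's = ess_bounded_scaled[OF q'(1) N1] square_integrable_scaled(1)[OF q'(2) N1]
    note cs = ess_bounded_scaled[OF \<psi>(3) N1]
    have r1: "rank_approx (\<lambda>u. mult_op f' (fourier_multiplier ?q u)) (N ^ DIM('a)) (\<delta> / 5)"
      by (rule rank_approx_mult_multiplier[OF f' qs \<delta>5 hs[OF q(2) N1 e1]])
    have r2: "rank_approx (\<lambda>u. fourier_multiplier ?q (mult_op f' u)) (N ^ DIM('a)) (\<delta> / 5)"
      by (rule rank_approx_multiplier_mult[OF f' qs \<delta>5 hs[OF q(2) N1 e1]])
    have r3: "rank_approx (\<lambda>u. mult_op a (fourier_multiplier ?q' u)) (N ^ DIM('a)) (\<delta> / 5)"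
      by (rule rank_approx_mult_multiplier[OF \<phi>(3,4) q's \<delta>5 hs[OF q'(2) N1 e2]])
    have r4: "rank_approx (\<lambda>u. fourier_multiplier ?q' (mult_op a u)) (N ^ DIM('a)) (\<delta> / 5)"
      by (rule rank_approx_multiplier_mult[OF \<phi>(3,4) q's \<delta>5 hs[OF q'(2) N1 e2]])
    have r5: "rank_approx (commutator (mult_op a) (fourier_multiplier ?c)) 0 (\<delta> / 5)"
    proof (rule rank_approx_norm)
      fix u
      have Lc: "cmod (?c (\<xi> + s) - ?c s) \<le> (L / real N) * norm \<xi>" for \<xi> s
        using L(1)[of "\<xi> /\<^sub>R real N" "s /\<^sub>R real N"] by (simp add: scaleR_add_right divide_inverse mult_ac)
      have "norm (commutator (mult_op a) (fourier_multiplier ?c) u)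
          \<le> ?\<kappa> * (LINT \<xi>|lborel. norm \<xi> * cmod (\<phi> \<xi>)) * (L / real N) * norm u"
        unfolding a_def
        by (rule norm_commutator_fourier_integral[OF \<phi>(1,2) \<phi>(3)[unfolded a_def] cs Lc]) (use L(2) in simp)
      also have "\<dots> = I / real N * norm u" by (simp add: I_def)
      also have "\<dots> \<le> \<delta> / 5 * norm u"
      proof (rule mult_right_mono)
        have "5 * I / \<delta> \<le> real N" using N0 N by simp
        then show "I / real N \<le> \<delta> / 5" using N1 \<delta> by (simp add: field_simps)
      qed simp
      finally show "norm (commutator (mult_op a) (fourier_multiplier ?c) u) \<le> \<delta> / 5 * norm u" .
    qed
    have fs: "mult_op f w = mult_op f' w + mult_op a w" for w
      using mult_op_add[OF f'(1) \<phi>(3), of w] by (simp add: f'_def)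
    have qss: "fourier_multiplier ?q w = fourier_multiplier ?q' w + fourier_multiplier ?c w" for w
      using fourier_multiplier_add[OF q's(1) cs, of w] by (simp add: q'_def)
    \<comment> \<open>Telescoping: [f, q] = [f', q] + [a, q'] + [a, c], where f = f' + a and q = q'
      + c.\<close>
    have "commutator (mult_op f) (fourier_multiplier ?q) =
      (\<lambda>u. ((mult_op f' (fourier_multiplier ?q u) - fourier_multiplier ?q (mult_op f' u))
        + (mult_op a (fourier_multiplier ?q' u) - fourier_multiplier ?q' (mult_op a u)))
        + commutator (mult_op a) (fourier_multiplier ?c) u)"
    proof
      fix u
      have 1: "fourier_multiplier ?q (mult_op f u) = fourier_multiplier ?q (mult_op f' u) + fourier_multiplier ?q (mult_op a u)"
        unfolding fs by (rule clinear_add[OF clinear_fourier_multiplier[OF qs(1)]])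
      have 2: "fourier_multiplier ?q (mult_op a u) = fourier_multiplier ?q' (mult_op a u) + fourier_multiplier ?c (mult_op a u)"
        by (rule qss)
      have 3: "mult_op f (fourier_multiplier ?q u) = mult_op f' (fourier_multiplier ?q u) + mult_op a (fourier_multiplier ?q u)"
        by (rule fs)
      have 4: "mult_op a (fourier_multiplier ?q u) = mult_op a (fourier_multiplier ?q' u) + mult_op a (fourier_multiplier ?c u)"
        unfolding qss by (rule clinear_add[OF clinear_mult_op[OF \<phi>(3)]])
      show "commutator (mult_op f) (fourier_multiplier ?q) u =
        ((mult_op f' (fourier_multiplier ?q u) - fourier_multiplier ?q (mult_op f' u))
        + (mult_op a (fourier_multiplier ?q' u) - fourier_multiplier ?q' (mult_op a u)))
        + commutator (mult_op a) (fourier_multiplier ?c) u"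
        unfolding commutator_def 1 2 3 4 by simp
    qed
    then show ?thesis
      by (simp only:) (rule rank_approx_mono[OF rank_approx_add[OF rank_approx_add[OF rank_approx_diff[OF r1 r2] rank_approx_diff[OF r3 r4]] r5]], simp_all)
  qed
  then show ?thesis by (rule eventually_sequentiallyI)
qed

section \<open>Low frequencies\<close>

lemma integral_cis_period:
  fixes m :: int
  assumes "N > 0"
  shows "integrable lborel (\<lambda>t. indicator {- (pi * N)..pi * N} t *\<^sub>R cis (t * m / N))"
    and "(LINT t|lborel. indicator {- (pi * N)..pi * N} t *\<^sub>R cis (t * m / N)) = (if m = 0 then of_real (2 * pi * N) else 0)"
proof -
  let ?a = "- (pi * N)" and ?b = "pi * N"
  have ab: "?a \<le> ?b" using assms by simp
  have cont: "continuous_on {?a..?b} (\<lambda>t. cis (t * m / N))" by (intro continuous_intros) (use assms in auto)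
  show "integrable lborel (\<lambda>t. indicator {?a..?b} t *\<^sub>R cis (t * m / N))"
    using borel_integrable_atLeastAtMost'[OF cont] by (simp add: set_integrable_def)
  show "(LINT t|lborel. indicator {?a..?b} t *\<^sub>R cis (t * m / N)) = (if m = 0 then of_real (2 * pi * N) else 0)"
  proof (cases "m = 0")
    case True
    have "(LINT t|lborel. indicator {?a..?b} t *\<^sub>R (1::complex)) = of_real (2 * pi * N)"
      using ab by (subst integral_scaleR_left) (auto simp: scaleR_conv_of_real)
    with True show ?thesis by simp
  next
    case False
    define F where "F = (\<lambda>t::real. cis (t * m / N) * (- \<i> * of_real (N / m)))"
    have "(F has_vector_derivative cis (t * m / N)) (at t within {?a..?b})" for t :: real
    proof -
      have e: "cis (x * m / N) = exp (x *\<^sub>R (\<i> * (m / N)))" for x :: real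
        by (simp add: cis_conv_exp scaleR_conv_of_real mult_ac)
      have "((\<lambda>t. cis (t * m / N) * (- \<i> * of_real (N / m))) has_vector_derivative
          (cis (t * m / N) * (\<i> * (m / N))) * (- \<i> * of_real (N / m))) (at t within {?a..?b})"
        unfolding e by (rule has_vector_derivative_mult_left[OF exp_scaleR_has_vector_derivative_right])
      moreover have "(cis (t * m / N) * (\<i> * (m / N))) * (- \<i> * of_real (N / m)) = cis (t * m / N)"
        using False assms by (simp add: field_simps)
      ultimately show ?thesis unfolding F_def by simp
    qed
    then have "(LINT t|lborel. indicator {?a..?b} t *\<^sub>R cis (t * m / N)) = F ?b - F ?a"
      by (intro integral_FTC_atLeastAtMost ab cont) auto
    also have "cis (?b * m / N) = cis (?a * m / N)"
    proof -
      have "cis (?b * m / N) = cis (2 * pi * m) * cis (?a * m / N)"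
        using assms by (simp add: cis_mult algebra_simps)
      then show ?thesis by (simp add: cis_multiple_2pi)
    qed
    then have "F ?b - F ?a = 0" unfolding F_def by (simp only: diff_self)
    finally show ?thesis using False by simp
  qed
qed

section \<open>Exponentials at lattice points and the cells of the lattice\<close>

definition lattice_point :: "real \<Rightarrow> ('a::euclidean_space \<Rightarrow> int) \<Rightarrow> 'a" where
  "lattice_point N z = (\<Sum>b\<in>Basis. (z b / N) *\<^sub>R b)"

lemma inner_lattice_point: "b \<in> Basis \<Longrightarrow> lattice_point N z \<bullet> b = z b / N"
  by (simp add: lattice_point_def)

text \<open>The characters at the points of the lattice of mesh 1 / N have the common period 2 pi N
  in each coordinate; the factor normalises them on the cube of that side.\<close>

definition lattice_exponential :: "real \<Rightarrow> ('a::euclidean_space \<Rightarrow> int) \<Rightarrow> 'a \<Rightarrow> complex" where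
  "lattice_exponential N z s =
     of_real ((1 / sqrt (2 * pi * N)) ^ DIM('a)) * (\<Prod>b\<in>Basis. indicator {- (pi * N)..pi * N} (s \<bullet> b)) * cis (- (s \<bullet> lattice_point N z))"

lemma lattice_exponential_inner:
  fixes y z :: "'a::euclidean_space \<Rightarrow> int"
  assumes N: "N > 0"
  shows "integrable lborel (\<lambda>s. lattice_exponential N y s * cnj (lattice_exponential N z s))"
    and "(LINT s|lborel. lattice_exponential N y s * cnj (lattice_exponential N z s)) = of_bool (\<forall>b\<in>Basis. y b = z b)"
proof -
  define h where "h = (\<lambda>b t. complex_of_real (1 / (2 * pi * N)) * (indicator {- (pi * N)..pi * N} t *\<^sub>R cis (t * (z b - y b) / N)))"
  have sq: "(1 / sqrt (2 * pi * N)) ^ DIM('a) * (1 / sqrt (2 * pi * N)) ^ DIM('a) = (1 / (2 * pi * N)) ^ DIM('a)"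
    unfolding power_mult_distrib[symmetric] using N by simp
  have eq: "lattice_exponential N y s * cnj (lattice_exponential N z s) = (\<Prod>b\<in>Basis. h b (s \<bullet> b))" for s
  proof -
    have "(\<Prod>b\<in>Basis. h b (s \<bullet> b)) = of_real ((1 / (2 * pi * N)) ^ DIM('a)) *
        (\<Prod>b\<in>Basis. indicator {- (pi * N)..pi * N} (s \<bullet> b)) * (\<Prod>b\<in>Basis. cis ((s \<bullet> b) * (z b - y b) / N))"
      unfolding h_def scaleR_conv_of_real prod.distrib by (simp add: indicator_def of_bool_def if_distrib cong: if_cong)
    also have "(\<Prod>b\<in>Basis. cis ((s \<bullet> b) * (z b - y b) / N)) = cis (- (s \<bullet> lattice_point N y)) * cis (s \<bullet> lattice_point N z)"
      by (simp add: cis_sum[symmetric] cis_mult lattice_point_def inner_sum_right sum_subtractf[symmetric] flip: sum_negf)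
         (simp add: algebra_simps diff_divide_distrib sum_subtractf sum_negf)
    finally have "(\<Prod>b\<in>Basis. h b (s \<bullet> b)) = of_real ((1 / (2 * pi * N)) ^ DIM('a)) *
        (\<Prod>b\<in>Basis. indicator {- (pi * N)..pi * N} (s \<bullet> b)) * (cis (- (s \<bullet> lattice_point N y)) * cis (s \<bullet> lattice_point N z))" .
    moreover have "(\<Prod>b\<in>Basis. indicator {- (pi * N)..pi * N} (s \<bullet> b)) * (\<Prod>b\<in>Basis. indicator {- (pi * N)..pi * N} (s \<bullet> b))
        = (\<Prod>b\<in>Basis. indicator {- (pi * N)..pi * N} (s \<bullet> b) :: complex)"
      unfolding prod.distrib[symmetric] by (intro prod.cong) (auto simp: indicator_def)
    moreover have "cnj (\<Prod>b\<in>Basis. indicator {- (pi * N)..pi * N} (s \<bullet> b)) = (\<Prod>b\<in>Basis. indicator {- (pi * N)..pi * N} (s \<bullet> b) :: complex)"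
      unfolding cnj_prod by (intro prod.cong) (auto simp: indicator_def)
    ultimately show ?thesis
      unfolding lattice_exponential_def sq[symmetric] by (simp add: cis_cnj mult_ac)
  qed
  have hi: "integrable lborel (h b)" "(LINT t|lborel. h b t) = of_bool (y b = z b)" for b
  proof -
    note P = integral_cis_period[OF N, of "z b - y b"]
    show "integrable lborel (h b)" unfolding h_def by (rule integrable_mult_right[OF P(1)])
    show "(LINT t|lborel. h b t) = of_bool (y b = z b)"
      unfolding h_def integral_mult_right_zero P(2) using N by auto
  qed
  show "integrable lborel (\<lambda>s. lattice_exponential N y s * cnj (lattice_exponential N z s))"
    unfolding eq by (rule integrable_prod_Basis(1)[OF hi(1)])
  show "(LINT s|lborel. lattice_exponential N y s * cnj (lattice_exponential N z s)) = of_bool (\<forall>b\<in>Basis. y b = z b)"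
    unfolding eq integrable_prod_Basis(2)[OF hi(1)] hi(2)
    by (auto simp: of_bool_def prod_zero_iff)
qed

lemma lattice_exponential_measurable [measurable]: "lattice_exponential N z \<in> borel_measurable borel"
  unfolding lattice_exponential_def by measurable

text \<open>Only the values of the index on \<open>Basis\<close> enter the exponential; among
  extensional functions, different indices differ there and so give orthogonal exponentials.\<close>

lemma lattice_exponential_orthonormal:
  fixes I :: "('a::euclidean_space \<Rightarrow> int) set" and z :: "'a \<Rightarrow> int"
  assumes N: "N > 0" and I: "I \<subseteq> extensional Basis"
  shows "orthonormal (\<lambda>z. abs_l2 (lattice_exponential N z)) I" "square_integrable (lattice_exponential N z)"
proof -
  have si: "square_integrable (lattice_exponential N z)" for z :: "'a \<Rightarrow> int"
  proof -
    have "integrable lborel (\<lambda>s. complex_of_real ((cmod (lattice_exponential N z s))\<^sup>2))"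
      using lattice_exponential_inner(1)[OF N, of z z] by (simp only: complex_norm_square)
    then show ?thesis unfolding square_integrable_def by (simp only: complex_of_real_integrable_eq) simp
  qed
  show "square_integrable (lattice_exponential N z)" by (rule si)
  show "orthonormal (\<lambda>z. abs_l2 (lattice_exponential N z)) I"
    unfolding orthonormal_def
  proof (intro ballI)
    fix y z assume "y \<in> I" "z \<in> I"
    then have "(\<forall>b\<in>Basis. y b = z b) \<longleftrightarrow> y = z" using I by (auto intro: extensionalityI[of y Basis z])
    then show "cinner (abs_l2 (lattice_exponential N y)) (abs_l2 (lattice_exponential N z)) = of_bool (y = z)"
      by (simp add: cinner_abs_l2 si lattice_exponential_inner(2)[OF N])
  qed
qed

text \<open>Up to normalisation the integrals are the coefficients of V with respect to the lattice
  exponentials. In other words, the inverse transform of V is sampled on the lattice, and Bessel's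
  inequality bounds the squared samples.\<close>

lemma bessel_lattice:
  fixes V :: "'a::euclidean_space \<Rightarrow> complex"
  assumes N: "N > 0" and I: "finite I" "I \<subseteq> extensional Basis" and V: "square_integrable V"
    and supp: "\<And>s. N < norm s \<Longrightarrow> V s = 0"
  shows "(\<Sum>z\<in>I. (cmod (LINT s|lborel. cis (s \<bullet> lattice_point N z) * V s))\<^sup>2) \<le> (2 * pi * N) ^ DIM('a) * (norm (abs_l2 V))\<^sup>2"
proof -
  let ?r = "(1 / sqrt (2 * pi * N)) ^ DIM('a)"
  have r: "?r > 0" using N by simp
  have r2: "?r\<^sup>2 = 1 / (2 * pi * N) ^ DIM('a)"
    using N by (simp add: power2_eq_square power_mult_distrib[symmetric] power_one_over)
  note e = lattice_exponential_orthonormal[OF N I(2)]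
  have eq: "(cmod (LINT s|lborel. cis (s \<bullet> lattice_point N z) * V s))\<^sup>2
      = (2 * pi * N) ^ DIM('a) * (cmod (cinner (abs_l2 V) (abs_l2 (lattice_exponential N z))))\<^sup>2" for z
  proof -
    have "V s * cnj (lattice_exponential N z s) = of_real ?r * (cis (s \<bullet> lattice_point N z) * V s)" for s
    proof (cases "norm s \<le> N")
      case True
      have "(\<Prod>b\<in>Basis. indicator {- (pi * N)..pi * N} (s \<bullet> b)) = (1::complex)"
      proof (rule prod.neutral, rule ballI)
        fix b :: 'a assume "b \<in> Basis"
        then have "\<bar>s \<bullet> b\<bar> \<le> N" using Basis_le_norm[of b s] True by linarith
        \<comment> \<open>The ball of radius N that carries V lies in the cube of half-side pi N, so
          the cut-off of the exponentials is invisible to V.\<close>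
        moreover have "N \<le> pi * N" using N pi_ge_two by (simp add: mult_le_cancel_right1)
        ultimately show "indicator {- (pi * N)..pi * N} (s \<bullet> b) = (1::complex)" by (auto simp: indicator_def)
      qed
      then show ?thesis by (simp add: lattice_exponential_def cis_cnj mult_ac)
    qed (use supp in simp)
    then have "cinner (abs_l2 V) (abs_l2 (lattice_exponential N z)) = of_real ?r * (LINT s|lborel. cis (s \<bullet> lattice_point N z) * V s)"
      unfolding cinner_abs_l2[OF V e(2)] by (simp only: integral_mult_right_zero)
    then have "(cmod (cinner (abs_l2 V) (abs_l2 (lattice_exponential N z))))\<^sup>2
        = ?r\<^sup>2 * (cmod (LINT s|lborel. cis (s \<bullet> lattice_point N z) * V s))\<^sup>2"
      by (simp only: norm_mult power_mult_distrib norm_of_real power2_abs)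
    then show ?thesis unfolding r2 using N by simp
  qed
  have "(\<Sum>z\<in>I. (cmod (LINT s|lborel. cis (s \<bullet> lattice_point N z) * V s))\<^sup>2)
      = (2 * pi * N) ^ DIM('a) * (\<Sum>z\<in>I. (cmod (cinner (abs_l2 V) (abs_l2 (lattice_exponential N z))))\<^sup>2)"
    by (simp add: eq sum_distrib_left)
  also have "\<dots> \<le> (2 * pi * N) ^ DIM('a) * (norm (abs_l2 V))\<^sup>2"
    by (rule mult_left_mono[OF bessel[OF I(1) e(1)]]) (use N in simp)
  finally show ?thesis .
qed

text \<open>The floor yields half-open cells, so each point lies in exactly one cell once the
  indices are taken extensional.\<close>

definition lattice_cell :: "real \<Rightarrow> ('a::euclidean_space \<Rightarrow> int) \<Rightarrow> 'a set" where
  "lattice_cell N z = {x. \<forall>b\<in>Basis. \<lfloor>N * (x \<bullet> b)\<rfloor> = z b}"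

lemma lattice_cell_measurable [measurable]: "lattice_cell N z \<in> sets borel"
  unfolding lattice_cell_def by measurable

lemma lattice_cell_shift:
  "N > 0 \<Longrightarrow> lattice_point N z + y \<in> lattice_cell N z \<longleftrightarrow> y \<in> lattice_cell N (\<lambda>_. 0)"
  by (auto simp: lattice_cell_def inner_add_left inner_lattice_point distrib_left)

lemma lattice_cell_bounds:
  fixes y :: "'a::euclidean_space"
  assumes "N > 0" "y \<in> lattice_cell N (\<lambda>_. 0)" "b \<in> Basis"
  shows "0 \<le> y \<bullet> b" "y \<bullet> b \<le> 1 / N"
proof -
  have "\<lfloor>N * (y \<bullet> b)\<rfloor> = 0" using assms by (simp add: lattice_cell_def)
  then have "0 \<le> N * (y \<bullet> b)" "N * (y \<bullet> b) < 1" by linarith+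
  then show "0 \<le> y \<bullet> b" "y \<bullet> b \<le> 1 / N" using assms(1) by (auto simp: zero_le_mult_iff field_simps)
qed

lemma lattice_cell_norm:
  fixes y :: "'a::euclidean_space"
  assumes "N > 0" "y \<in> lattice_cell N (\<lambda>_. 0)"
  shows "(norm y)\<^sup>2 \<le> DIM('a) / N\<^sup>2"
proof -
  have "(norm y)\<^sup>2 = (\<Sum>b\<in>Basis. (y \<bullet> b)\<^sup>2)"
    by (subst power2_norm_eq_inner, subst euclidean_inner) (simp add: power2_eq_square)
  also have "\<dots> \<le> (\<Sum>b\<in>(Basis::'a set). (1 / N)\<^sup>2)"
    by (intro sum_mono power_mono lattice_cell_bounds[OF assms])
  finally show ?thesis by (simp add: power_divide)
qed

lemma lattice_cell_emeasure:
  assumes "N > 0"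
  shows "emeasure lborel (lattice_cell N (\<lambda>_::'a::euclidean_space. 0)) \<le> ennreal ((1 / N) ^ DIM('a))"
proof -
  let ?c = "(\<Sum>b\<in>Basis. (1 / N) *\<^sub>R b) :: 'a"
  have c: "?c \<bullet> b = 1 / N" if "b \<in> Basis" for b using that by simp
  have "lattice_cell N (\<lambda>_::'a. 0) \<subseteq> cbox 0 ?c"
    using lattice_cell_bounds[OF assms] c by (auto simp: mem_box)
  then have "emeasure lborel (lattice_cell N (\<lambda>_::'a. 0)) \<le> emeasure lborel (cbox 0 ?c)"
    by (rule emeasure_mono) simp
  also have "\<dots> = ennreal (\<Prod>b\<in>Basis. (?c - 0) \<bullet> b)"
    by (rule emeasure_lborel_cbox) (use c assms in simp)
  also have "(\<Prod>b\<in>Basis. (?c - 0) \<bullet> b) = (1 / N) ^ DIM('a)" using c by simp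
  finally show ?thesis .
qed

lemma nn_integral_lborel_shift:
  fixes f :: "'a::euclidean_space \<Rightarrow> ennreal"
  assumes [measurable]: "f \<in> borel_measurable borel"
  shows "(\<integral>\<^sup>+x. f x \<partial>lborel) = (\<integral>\<^sup>+x. f (t + x) \<partial>lborel)"
  by (subst lborel_distr_plus[of t, symmetric]) (simp add: nn_integral_distr)

lemma norm_cis_taylor: "cmod (cis \<theta> - 1 - \<i> * of_real \<theta>) \<le> \<theta>\<^sup>2 / 2"
  using iexp_approx1[of \<theta> 1] by (simp add: cis_conv_exp algebra_simps power2_eq_square)

lemma abs_l2_sum:
  assumes "finite J" "\<And>i. i \<in> J \<Longrightarrow> square_integrable (U i)"
  shows "(\<Sum>i\<in>J. scaleC (c i) (abs_l2 (U i))) = abs_l2 (\<lambda>x. \<Sum>i\<in>J. c i * U i x)" "square_integrable (\<lambda>x. \<Sum>i\<in>J. c i * U i x)"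
proof -
  have "(\<Sum>i\<in>J. scaleC (c i) (abs_l2 (U i))) = abs_l2 (\<lambda>x. \<Sum>i\<in>J. c i * U i x) \<and> square_integrable (\<lambda>x. \<Sum>i\<in>J. c i * U i x)"
    using assms
  proof (induction J rule: finite_induct)
    case empty
    then show ?case by (simp add: abs_l2_zero square_integrable_zero)
  next
    case (insert i J)
    then show ?case by (simp add: abs_l2_scaleC abs_l2_add square_integrable_scale square_integrable_add)
  qed
  then show "(\<Sum>i\<in>J. scaleC (c i) (abs_l2 (U i))) = abs_l2 (\<lambda>x. \<Sum>i\<in>J. c i * U i x)" "square_integrable (\<lambda>x. \<Sum>i\<in>J. c i * U i x)"
    by auto
qed

lemma inner_Basis_sum: "s \<bullet> y = (\<Sum>b\<in>Basis. (y \<bullet> b) * (s \<bullet> b))" for s y :: "'a::euclidean_space"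
  by (subst euclidean_inner) (simp add: mult.commute)

text \<open>On low frequencies the image is replaced by its first-order Taylor polynomial at the corner of each
  cell of the lattice with mesh \<open>1 / N\<close>. Second-order accuracy is essential: it gains the factor
  \<open>\<kappa>\<close> in the error while the rank is bounded independently of \<open>\<kappa>\<close>.\<close>

lemma rank_approx_low_frequency:
  fixes f w :: "'a::euclidean_space \<Rightarrow> complex" and N R :: nat
  assumes N: "N > 0"
    and f: "ess_bounded A f" "square_integrable f" "\<And>x. real R < norm x \<Longrightarrow> f x = 0"
    and w: "ess_bounded C w" "square_integrable w" "\<And>s. cmod (w s) * norm s \<le> B"
      "\<And>s. \<kappa> * real N < norm s \<Longrightarrow> w s = 0"
    and \<kappa>: "0 \<le> \<kappa>" "\<kappa> \<le> 1"
  shows "rank_approx (\<lambda>u. mult_op f (fourier_multiplier w u))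
    (((2 * R + 1) ^ DIM('a) * (DIM('a) + 1)) * N ^ DIM('a)) (A * (B * \<kappa> * DIM('a) / 2) / N)"
proof -
  define d where "d = DIM('a)"
  define c where "c = fourier_const TYPE('a)"
  have c: "c > 0" unfolding c_def by (rule fourier_const_pos)
  define p where "p = (lattice_point (real N) :: ('a \<Rightarrow> int) \<Rightarrow> 'a)"
  define cell where "cell = (lattice_cell (real N) :: ('a \<Rightarrow> int) \<Rightarrow> 'a set)"
  define Q where "Q = cell (\<lambda>_. 0)"
  \<comment> \<open>These indices cover all cells that meet the ball of radius R, outside which f
    vanishes.\<close>
  define I where "I = PiE (Basis::'a set) (\<lambda>_. {- int (R * N)..int (R * N)})"
  \<comment> \<open>The label 0, not a basis vector, stands for the constant Taylor term and the
    basis vectors for the linear ones: d + 1 terms per cell.\<close>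
  define J where "J = I \<times> insert 0 (Basis::'a set)"
  have Nr: "real N > 0" using N by simp
  have A0: "0 \<le> A" by (rule ess_bounded_nonneg[OF f(1)])
  have B0: "0 \<le> B" using w(3)[of 0] by simp
  have [measurable]: "cell z \<in> sets borel" for z unfolding cell_def by measurable
  have [measurable]: "f \<in> borel_measurable borel" "w \<in> borel_measurable borel"
    using f(2) w(2) by (auto dest: square_integrable_measurable)
  have finI: "finite I" unfolding I_def by (intro finite_PiE) auto
  have extI: "I \<subseteq> extensional Basis" unfolding I_def by (auto simp: PiE_def)
  have finJ: "finite J" unfolding J_def using finI by simp
  have cardJ: "card J \<le> ((2 * R + 1) ^ d * (d + 1)) * N ^ d"
  proof -
    have "card I = (2 * (R * N) + 1) ^ d"
    proof -
      have "card {- int m..int m} = 2 * m + 1" for m :: nat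
        unfolding card_atLeastAtMost_int by linarith
      then show ?thesis unfolding I_def d_def by (subst card_PiE) (simp_all del: of_nat_mult)
    qed
    also have "\<dots> \<le> ((2 * R + 1) * N) ^ d" using N by (intro power_mono) (auto simp: algebra_simps)
    finally have "card I * (d + 1) \<le> ((2 * R + 1) * N) ^ d * (d + 1)" by (rule mult_right_mono) simp
    moreover have "card J = card I * (d + 1)" unfolding J_def d_def by (simp add: card_cartesian_product)
    ultimately show ?thesis by (simp only: power_mult_distrib mult_ac)
  qed
  have cellQ: "x \<in> cell z \<longleftrightarrow> x - p z \<in> Q" for x z
    using lattice_cell_shift[OF Nr, of z "x - p z"] by (simp add: cell_def Q_def p_def)
  have Qb: "0 \<le> y \<bullet> b" "y \<bullet> b \<le> 1 / real N" if "y \<in> Q" "b \<in> Basis" for y b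
    using lattice_cell_bounds[OF Nr] that unfolding Q_def cell_def by auto
  \<comment> \<open>The Taylor coefficients as functions of the frequency. The cut-off at N makes
    them bounded and costs nothing, since w vanishes beyond \<kappa> N \<le> N.\<close>
  define \<mu> where "\<mu> = (\<lambda>b s::'a. indicator (cball 0 (real N)) s * (if b = 0 then 1 else \<i> * of_real (s \<bullet> b)))"
  define k where "k = (\<lambda>z b s. cnj (cis (s \<bullet> p z) * (\<mu> b s * w s)))"
  define v where "v = (\<lambda>i. inv fourier (abs_l2 (k (fst i) (snd i))))"
  define t where "t = (\<lambda>z b x. indicator (cell z) x * (of_real c * (if b = 0 then 1 else of_real ((x - p z) \<bullet> b))) :: complex)"
  define W where "W = (\<lambda>i x. t (fst i) (snd i) x * f x)"
  have ind [measurable]: "(\<lambda>x. indicator (cell z) x :: complex) \<in> borel_measurable borel"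
    "(\<lambda>x. indicator (cball 0 (real N)) x :: complex) \<in> borel_measurable (borel :: 'a measure)" for z
    by (auto intro!: borel_measurable_indicator)
  have \<mu>b: "ess_bounded (real N) (\<mu> b)" if "b \<in> insert 0 Basis" for b
  proof -
    have "cmod (\<mu> b s) \<le> real N" for s
    proof (cases "norm s \<le> real N")
      case True
      have "cmod (if b = 0 then 1 else \<i> * of_real (s \<bullet> b)) \<le> real N"
        using that N True Basis_le_norm[of b s] by (auto simp: norm_mult)
      then show ?thesis using True by (simp add: \<mu>_def)
    qed (use Nr in \<open>simp add: \<mu>_def\<close>)
    moreover have "\<mu> b \<in> borel_measurable borel" unfolding \<mu>_def by measurable
    ultimately show ?thesis by (simp add: ess_bounded_def)
  qed
  have tb: "ess_bounded c (t z b)" if "b \<in> insert 0 Basis" for z b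
  proof -
    have "cmod (t z b x) \<le> c" for x
    proof (cases "x \<in> cell z")
      case True
      then have "x - p z \<in> Q" by (simp add: cellQ)
      then have "\<bar>(x - p z) \<bullet> b\<bar> \<le> 1" if "b \<in> Basis"
        using Qb[of "x - p z" b] that N order_trans[of _ "1 / real N" 1] by auto
      then have "cmod (if b = 0 then 1 else complex_of_real ((x - p z) \<bullet> b)) \<le> 1"
        using that by auto
      then have "c * cmod (if b = 0 then 1 else complex_of_real ((x - p z) \<bullet> b)) \<le> c * 1"
        by (rule mult_left_mono) (use c in simp)
      then show ?thesis using True c by (simp add: t_def norm_mult)
    qed (use c in \<open>simp add: t_def\<close>)
    moreover have "t z b \<in> borel_measurable borel" unfolding t_def by measurable
    ultimately show ?thesis by (simp add: ess_bounded_def)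
  qed
  have ki: "square_integrable (k z b)" if "b \<in> insert 0 Basis" for z b
    unfolding k_def
    by (intro square_integrable_cnj square_integrable_ess_bounded_mult(1)[OF ess_bounded_cis]
        square_integrable_ess_bounded_mult(1)[OF \<mu>b[OF that] w(2)]) measurable
  have Wi: "square_integrable (W i)" if "i \<in> J" for i
    unfolding W_def by (rule square_integrable_ess_bounded_mult(1)[OF tb f(2)]) (use that in \<open>auto simp: J_def\<close>)
  \<comment> \<open>The Taylor remainder is at most |s|^2 |y|^2 / 2, with |y|^2 \<le> d / N^2. One
    factor |s| is paid by |w| |s| \<le> B, the other by |s| \<le> \<kappa> N.\<close>
  define \<beta> where "\<beta> = B * \<kappa> * real d / 2 / real N"
  have \<beta>0: "0 \<le> \<beta>" unfolding \<beta>_def using B0 \<kappa> by simp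
  have "norm (mult_op f (fourier_multiplier w u) - (\<Sum>i\<in>J. scaleC (cinner u (v i)) (abs_l2 (W i)))) \<le> A * \<beta> * norm u" for u
  proof -
    define \<omega> where "\<omega> = rep_l2 (fourier u)"
    have \<omega>: "square_integrable \<omega>" "abs_l2 \<omega> = fourier u" by (simp_all add: \<omega>_def square_integrable_rep_l2)
    define V where "V = (\<lambda>s. w s * \<omega> s)"
    have V: "square_integrable V" "integrable lborel V"
      unfolding V_def
      by (rule square_integrable_ess_bounded_mult(1)[OF w(1) \<omega>(1)])
         (rule square_integrable_mult'[OF w(2) \<omega>(1)])
    have [measurable]: "V \<in> borel_measurable borel" using V(1) by (rule square_integrable_measurable)
    have V0: "V s = 0" if "real N < norm s" for s
    proof -
      have "\<kappa> * real N \<le> 1 * real N" using \<kappa> by (intro mult_right_mono) auto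
      then show ?thesis using w(4)[of s] that by (simp add: V_def)
    qed
    define r where "r = (\<lambda>y s::'a. cis (s \<bullet> y) - 1 - \<i> * of_real (s \<bullet> y))"
    define H where "H = (\<lambda>z y. LINT s|lborel. cis (s \<bullet> p z) * (r y s * V s))"
    have [measurable]: "H z \<in> borel_measurable borel" for z unfolding H_def r_def by measurable
    define a where "a = (\<lambda>z b. LINT s|lborel. cis (s \<bullet> p z) * (\<mu> b s * V s))"
    have a: "cinner u (v (z, b)) = a z b" if "b \<in> insert 0 Basis" for z b
    proof -
      have "cinner u (v (z, b)) = cnj (cinner (abs_l2 (k z b)) (fourier u))"
        by (subst cinner_commute) (simp add: v_def cinner_inv_fourier)
      also have "\<dots> = cinner (fourier u) (abs_l2 (k z b))" by (rule cinner_commute[symmetric])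
      also have "\<dots> = (LINT s|lborel. \<omega> s * cnj (k z b s))"
        unfolding \<omega>_def by (rule cinner_abs_l2_right[OF ki[OF that]])
      also have "\<dots> = a z b" by (simp add: a_def k_def V_def mult_ac)
      finally show ?thesis .
    qed
    define F where "F = (\<lambda>x. LINT s|lborel. cis (s \<bullet> x) * V s)"
    have FV: "fourier_integral V (- x) = of_real c * F x" for x
      by (simp add: fourier_integral_alt F_def c_def)
    have taylor: "F x = a z 0 + (\<Sum>b\<in>Basis. of_real ((x - p z) \<bullet> b) * a z b) + H z (x - p z)" for x z
    proof -
      define y where "y = x - p z"
      have \<mu>V: "integrable lborel (\<lambda>s. cis (s \<bullet> p z) * (\<mu> b s * V s))" if "b \<in> insert 0 Basis" for b
      proof (rule integrable_cis_mult)
        have "integrable lborel (\<lambda>s. (\<mu> b s * w s) * \<omega> s)"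
          by (rule square_integrable_mult'[OF square_integrable_ess_bounded_mult(1)[OF \<mu>b[OF that] w(2)] \<omega>(1)])
        then show "integrable lborel (\<lambda>s. \<mu> b s * V s)" by (simp add: V_def mult.assoc)
      qed measurable
      have cV: "integrable lborel (\<lambda>s. cis (s \<bullet> x) * V s)" by (rule integrable_cis_mult[OF V(2)]) measurable
      have sumi: "integrable lborel (\<lambda>s. \<Sum>b\<in>Basis. of_real (y \<bullet> b) * (cis (s \<bullet> p z) * (\<mu> b s * V s)))"
        by (rule Bochner_Integration.integrable_sum, rule integrable_mult_right, rule \<mu>V) simp
      have eq: "cis (s \<bullet> p z) * (r y s * V s) =
          cis (s \<bullet> x) * V s - cis (s \<bullet> p z) * (\<mu> 0 s * V s) - (\<Sum>b\<in>Basis. of_real (y \<bullet> b) * (cis (s \<bullet> p z) * (\<mu> b s * V s)))" for s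
      proof (cases "norm s \<le> real N")
        case True
        have m: "\<mu> b s = \<i> * of_real (s \<bullet> b)" if "b \<in> Basis" for b
          using True that by (auto simp: \<mu>_def)
        have "(\<Sum>b\<in>Basis. of_real (y \<bullet> b) * (cis (s \<bullet> p z) * (\<mu> b s * V s)))
            = (\<Sum>b\<in>Basis. of_real ((y \<bullet> b) * (s \<bullet> b)) * (\<i> * cis (s \<bullet> p z) * V s))"
          by (intro sum.cong refl) (simp add: m)
        also have "\<dots> = of_real (s \<bullet> y) * (\<i> * cis (s \<bullet> p z) * V s)"
          by (simp only: sum_distrib_right[symmetric] of_real_sum[symmetric] inner_Basis_sum[of s y])
        finally have "(\<Sum>b\<in>Basis. of_real (y \<bullet> b) * (cis (s \<bullet> p z) * (\<mu> b s * V s))) = of_real (s \<bullet> y) * (\<i> * cis (s \<bullet> p z) * V s)" .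
        moreover have "cis (s \<bullet> x) = cis (s \<bullet> p z) * cis (s \<bullet> y)" by (simp add: y_def cis_mult inner_diff_right)
        moreover have "\<mu> 0 s = 1" using True by (simp add: \<mu>_def)
        ultimately show ?thesis by (simp add: r_def algebra_simps)
      qed (simp add: V0)
      have "H z y = F x - a z 0 - (LINT s|lborel. (\<Sum>b\<in>Basis. of_real (y \<bullet> b) * (cis (s \<bullet> p z) * (\<mu> b s * V s))))"
        unfolding H_def eq F_def a_def
        by (simp only: Bochner_Integration.integral_diff[OF Bochner_Integration.integrable_diff[OF cV \<mu>V[OF insertI1]] sumi]
            Bochner_Integration.integral_diff[OF cV \<mu>V[OF insertI1]])
      also have "(LINT s|lborel. (\<Sum>b\<in>Basis. of_real (y \<bullet> b) * (cis (s \<bullet> p z) * (\<mu> b s * V s)))) = (\<Sum>b\<in>Basis. of_real (y \<bullet> b) * a z b)"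
        unfolding a_def
        by (subst Bochner_Integration.integral_sum) (auto intro!: integrable_mult_right \<mu>V simp del: integrable_mult_right_iff)
      finally show ?thesis by (simp add: y_def)
    qed
    \<comment> \<open>For fixed y the numbers \<open>H z y\<close> are, up to a constant, the
      samples at the corners \<open>p z\<close> of one function, the inverse transform of
      \<open>r y s * V s\<close>; so a single application of Bessel's inequality controls all
      cells.\<close>
    have bound: "(\<Sum>z\<in>I. (cmod (H z y))\<^sup>2) \<le> (2 * pi * real N) ^ d * (\<beta> * norm u)\<^sup>2" if y: "y \<in> Q" for y
    proof -
      have y2: "(norm y)\<^sup>2 \<le> real d / (real N)\<^sup>2"
        using lattice_cell_norm[OF Nr] y unfolding Q_def cell_def d_def by auto
      have "cmod (r y s * w s) \<le> \<beta>" for s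
      proof (cases "norm s \<le> \<kappa> * real N")
        case True
        have "cmod (r y s) \<le> (s \<bullet> y)\<^sup>2 / 2" unfolding r_def by (rule norm_cis_taylor)
        also have "\<dots> \<le> (norm s)\<^sup>2 * (norm y)\<^sup>2 / 2"
          using power_mono[OF Cauchy_Schwarz_ineq2[of s y], of 2] by (simp add: power_mult_distrib)
        also have "\<dots> \<le> (norm s)\<^sup>2 * (real d / (real N)\<^sup>2) / 2"
          using y2 by (intro divide_right_mono mult_left_mono) auto
        finally have "cmod (r y s * w s) \<le> (norm s)\<^sup>2 * (real d / (real N)\<^sup>2) / 2 * cmod (w s)"
          unfolding norm_mult by (rule mult_right_mono) simp
        also have "\<dots> = (cmod (w s) * norm s) * (norm s * (real d / (real N)\<^sup>2) / 2)"
          by (simp add: power2_eq_square mult_ac)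
        also have "\<dots> \<le> B * (\<kappa> * real N * (real d / (real N)\<^sup>2) / 2)"
          using w(3)[of s] True B0 by (intro mult_mono divide_right_mono mult_right_mono) auto
        also have "\<dots> = \<beta>" using Nr by (simp add: \<beta>_def power2_eq_square)
        finally show ?thesis .
      qed (use w(4) \<beta>0 in auto)
      then have rw: "ess_bounded \<beta> (\<lambda>s. r y s * w s)"
        unfolding ess_bounded_def r_def by auto
      note G = square_integrable_ess_bounded_mult[OF rw \<omega>(1)]
      have Geq: "(\<lambda>s. r y s * w s * \<omega> s) = (\<lambda>s. r y s * V s)" by (simp add: V_def mult.assoc)
      have "(\<Sum>z\<in>I. (cmod (H z y))\<^sup>2) \<le> (2 * pi * real N) ^ d * (norm (abs_l2 (\<lambda>s. r y s * V s)))\<^sup>2"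
        unfolding H_def p_def d_def
        by (rule bessel_lattice[OF Nr finI extI G(1)[unfolded Geq]]) (simp add: V0)
      also have "\<dots> \<le> (2 * pi * real N) ^ d * (\<beta> * norm u)\<^sup>2"
        using G(2)[unfolded Geq \<omega>(2) norm_fourier] Nr by (intro mult_left_mono power_mono) auto
      finally show ?thesis .
    qed
    define E where "E = (\<lambda>x. f x * fourier_integral V (- x) - (\<Sum>i\<in>J. cinner u (v i) * W i x))"
    have FVi: "square_integrable (\<lambda>x. f x * fourier_integral V (- x))"
      by (rule square_integrable_ess_bounded_mult(1)[OF f(1) inv_fourier_abs_l2(1)[OF V]])
    note S = abs_l2_sum[OF finJ Wi, where c="\<lambda>i. cinner u (v i)"]
    have Ei: "square_integrable E" unfolding E_def by (rule square_integrable_diff[OF FVi S(2)])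
    have [measurable]: "E \<in> borel_measurable borel" using Ei by (rule square_integrable_measurable)
    have "fourier_multiplier w u = abs_l2 (\<lambda>x. fourier_integral V (- x))"
      using mult_op_abs[OF w(1) \<omega>(1)] inv_fourier_abs_l2(2)[OF V] by (simp add: fourier_multiplier_def \<omega>(2) V_def)
    then have Eabs: "mult_op f (fourier_multiplier w u) - (\<Sum>i\<in>J. scaleC (cinner u (v i)) (abs_l2 (W i))) = abs_l2 E"
      by (simp add: mult_op_abs[OF f(1) inv_fourier_abs_l2(1)[OF V]] S(1) abs_l2_diff[OF FVi S(2)] E_def)
    \<comment> \<open>The cells are disjoint, so at most one summand is nonzero at each x; the bound
      is written as a sum in order to be integrated term by term.\<close>
    have Ept: "(cmod (E x))\<^sup>2 \<le> (cmod (f x))\<^sup>2 * (c\<^sup>2 * (\<Sum>z\<in>I. indicator (cell z) x * (cmod (H z (x - p z)))\<^sup>2))" for x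
    proof (cases "norm x \<le> real R")
      case False
      then show ?thesis using f(3)[of x] by (simp add: E_def W_def)
    next
      case True
      define z0 where "z0 = restrict (\<lambda>b. \<lfloor>real N * (x \<bullet> b)\<rfloor>) Basis"
      have z0I: "z0 \<in> I"
      proof -
        have "\<lfloor>real N * (x \<bullet> b)\<rfloor> \<in> {- int (R * N)..int (R * N)}" if "b \<in> Basis" for b
        proof -
          have "\<bar>x \<bullet> b\<bar> \<le> real R" using Basis_le_norm[OF that, of x] True by linarith
          then have "real N * \<bar>x \<bullet> b\<bar> \<le> real N * real R" by (rule mult_left_mono) simp
          then have "\<bar>real N * (x \<bullet> b)\<bar> \<le> real (R * N)" by (simp add: abs_mult mult.commute)
          then show ?thesis by (auto simp: le_floor_iff floor_le_iff)
        qed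
        then show ?thesis by (auto simp: z0_def I_def)
      qed
      have cell0: "x \<in> cell z0" by (simp add: cell_def lattice_cell_def z0_def)
      have other: "x \<notin> cell z" if "z \<in> I" "z \<noteq> z0" for z
      proof
        assume "x \<in> cell z"
        then have "z b = z0 b" if "b \<in> Basis" for b using that by (simp add: cell_def lattice_cell_def z0_def)
        then have "z = z0" using \<open>z \<in> I\<close> z0I extI by (intro extensionalityI[of z Basis z0]) auto
        with that show False by simp
      qed
      have "(\<Sum>i\<in>J. cinner u (v i) * W i x) = (\<Sum>z\<in>I. \<Sum>b\<in>insert 0 Basis. a z b * (t z b x * f x))"
        unfolding J_def sum.cartesian_product by (intro sum.cong) (auto simp: W_def a)
      also have "\<dots> = (\<Sum>z\<in>{z0}. \<Sum>b\<in>insert 0 Basis. a z b * (t z b x * f x))"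
        by (rule sum.mono_neutral_right) (use finI z0I other in \<open>auto simp: t_def\<close>)
      also have "\<dots> = f x * of_real c * (a z0 0 + (\<Sum>b\<in>Basis. of_real ((x - p z0) \<bullet> b) * a z0 b))"
      proof -
        have "(\<Sum>b\<in>Basis. a z0 b * (t z0 b x * f x)) = (\<Sum>b\<in>Basis. f x * of_real c * (of_real ((x - p z0) \<bullet> b) * a z0 b))"
          by (intro sum.cong refl) (use cell0 in \<open>auto simp: t_def mult_ac\<close>)
        then show ?thesis using cell0 by (simp add: t_def sum_distrib_left distrib_left mult_ac)
      qed
      finally have "E x = f x * of_real c * H z0 (x - p z0)"
        unfolding E_def FV taylor[of x z0] by (simp add: algebra_simps)
      moreover have "(\<Sum>z\<in>I. indicator (cell z) x * (cmod (H z (x - p z)))\<^sup>2) = (\<Sum>z\<in>{z0}. indicator (cell z) x * (cmod (H z (x - p z)))\<^sup>2)"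
        by (rule sum.mono_neutral_right) (use finI z0I other in auto)
      ultimately show ?thesis using cell0 c by (simp add: norm_mult power_mult_distrib)
    qed
    have "ennreal ((norm (abs_l2 E))\<^sup>2) = (\<integral>\<^sup>+x. ennreal ((cmod (E x))\<^sup>2) \<partial>lborel)"
      by (rule nn_norm_abs_l2[OF Ei, symmetric])
    also have "\<dots> \<le> (\<integral>\<^sup>+x. (\<Sum>z\<in>I. ennreal (indicator (cell z) x * (A\<^sup>2 * c\<^sup>2 * (cmod (H z (x - p z)))\<^sup>2))) \<partial>lborel)"
    proof (rule nn_integral_mono_AE)
      have "AE x in lborel. cmod (f x) \<le> A" using f(1) by (simp add: ess_bounded_def)
      then show "AE x in lborel. ennreal ((cmod (E x))\<^sup>2) \<le> (\<Sum>z\<in>I. ennreal (indicator (cell z) x * (A\<^sup>2 * c\<^sup>2 * (cmod (H z (x - p z)))\<^sup>2)))"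
      proof eventually_elim
        case (elim x)
        have "(cmod (E x))\<^sup>2 \<le> (cmod (f x))\<^sup>2 * (c\<^sup>2 * (\<Sum>z\<in>I. indicator (cell z) x * (cmod (H z (x - p z)))\<^sup>2))" by (rule Ept)
        also have "\<dots> \<le> A\<^sup>2 * (c\<^sup>2 * (\<Sum>z\<in>I. indicator (cell z) x * (cmod (H z (x - p z)))\<^sup>2))"
          by (intro mult_right_mono power_mono elim mult_nonneg_nonneg sum_nonneg) auto
        also have "\<dots> = (\<Sum>z\<in>I. indicator (cell z) x * (A\<^sup>2 * c\<^sup>2 * (cmod (H z (x - p z)))\<^sup>2))"
          by (simp add: sum_distrib_left mult_ac)
        finally show ?case by (subst sum_ennreal) (auto intro: ennreal_leI)
      qed
    qed
    also have "\<dots> = (\<Sum>z\<in>I. \<integral>\<^sup>+x. ennreal (indicator (cell z) x * (A\<^sup>2 * c\<^sup>2 * (cmod (H z (x - p z)))\<^sup>2)) \<partial>lborel)"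
      by (rule nn_integral_sum) measurable
    \<comment> \<open>Every cell is translated to \<open>Q\<close>, after which sum and integral are
      exchanged and \<open>bound\<close> applies for each y.\<close>
    also have "\<dots> = (\<Sum>z\<in>I. \<integral>\<^sup>+y. ennreal (indicator Q y * (A\<^sup>2 * c\<^sup>2 * (cmod (H z y))\<^sup>2)) \<partial>lborel)"
    proof (rule sum.cong[OF refl])
      fix z
      have "(\<integral>\<^sup>+x. ennreal (indicator (cell z) x * (A\<^sup>2 * c\<^sup>2 * (cmod (H z (x - p z)))\<^sup>2)) \<partial>lborel)
          = (\<integral>\<^sup>+y. ennreal (indicator (cell z) (p z + y) * (A\<^sup>2 * c\<^sup>2 * (cmod (H z (p z + y - p z)))\<^sup>2)) \<partial>lborel)"
        by (rule nn_integral_lborel_shift) measurable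
      then show "(\<integral>\<^sup>+x. ennreal (indicator (cell z) x * (A\<^sup>2 * c\<^sup>2 * (cmod (H z (x - p z)))\<^sup>2)) \<partial>lborel)
          = (\<integral>\<^sup>+y. ennreal (indicator Q y * (A\<^sup>2 * c\<^sup>2 * (cmod (H z y))\<^sup>2)) \<partial>lborel)"
        by (simp add: indicator_def cellQ)
    qed
    also have "\<dots> = (\<integral>\<^sup>+y. (\<Sum>z\<in>I. ennreal (indicator Q y * (A\<^sup>2 * c\<^sup>2 * (cmod (H z y))\<^sup>2))) \<partial>lborel)"
      by (rule nn_integral_sum[symmetric]) (simp add: Q_def)
    also have "\<dots> \<le> (\<integral>\<^sup>+y. ennreal (A\<^sup>2 * c\<^sup>2 * ((2 * pi * real N) ^ d * (\<beta> * norm u)\<^sup>2)) * indicator Q y \<partial>lborel)"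
    proof (rule nn_integral_mono)
      fix y
      have "(\<Sum>z\<in>I. indicator Q y * (A\<^sup>2 * c\<^sup>2 * (cmod (H z y))\<^sup>2)) \<le> A\<^sup>2 * c\<^sup>2 * ((2 * pi * real N) ^ d * (\<beta> * norm u)\<^sup>2) * indicator Q y"
        using mult_left_mono[OF bound, of y "A\<^sup>2 * c\<^sup>2"] by (auto simp: indicator_def sum_distrib_left)
      then show "(\<Sum>z\<in>I. ennreal (indicator Q y * (A\<^sup>2 * c\<^sup>2 * (cmod (H z y))\<^sup>2))) \<le> ennreal (A\<^sup>2 * c\<^sup>2 * ((2 * pi * real N) ^ d * (\<beta> * norm u)\<^sup>2)) * indicator Q y"
        by (subst sum_ennreal) (auto simp: indicator_def intro: ennreal_leI)
    qed
    also have "\<dots> = ennreal (A\<^sup>2 * c\<^sup>2 * ((2 * pi * real N) ^ d * (\<beta> * norm u)\<^sup>2)) * emeasure lborel Q"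
      by (rule nn_integral_cmult_indicator) (simp add: Q_def)
    also have "\<dots> \<le> ennreal (A\<^sup>2 * c\<^sup>2 * ((2 * pi * real N) ^ d * (\<beta> * norm u)\<^sup>2)) * ennreal ((1 / real N) ^ d)"
      unfolding Q_def cell_def d_def by (rule mult_left_mono[OF lattice_cell_emeasure[OF Nr]]) simp
    also have "\<dots> = ennreal ((c\<^sup>2 * (2 * pi) ^ d) * (A * \<beta> * norm u)\<^sup>2)"
    proof -
      have "A\<^sup>2 * c\<^sup>2 * ((2 * pi * real N) ^ d * (\<beta> * norm u)\<^sup>2) * (1 / real N) ^ d = (c\<^sup>2 * (2 * pi) ^ d) * (A * \<beta> * norm u)\<^sup>2"
        using Nr by (simp add: power_mult_distrib power_one_over mult_ac)
      then show ?thesis by (subst ennreal_mult[symmetric]) (use Nr in auto)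
    qed
    also have "c\<^sup>2 * (2 * pi) ^ d = 1" unfolding c_def d_def by (rule fourier_const_power2)
    finally have "(norm (abs_l2 E))\<^sup>2 \<le> (A * \<beta> * norm u)\<^sup>2" by (simp add: ennreal_le_iff)
    then have "norm (abs_l2 E) \<le> A * \<beta> * norm u"
      by (rule power2_le_imp_le) (use A0 \<beta>0 in simp)
    then show ?thesis by (simp only: Eabs)
  qed
  from rank_approx_index[OF finJ cardJ this]
  show ?thesis by (simp add: \<beta>_def d_def)
qed

section \<open>The commutators\<close>

definition bessel_symbol :: "'a::euclidean_space \<Rightarrow> complex" where
  "bessel_symbol s = of_real (1 / sqrt (1 + (norm s)\<^sup>2))"

lemma bessel_potential_alt: "bessel_potential = fourier_multiplier bessel_symbol"
proof -
  have "(1 + (norm s)\<^sup>2) powr (- 1 / 2) = 1 / sqrt (1 + (norm s)\<^sup>2)" for s :: 'a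
    using powr_minus_divide[of "1 + (norm s)\<^sup>2" "1 / 2"] by (simp add: powr_half_sqrt)
  then have "(\<lambda>s::'a. complex_of_real ((1 - - (norm s)\<^sup>2) powr (- 1 / 2))) = bessel_symbol"
    by (auto simp: bessel_symbol_def)
  then show ?thesis by (simp only: bessel_potential_def laplacian_calculus_def)
qed

lemma sqrt_one_plus_gt: "norm s < sqrt (1 + (norm s)\<^sup>2)" for s :: "'a::euclidean_space"
  by (rule real_less_rsqrt) simp

text \<open>The third bound is of second order: on |s| \<ge> \<kappa> N the Bessel symbol differs
  from the homogeneous 1 / |s| by O(N^(-2)), which is below the admissible o(1/N). It rests on
  sqrt(1 + r^2) \<le> r + 1.\<close>

lemma bessel_symbol_bounds:
  fixes s :: "'a::euclidean_space"
  shows "cmod (bessel_symbol s) \<le> 1" "cmod (bessel_symbol s) * norm s \<le> 1"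
    "s \<noteq> 0 \<Longrightarrow> cmod (bessel_symbol s - of_real (1 / norm s)) \<le> 1 / (norm s)\<^sup>2"
proof -
  let ?r = "sqrt (1 + (norm s)\<^sup>2)"
  have r: "1 \<le> ?r" "norm s \<le> ?r" using sqrt_one_plus_gt[of s] by auto
  show "cmod (bessel_symbol s) \<le> 1"
    using frac_le[OF zero_le_one order_refl zero_less_one r(1)] by (simp add: bessel_symbol_def norm_divide)
  have "norm s / ?r \<le> ?r / ?r" using r by (intro divide_right_mono) auto
  also have "?r / ?r = 1" using r(1) by (intro divide_self) linarith
  finally show "cmod (bessel_symbol s) * norm s \<le> 1" by (simp add: bessel_symbol_def norm_divide)
  assume "s \<noteq> 0"
  then have n: "norm s > 0" by simp
  have r2: "?r\<^sup>2 = 1 + (norm s)\<^sup>2" by simp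
  have up: "?r \<le> norm s + 1"
    by (rule real_le_lsqrt) (auto simp: power2_eq_square algebra_simps)
  have "cmod (bessel_symbol s - of_real (1 / norm s)) = \<bar>1 / ?r - 1 / norm s\<bar>"
    unfolding bessel_symbol_def of_real_diff[symmetric] norm_of_real ..
  also have "\<dots> = (?r - norm s) / (norm s * ?r)"
  proof -
    have "\<bar>1 / a - 1 / b\<bar> = (a - b) / (b * a)" if "0 < b" "b \<le> a" for a b :: real
    proof -
      have "1 / a - 1 / b = - ((a - b) / (b * a))" using that by (simp add: field_simps)
      then show ?thesis using that by (simp only: abs_minus_cancel) (simp add: abs_of_nonneg)
    qed
    then show ?thesis using n r(2) .
  qed
  also have "\<dots> \<le> 1 / (norm s * norm s)"
    using n r up by (intro frac_le mult_left_mono mult_pos_pos) auto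
  finally show "cmod (bessel_symbol s - of_real (1 / norm s)) \<le> 1 / (norm s)\<^sup>2" by (simp add: power2_eq_square)
qed

lemma bessel_symbol_measurable [measurable]: "bessel_symbol \<in> borel_measurable borel"
  unfolding bessel_symbol_def by measurable

lemma ess_bounded_bessel_symbol: "ess_bounded 1 bessel_symbol"
  by (simp add: ess_bounded_def bessel_symbol_bounds)

lemma ess_boundedI:
  "m \<in> borel_measurable borel \<Longrightarrow> (\<And>x. cmod (m x) \<le> C) \<Longrightarrow> ess_bounded C m"
  by (simp add: ess_bounded_def)

lemma square_integrable_bounded_on_cball:
  fixes h :: "'a::euclidean_space \<Rightarrow> complex"
  assumes "ess_bounded C h" "\<And>s. R < norm s \<Longrightarrow> h s = 0"
  shows "square_integrable h"
proof -
  have "(\<lambda>s. h s * indicator (cball 0 R) s) = h" using assms(2) by (auto simp: indicator_def fun_eq_iff)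
  then show ?thesis
    using square_integrable_ess_bounded_mult(1)[OF assms(1) square_integrable_indicator_cball[of 0 R]] by simp
qed

lemma mult_op_scale:
  assumes "ess_bounded C m"
  shows "mult_op (\<lambda>x. k * m x) u = scaleC k (mult_op m u)"
proof (induction u rule: l2_abs_induct)
  case (abs U)
  have km: "ess_bounded (cmod k * C) (\<lambda>x. k * m x)"
    using ess_bounded_mult[OF ess_boundedI[of "\<lambda>_. k" "cmod k"] assms] by simp
  show ?case
    by (simp add: mult_op_abs[OF km abs] mult_op_abs[OF assms abs]
        abs_l2_scaleC square_integrable_ess_bounded_mult(1)[OF assms abs] mult.assoc)
qed

lemma fourier_multiplier_scale:
  "ess_bounded C m \<Longrightarrow> fourier_multiplier (\<lambda>x. k * m x) u = scaleC k (fourier_multiplier m u)"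
  by (simp add: fourier_multiplier_def mult_op_scale clinear_scaleC[OF clinear_inv_fourier])

lemma infinitesimal_rank_commutator:
  fixes f \<gamma> :: "'a::euclidean_space \<Rightarrow> complex" and R :: nat
  assumes f: "ess_bounded A f" "\<And>x. real R < norm x \<Longrightarrow> f x = 0"
    and \<gamma> [measurable]: "\<gamma> \<in> borel_measurable borel" and \<gamma>B: "\<And>s. cmod (\<gamma> s) \<le> B"
    and hom: "\<And>t s. t > 0 \<Longrightarrow> \<gamma> (t *\<^sub>R s) = \<gamma> s"
  shows "infinitesimal_rank (commutator (mult_op f) (fourier_multiplier (\<lambda>s. \<gamma> s * bessel_symbol s)))"
proof -
  let ?d = "DIM('a)"
  \<comment> \<open>K N^d is the rank spent on low frequencies in one order of the factors; the
    total 2 K + 4 adds the other order and the four Hilbert-Schmidt terms of the middle band. None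
    of it depends on \<eta>.\<close>
  define K where "K = (2 * R + 1) ^ ?d * (?d + 1)"
  define m where "m = (\<lambda>s. \<gamma> s * bessel_symbol s)"
  have A0: "0 \<le> A" by (rule ess_bounded_nonneg[OF f(1)])
  have B0: "0 \<le> B" using order_trans[OF norm_ge_zero \<gamma>B[of 0]] .
  have fi: "square_integrable f" by (rule square_integrable_bounded_on_cball[OF f])
  have mB: "cmod (m s) \<le> B" "cmod (m s) * norm s \<le> B" for s
  proof -
    show "cmod (m s) \<le> B"
      using mult_mono[OF \<gamma>B[of s] bessel_symbol_bounds(1)[of s] B0 norm_ge_zero] by (simp add: m_def norm_mult)
    show "cmod (m s) * norm s \<le> B"
      using mult_mono[OF \<gamma>B[of s] bessel_symbol_bounds(2)[of s] B0] by (simp add: m_def norm_mult mult.assoc)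
  qed
  have [measurable]: "m \<in> borel_measurable borel" unfolding m_def by measurable
  have "\<forall>\<^sub>F N in sequentially. rank_approx (commutator (mult_op f) (fourier_multiplier m)) ((2 * K + 4) * N ^ ?d) (\<eta> / real N)"
    if \<eta>: "\<eta> > 0" for \<eta>
  proof -
    \<comment> \<open>The two low-frequency errors add up to A B d \<kappa> / N and are allotted one
      third of \<eta> / N. The 1 in the denominator guards against A B = 0, and
      \<open>rank_approx_low_frequency\<close> asks for \<kappa> \<le> 1.\<close>
    define \<kappa> where "\<kappa> = min 1 (\<eta> / (3 * (A * B * ?d + 1)))"
    have p: "3 * (A * B * ?d + 1) > 0" using A0 B0 by (simp add: add_nonneg_pos)
    have \<kappa>: "0 < \<kappa>" "\<kappa> \<le> 1" using \<eta> p by (auto simp: \<kappa>_def)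
    have \<kappa>\<eta>: "A * B * ?d * \<kappa> \<le> \<eta> / 3"
    proof -
      have "\<kappa> * (3 * (A * B * ?d + 1)) \<le> \<eta>" using p by (simp add: \<kappa>_def min_def pos_le_divide_eq) 
      then show ?thesis using \<kappa> by (simp add: algebra_simps)
    qed
    \<comment> \<open>The high part has a symbol of size at most B / (\<Lambda> N) and enters twice,
      for another third: 6 = 2 * 3. The summand 1 gives \<Lambda> \<ge> 1.\<close>
    define \<Lambda> where "\<Lambda> = 6 * A * B / \<eta> + 1"
    have \<Lambda>: "1 \<le> \<Lambda>" using A0 B0 \<eta> by (simp add: \<Lambda>_def)
    have \<Lambda>\<eta>: "2 * (A * (B / \<Lambda>)) \<le> \<eta> / 3"
    proof -
      have "6 * A * B \<le> \<eta> * \<Lambda>" using \<eta> by (simp add: \<Lambda>_def distrib_left)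
      then show ?thesis using \<Lambda> by (simp add: field_simps)
    qed
    \<comment> \<open>The two cut-offs make q bounded and square-integrable; \<kappa> and \<Lambda>
      are fixed before N, so q does not depend on N.\<close>
    define q where "q = (\<lambda>s::'a. if \<kappa> \<le> norm s \<and> norm s < \<Lambda> then \<gamma> s / of_real (norm s) else 0)"
    have qb: "ess_bounded (B / \<kappa>) q"
    proof (rule ess_boundedI)
      show "cmod (q s) \<le> B / \<kappa>" for s
        using \<kappa> B0 \<gamma>B[of s] by (auto simp: q_def norm_divide intro!: frac_le)
      show "q \<in> borel_measurable borel" unfolding q_def by measurable
    qed
    have qi: "square_integrable q" by (rule square_integrable_bounded_on_cball[OF qb, of \<Lambda>]) (simp add: q_def)
    have \<eta>3: "\<eta> / 3 > 0" using \<eta> by simp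
    \<comment> \<open>For N \<ge> \<Lambda> / \<kappa>^2, any s with |s| \<ge> \<kappa> N has |s|^2
      \<ge> \<Lambda> N; then replacing the Bessel symbol by 1 / |s| costs no more than the bound
      for the high part.\<close>
    obtain N1 :: nat where N1: "\<Lambda> / \<kappa>\<^sup>2 \<le> N1" using real_arch_simple by blast
    show ?thesis
      using rank_approx_commutator_scaled[OF f(1) fi qb qi \<eta>3] eventually_ge_at_top[of "max 1 N1"]
    proof eventually_elim
      case (elim N)
      then have N: "N > 0" and Nr: "real N > 0" and NN1: "\<Lambda> / \<kappa>\<^sup>2 \<le> real N" using N1 by auto
      let ?D = fourier_multiplier and ?M = "mult_op f"
      define mL where "mL = (\<lambda>s. if norm s < \<kappa> * real N then m s else 0)"
      define qN where "qN = (\<lambda>s::'a. q (s /\<^sub>R real N))"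
      define mM where "mM = (\<lambda>s. of_real (1 / real N) * qN s)"
      \<comment> \<open>Besides the high frequencies, \<open>mH\<close> contains, on the middle
        band, the error of replacing the Bessel symbol by 1 / |s|.\<close>
      define mH where "mH = (\<lambda>s. m s - mL s - mM s)"
      have qNb: "ess_bounded (B / \<kappa>) qN" unfolding qN_def by (rule ess_bounded_scaled[OF qb N])
      have mLb: "ess_bounded B mL"
        by (rule ess_boundedI) (use mB B0 in \<open>auto simp: mL_def\<close>)
      have mMb: "ess_bounded (1 / real N * (B / \<kappa>)) mM"
        unfolding mM_def by (rule ess_bounded_mult[OF ess_boundedI qNb]) (use Nr in \<open>auto simp: norm_divide\<close>)
      \<comment> \<open>Homogeneity of \<gamma> lets the dilation act on 1 / |s| alone, where it
        cancels the factor 1 / N.\<close>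
      have mM: "mM s = (if \<kappa> * real N \<le> norm s \<and> norm s < \<Lambda> * real N then \<gamma> s / of_real (norm s) else 0)" for s
        using hom[of "inverse (real N)" s] Nr by (simp add: mM_def qN_def q_def field_simps)
      have mHb: "ess_bounded (B / (\<Lambda> * real N)) mH"
      proof (rule ess_boundedI)
        show "mH \<in> borel_measurable borel"
          unfolding mH_def using mLb mMb by (intro borel_measurable_diff) (auto simp: ess_bounded_def)
        fix s :: 'a
        have \<Lambda>N: "\<Lambda> * real N > 0" using \<Lambda> Nr by simp
        consider "norm s < \<kappa> * real N" | "\<kappa> * real N \<le> norm s" "norm s < \<Lambda> * real N" | "\<kappa> * real N \<le> norm s" "\<Lambda> * real N \<le> norm s"
          by linarith
        then show "cmod (mH s) \<le> B / (\<Lambda> * real N)"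
        proof cases
          case 1
          then show ?thesis using B0 \<Lambda>N by (simp add: mH_def mL_def mM)
        next
          case 2
          have \<kappa>N: "\<kappa> * real N > 0" using \<kappa> Nr by simp
          then have s0: "s \<noteq> 0" using 2 by auto
          have "mH s = \<gamma> s * (bessel_symbol s - of_real (1 / norm s))"
            using 2 by (simp add: mH_def mL_def mM m_def right_diff_distrib)
          then have "cmod (mH s) \<le> B * (1 / (norm s)\<^sup>2)"
            using mult_mono[OF \<gamma>B[of s] bessel_symbol_bounds(3)[OF s0] B0] by (simp add: norm_mult)
          also have "\<dots> \<le> B * (1 / (\<Lambda> * real N))"
          proof (intro mult_left_mono divide_left_mono)
            have "\<Lambda> * real N \<le> (\<kappa>\<^sup>2 * real N) * real N"
              using NN1 \<kappa> Nr by (intro mult_right_mono) (auto simp: pos_divide_le_eq mult.commute)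
            also have "\<dots> = (\<kappa> * real N)\<^sup>2" by (simp add: power2_eq_square)
            also have "\<dots> \<le> (norm s)\<^sup>2" using 2 \<kappa>N by (intro power_mono) auto
            finally show "\<Lambda> * real N \<le> (norm s)\<^sup>2" .
            show "0 < (norm s)\<^sup>2 * (\<Lambda> * real N)" using s0 \<Lambda>N by simp
          qed (use B0 in auto)
          finally show ?thesis by simp
        next
          case 3
          have "cmod (m s) * (\<Lambda> * real N) \<le> cmod (m s) * norm s" using 3 by (intro mult_left_mono) auto
          also have "\<dots> \<le> B" by (rule mB)
          finally show ?thesis using 3 \<Lambda>N by (simp add: mH_def mL_def mM pos_le_divide_eq)
        qed
      qed
      have mLi: "square_integrable mL"
        by (rule square_integrable_bounded_on_cball[OF mLb, of "\<kappa> * real N"]) (simp add: mL_def)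
      have mL1: "cmod (mL s) * norm s \<le> B" for s using mB(2)[of s] B0 by (simp add: mL_def)
      have mL0: "mL s = 0" if "\<kappa> * real N < norm s" for s using that by (simp add: mL_def)
      let ?e = "A * (B * \<kappa> * ?d / 2) / real N"
      have r1: "rank_approx (\<lambda>u. ?M (?D mL u)) (K * N ^ ?d) ?e"
        unfolding K_def
        by (rule rank_approx_low_frequency[OF N f(1) fi f(2) mLb mLi mL1 mL0 less_imp_le[OF \<kappa>(1)] \<kappa>(2)])
      \<comment> \<open>Conjugate symbols, because the opposite order of the factors is obtained as
        an adjoint.\<close>
      have r1': "rank_approx (\<lambda>u. mult_op (\<lambda>x. cnj (f x)) (?D (\<lambda>s. cnj (mL s)) u)) (K * N ^ ?d) ?e"
        unfolding K_def
        by (rule rank_approx_low_frequency[OF N ess_bounded_cnj[OF f(1)] square_integrable_cnj[OF fi] _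
              ess_bounded_cnj[OF mLb] square_integrable_cnj[OF mLi] _ _ less_imp_le[OF \<kappa>(1)] \<kappa>(2)])
           (simp_all add: f(2) mL1 mL0)
      have r2: "rank_approx (\<lambda>u. ?D mL (?M u)) (K * N ^ ?d) ?e"
        by (rule rank_approx_adjoint[OF r1' cinner_mult_multiplier[OF f(1) mLb]])
           (use A0 B0 \<kappa> in simp)
      have H: "norm (?M (?D mH u)) \<le> A * (B / (\<Lambda> * real N)) * norm u" "norm (?D mH (?M u)) \<le> A * (B / (\<Lambda> * real N)) * norm u" for u
      proof -
        have "norm (?M (?D mH u)) \<le> A * norm (?D mH u)" by (rule norm_mult_op[OF f(1)])
        also have "\<dots> \<le> A * (B / (\<Lambda> * real N) * norm u)" by (rule mult_left_mono[OF norm_fourier_multiplier[OF mHb] A0])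
        finally show "norm (?M (?D mH u)) \<le> A * (B / (\<Lambda> * real N)) * norm u" by simp
        have "norm (?D mH (?M u)) \<le> B / (\<Lambda> * real N) * norm (?M u)" by (rule norm_fourier_multiplier[OF mHb])
        also have "\<dots> \<le> B / (\<Lambda> * real N) * (A * norm u)" by (rule mult_left_mono[OF norm_mult_op[OF f(1)] ess_bounded_nonneg[OF mHb]])
        finally show "norm (?D mH (?M u)) \<le> A * (B / (\<Lambda> * real N)) * norm u" by (simp add: mult_ac)
      qed
      have r3: "rank_approx (\<lambda>u. ?M (?D mH u) - ?D mH (?M u)) (0 + 0) (A * (B / (\<Lambda> * real N)) + A * (B / (\<Lambda> * real N)))"
        by (rule rank_approx_diff[OF rank_approx_norm[OF H(1)] rank_approx_norm[OF H(2)]])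
      have r4: "rank_approx (\<lambda>u. scaleC (of_real (1 / real N)) (commutator ?M (?D qN) u)) (4 * N ^ ?d) (1 / real N * (\<eta> / 3))"
        by (rule rank_approx_compose[OF elim(1)[folded qN_def]])
           (use Nr in \<open>simp_all add: clinear_def l2.scale_right_distrib mult.commute norm_scaleC norm_divide\<close>)
      have Dsplit: "?D m w = ?D mL w + ?D mM w + ?D mH w" for w
      proof -
        have "?D (\<lambda>s. (mL s + mM s) + mH s) w = ?D mL w + ?D mM w + ?D mH w"
          by (simp only: fourier_multiplier_add[OF ess_bounded_add[OF mLb mMb] mHb] fourier_multiplier_add[OF mLb mMb])
        then show ?thesis by (simp add: mH_def)
      qed
      have DM: "?D mM w = scaleC (of_real (1 / real N)) (?D qN w)" for w
        unfolding mM_def by (rule fourier_multiplier_scale[OF qNb])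
      note lin = clinear_add[OF clinear_mult_op[OF f(1)]] clinear_scaleC[OF clinear_mult_op[OF f(1)]]
      have split: "commutator ?M (?D m) = (\<lambda>u. ((?M (?D mL u) - ?D mL (?M u)) + (?M (?D mH u) - ?D mH (?M u)))
          + scaleC (of_real (1 / real N)) (commutator ?M (?D qN) u))"
        unfolding commutator_def Dsplit DM lin l2.scale_right_diff_distrib by (rule ext) simp
      have err: "?e + ?e + (A * (B / (\<Lambda> * real N)) + A * (B / (\<Lambda> * real N))) + 1 / real N * (\<eta> / 3) \<le> \<eta> / real N"
      proof -
        have "?e + ?e + (A * (B / (\<Lambda> * real N)) + A * (B / (\<Lambda> * real N))) + 1 / real N * (\<eta> / 3)
            = (A * B * ?d * \<kappa> + 2 * (A * (B / \<Lambda>)) + \<eta> / 3) / real N"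
          using Nr \<Lambda> by (simp add: field_simps)
        also have "\<dots> \<le> \<eta> / real N" using \<kappa>\<eta> \<Lambda>\<eta> Nr by (intro divide_right_mono) auto
        finally show ?thesis .
      qed
      show ?case
        unfolding split
        by (rule rank_approx_mono[OF rank_approx_add[OF rank_approx_add[OF rank_approx_diff[OF r1 r2] r3] r4] _ err])
           (simp add: algebra_simps)
    qed
  qed
  then show ?thesis unfolding infinitesimal_rank_def m_def by blast
qed

section \<open>Symbols on the sphere and the two commutators\<close>

lemma sphere_projection_measurable:
  "(\<lambda>x. x /\<^sub>R norm x) \<in> restrict_space lborel (cball 0 1 - {0}) \<rightarrow>\<^sub>M restrict_space borel (sphere (0::'a::euclidean_space) 1)"
proof (rule measurable_restrict_space2)
  show "(\<lambda>x. x /\<^sub>R norm x) \<in> borel_measurable (restrict_space lborel (cball (0::'a) 1 - {0}))"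
    by (rule measurable_restrict_space1) measurable
qed (auto simp: space_restrict_space)

lemma sets_sphere_measure: "sets (sphere_measure :: 'a::euclidean_space measure) = sets (restrict_space borel (sphere 0 1))"
  by (simp add: sphere_measure_def)

text \<open>A null set of the sphere spans a null cone: cut off at radius 1 this is the definition of the cone
  measure, and the whole cone is a countable union of dilates.\<close>

lemma AE_sphere_measure_cone:
  assumes "AE \<theta> in (sphere_measure :: 'a::euclidean_space measure). P \<theta>"
  shows "AE s in lborel. s \<noteq> 0 \<longrightarrow> P (s /\<^sub>R norm (s::'a))"
proof -
  let ?h = "\<lambda>x::'a. x /\<^sub>R norm x" and ?U = "cball 0 1 - {0::'a}"
  have space: "space (sphere_measure :: 'a measure) = sphere 0 1"
    by (simp add: sphere_measure_def space_scale_measure space_restrict_space)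
  obtain N where N: "N \<in> null_sets (sphere_measure :: 'a measure)" "{\<theta> \<in> sphere 0 1. \<not> P \<theta>} \<subseteq> N"
    using assms unfolding eventually_ae_filter space by auto
  have Ns: "N \<in> sets (restrict_space borel (sphere 0 1))" using N(1) by (auto simp: sets_sphere_measure[symmetric])
  have U: "?U \<in> sets lborel" by simp
  have "emeasure (distr (restrict_space lborel ?U) (restrict_space borel (sphere 0 1)) ?h) N = 0"
    using N(1) by (auto simp: sphere_measure_def null_sets_def emeasure_scale_measure)
  then have z: "emeasure lborel (?h -` N \<inter> ?U) = 0"
    by (simp add: emeasure_distr[OF sphere_projection_measurable Ns] space_restrict_space emeasure_restrict_space U)
  have ms: "?h -` N \<inter> ?U \<in> sets lborel"
    using measurable_sets[OF sphere_projection_measurable Ns] U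
    by (simp add: space_restrict_space sets_restrict_space_iff)
  have "AE s in lborel. s \<notin> ?h -` N \<inter> ?U" by (rule AE_not_in) (use z ms in \<open>simp add: null_sets_def\<close>)
  then have "AE s in lborel. 0 + (1 / real (Suc n)) *\<^sub>R s \<notin> ?h -` N \<inter> ?U" for n
    by (intro AE_lborel_affine) auto
  then have "AE s in lborel. \<forall>n. 0 + (1 / real (Suc n)) *\<^sub>R s \<notin> ?h -` N \<inter> ?U"
    by (simp only: AE_all_countable) simp
  then show ?thesis
  proof eventually_elim
    case (elim s)
    show ?case
    proof
      assume s: "s \<noteq> 0"
      obtain n :: nat where n: "norm s \<le> n" using real_arch_simple by blast
      have "(1 / real (Suc n)) *\<^sub>R s \<in> ?U" using s n by simp
      moreover have "?h ((1 / real (Suc n)) *\<^sub>R s) = ?h s" using s by (simp add: inverse_eq_divide)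
      ultimately have "?h s \<notin> N" using elim[rule_format, of n] by auto
      moreover have "?h s \<in> sphere 0 1" using s by simp
      ultimately show "P (?h s)" using N(2) by blast
    qed
  qed
qed

lemma sphere_symbol_measurable:
  fixes g :: "'a::euclidean_space \<Rightarrow> complex"
  assumes g: "g \<in> borel_measurable sphere_measure"
  shows "(\<lambda>s. g (s /\<^sub>R norm s)) \<in> borel_measurable borel"
proof -
  obtain e :: 'a where e: "e \<in> Basis" using nonempty_Basis by blast
  \<comment> \<open>At the origin \<open>s /\<^sub>R norm s\<close> is 0, a point off the sphere,
    where measurability of g says nothing. So h sends the origin to a unit vector, and the value
    \<open>g 0\<close> is restored at the end.\<close>
  define h where "h = (\<lambda>s::'a. if s = 0 then e else s /\<^sub>R norm s)"
  have "h \<in> borel \<rightarrow>\<^sub>M restrict_space borel (sphere 0 1)"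
  proof (rule measurable_restrict_space2)
    show "h \<in> borel_measurable borel" unfolding h_def by measurable
  qed (use e in \<open>auto simp: h_def\<close>)
  moreover have "g \<in> borel_measurable (restrict_space borel (sphere 0 1))"
    using g by (simp add: measurable_cong_sets[OF sets_sphere_measure refl])
  ultimately have [measurable]: "(\<lambda>s. g (h s)) \<in> borel_measurable borel" by (rule measurable_compose)
  have "(\<lambda>s. g (s /\<^sub>R norm s)) = (\<lambda>s. if s = 0 then g 0 else g (h s))" by (auto simp: h_def)
  also have "\<dots> \<in> borel_measurable borel" by measurable
  finally show ?thesis .
qed

lemma commutator_multiplier_bounded:
  fixes f m :: "'a::euclidean_space \<Rightarrow> complex"
  assumes f: "ess_bounded A f" and m: "ess_bounded B m"
  shows "clinear (commutator (mult_op f) (fourier_multiplier m))"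
    "norm (commutator (mult_op f) (fourier_multiplier m) u) \<le> (2 * A * B) * norm u"
proof -
  note cf = clinear_mult_op[OF f] and cm = clinear_fourier_multiplier[OF m]
  show "clinear (commutator (mult_op f) (fourier_multiplier m))"
    unfolding commutator_def by (rule clinear_minus[OF clinear_compose[OF cf cm] clinear_compose[OF cm cf]])
  have "norm (mult_op f (fourier_multiplier m u)) \<le> A * (B * norm u)"
    by (rule order_trans[OF norm_mult_op[OF f] mult_left_mono[OF norm_fourier_multiplier[OF m] ess_bounded_nonneg[OF f]]])
  moreover have "norm (fourier_multiplier m (mult_op f u)) \<le> B * (A * norm u)"
    by (rule order_trans[OF norm_fourier_multiplier[OF m] mult_left_mono[OF norm_mult_op[OF f] ess_bounded_nonneg[OF m]]])
  ultimately show "norm (commutator (mult_op f) (fourier_multiplier m) u) \<le> (2 * A * B) * norm u"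
    unfolding commutator_def
    using norm_triangle_ineq4[of "mult_op f (fourier_multiplier m u)" "fourier_multiplier m (mult_op f u)"]
    by (simp add: mult_ac)
qed

theorem theorem4p1:
  fixes f g :: "real ^ 'n \<Rightarrow> complex"
  assumes "CARD('n) \<ge> 2"
    and "f \<in> L_infinity lborel" and "compactly_supported f"
    and "g \<in> L_infinity sphere_measure"
  shows "commutator (pi1 f \<circ> bessel_potential) (pi2 g) \<in> weak_schatten_0 (real CARD('n))
       \<and> commutator (pi1 f) (pi2 g \<circ> bessel_potential) \<in> weak_schatten_0 (real CARD('n))"
proof -
  obtain A where A: "ess_bounded A f"
    using assms(2) by (auto simp: L_infinity_def ess_bounded_def)
  obtain K where K: "compact K" "AE x in lborel. x \<notin> K \<longrightarrow> f x = 0"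
    using assms(3) by (auto simp: compactly_supported_def)
  obtain r where "\<And>x. x \<in> K \<Longrightarrow> norm x \<le> r" using compact_imp_bounded[OF K(1)] by (auto simp: bounded_iff)
  moreover obtain R :: nat where "r \<le> R" using real_arch_simple by blast
  ultimately have R: "\<And>x. x \<in> K \<Longrightarrow> norm x \<le> real R" by fastforce
  \<comment> \<open>A representative that vanishes everywhere outside a ball, as the estimates use a
    pointwise condition on the support.\<close>
  define f' where "f' = (\<lambda>x. indicator (cball 0 (real R)) x * f x)"
  have f': "ess_bounded A f'"
  proof -
    have "ess_bounded 1 (indicator (cball 0 (real R)) :: real ^ 'n \<Rightarrow> complex)"
      by (rule ess_boundedI) (auto simp: indicator_def intro!: borel_measurable_indicator)
    from ess_bounded_mult[OF this A] show ?thesis by (simp add: f'_def)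
  qed
  have f'0: "f' x = 0" if "real R < norm x" for x using that by (simp add: f'_def)
  have ff': "pi1 f = mult_op f'"
  proof
    show "pi1 f u = mult_op f' u" for u
      unfolding pi1_def
      by (rule mult_op_cong[OF _ A f']) (use K(2) R in \<open>auto simp: f'_def indicator_def elim!: eventually_mono\<close>)
  qed
  obtain C where g: "g \<in> borel_measurable sphere_measure" "AE \<theta> in sphere_measure. cmod (g \<theta>) \<le> C"
    using assms(4) by (auto simp: L_infinity_def)
  \<comment> \<open>The maximum makes B nonnegative, so that |\<gamma>| \<le> B also holds where
    \<gamma> is set to 0.\<close>
  define B where "B = max C 0"
  \<comment> \<open>A version of the symbol bounded everywhere. The test for exceptional points
    involves the direction alone, so \<gamma> stays homogeneous of degree 0.\<close>
  define \<gamma> where "\<gamma> = (\<lambda>s. if cmod (g (s /\<^sub>R norm s)) \<le> B then g (s /\<^sub>R norm s) else 0)"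
  note gm [measurable] = sphere_symbol_measurable[OF g(1)]
  have \<gamma>m [measurable]: "\<gamma> \<in> borel_measurable borel" unfolding \<gamma>_def by measurable
  have \<gamma>B: "cmod (\<gamma> s) \<le> B" for s by (simp add: \<gamma>_def B_def)
  have \<gamma>: "ess_bounded B \<gamma>" by (rule ess_boundedI[OF \<gamma>m \<gamma>B])
  have hom: "\<gamma> (t *\<^sub>R s) = \<gamma> s" if "t > 0" for t s
  proof -
    have "(t *\<^sub>R s) /\<^sub>R norm (t *\<^sub>R s) = s /\<^sub>R norm s" using that by (simp add: mult.commute[of _ t] mult.assoc[symmetric])
    then show ?thesis by (simp only: \<gamma>_def)
  qed
  have AEg: "AE s in lborel. cmod (g (s /\<^sub>R norm s)) \<le> B"
    using AE_sphere_measure_cone[OF g(2)] AE_lborel_singleton[of "0::real^'n"]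
    by eventually_elim (simp add: B_def)
  have pi2: "pi2 g = fourier_multiplier \<gamma>"
    unfolding pi2_def
  proof (rule fourier_multiplier_cong[OF _ _ \<gamma>])
    show "AE s in lborel. g (s /\<^sub>R norm s) = \<gamma> s" using AEg by eventually_elim (simp add: \<gamma>_def)
    show "ess_bounded B (\<lambda>s. g (s /\<^sub>R norm s))" using AEg gm by (simp add: ess_bounded_def)
  qed
  let ?b = "bessel_symbol :: real ^ 'n \<Rightarrow> complex"
  define m where "m = (\<lambda>s. \<gamma> s * ?b s)"
  have m: "ess_bounded (B * 1) m" unfolding m_def by (rule ess_bounded_mult[OF \<gamma> ess_bounded_bessel_symbol])
  let ?S = "commutator (mult_op f') (fourier_multiplier m)" and ?S1 = "commutator (mult_op f') (fourier_multiplier ?b)"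
  have S: "infinitesimal_rank ?S"
    unfolding m_def by (rule infinitesimal_rank_commutator[OF f' f'0 \<gamma>m \<gamma>B hom])
  \<comment> \<open>The Bessel symbol itself is the case \<gamma> = 1.\<close>
  have S1: "infinitesimal_rank ?S1"
    using infinitesimal_rank_commutator[OF f' f'0, where \<gamma>="\<lambda>_. 1" and B=1] by simp
  note lS = commutator_multiplier_bounded[OF f' m] and lS1 = commutator_multiplier_bounded[OF f' ess_bounded_bessel_symbol]
  have D\<gamma>: "fourier_multiplier \<gamma> (fourier_multiplier ?b u) = fourier_multiplier m u"
    "fourier_multiplier ?b (fourier_multiplier \<gamma> u) = fourier_multiplier m u" for u
    unfolding m_def
    by (simp_all add: fourier_multiplier_mult[OF \<gamma> ess_bounded_bessel_symbol]
        fourier_multiplier_mult[OF ess_bounded_bessel_symbol \<gamma>] mult.commute)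
  have 2: "commutator (pi1 f) (pi2 g \<circ> bessel_potential) = ?S"
    by (simp add: commutator_def ff' pi2 bessel_potential_alt D\<gamma>)
  \<comment> \<open>As the multipliers commute, f b(D) g(D) equals f m(D), and g(D) f b(D) equals
    g(D) [f, b(D)] + m(D) f.\<close>
  have 1: "commutator (pi1 f \<circ> bessel_potential) (pi2 g) = (\<lambda>u. ?S u - fourier_multiplier \<gamma> (?S1 u))"
    by (simp add: commutator_def ff' pi2 bessel_potential_alt D\<gamma> clinear_diff[OF clinear_fourier_multiplier[OF \<gamma>]])
  have "(\<lambda>u. ?S u - fourier_multiplier \<gamma> (?S1 u)) \<in> weak_schatten_0 (real DIM(real ^ 'n))"
  proof (rule weak_schatten_0I)
    show "clinear (\<lambda>u. ?S u - fourier_multiplier \<gamma> (?S1 u))"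
      by (rule clinear_minus[OF lS(1) clinear_compose[OF clinear_fourier_multiplier[OF \<gamma>] lS1(1)]])
    show "norm (?S u - fourier_multiplier \<gamma> (?S1 u)) \<le> (2 * A * (B * 1) + B * (2 * A * 1)) * norm u" for u
    proof -
      have "norm (fourier_multiplier \<gamma> (?S1 u)) \<le> B * ((2 * A * 1) * norm u)"
        by (rule order_trans[OF norm_fourier_multiplier[OF \<gamma>] mult_left_mono[OF lS1(2) ess_bounded_nonneg[OF \<gamma>]]])
      then show ?thesis
        using norm_triangle_ineq4[of "?S u" "fourier_multiplier \<gamma> (?S1 u)"] lS(2)[of u]
        by (simp add: distrib_right mult_ac)
    qed
    show "infinitesimal_rank (\<lambda>u. ?S u - fourier_multiplier \<gamma> (?S1 u))"
      by (rule infinitesimal_rank_diff[OF S infinitesimal_rank_compose[OF S1 clinear_fourier_multiplier[OF \<gamma>]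
            norm_fourier_multiplier[OF \<gamma>] ess_bounded_nonneg[OF \<gamma>]]])
  qed
  moreover have "?S \<in> weak_schatten_0 (real DIM(real ^ 'n))"
    by (rule weak_schatten_0I[OF lS S])
  ultimately show ?thesis by (simp add: 1 2)
qed

end
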